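(* Let $T\in(0,\infty)$, $d,m\in\mathbb{N}$, $\rho\in\mathbb{R}$, let $O\subset\mathbb{R}^d$ be an open set, let $\varphi\in C(O,\mathbb{R})$, $v\in C((0,T)\times O,\mathbb{R})$, let $\mu\colon(0,T)\times O\to\mathbb{R}^d$ and $\sigma\colon(0,T)\times O\to\mathbb{R}^{d\times m}$ be locally Lipschitz continuous functions and let $V\in C^2(O,(0,\infty))$ satisfy $$v(t,x)V(x)+\big\langle\mu(t,x),(\nabla V)(x)\big\rangle+\operatorname{tr}\big(\sigma(t,x)[\sigma(t,x)]^*(\operatorname{Hess}V)(x)\big)\le\rho\cdot V(x)$$ for all $(t,x)\in(0,T)\times O$. Then there exists at most one continuous function $u\colon[0,T]\times O\to\mathbb{R}$ which fulfills $u(0,x)=\varphi(x)$ for all $x\in O$, which fulfills $\lim_{n\to\infty}\sup_{(t,x)\in(0,T)\times O_n^c}\frac{|u(t,x)|}{V(x)}=0$ and which fulfills that $u|_{(0,T)\times O}$ is a viscosity solution of $$\frac{\partial}{\partial t}u(t,x)-v(t,x)u(t,x)-\big\langle\mu(t,x),(\nabla_xu)(t,x)\big\rangle-\operatorname{tr}\big(\sigma(t,x)[\sigma(t,x)]^*(\operatorname{Hess}_xu)(t,x)\big)=0$$ for $(t,x)\in(0,T)\times O$.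
   Context: Exhaustion of $O$: $O_n:=\{x\in O\colon\operatorname{dist}(x,\mathbb{R}^d\setminus O)\ge\frac1n\text{ and }\|x\|\le n\}$ and $O_n^c:=O\setminus O_n$ for $n\in\mathbb{N}$, where $\operatorname{dist}(x,A)=\inf(\{\|x-y\|\colon y\in A\}\cup\{\infty\})$. Convention: $\sup(\emptyset)=-\infty$. Viscosity solutions: for $n\in\mathbb{N}$ let $\mathbb{S}_n$ be the set of symmetric real $n\times n$ matrices, with $A\le B$ iff $\langle x,Ax\rangle\le\langle x,Bx\rangle$ for all $x\in\mathbb{R}^n$. Let $U\subset\mathbb{R}^n$ be open. A function $F\colon U\times\mathbb{R}\times\mathbb{R}^n\times\mathbb{S}_n\to\mathbb{R}$ is degenerate elliptic if $F(z,r,p,A)\le F(z,r,p,B)$ whenever $A\ge B$. For such $F$, a function $u\colon U\to\mathbb{R}$ is a viscosity subsolution of $F=0$ if $u$ is upper semicontinuous and $F(z,\phi(z),(\nabla\phi)(z),(\operatorname{Hess}\phi)(z))\le0$ for all $z\in U$ and all $\phi\in C^2(U,\mathbb{R})$ with $\phi\ge u$ and $\phi(z)=u(z)$; it is a viscosity supersolution of $F=0$ if $u$ is lower semicontinuous and $F(z,\phi(z),(\nabla\phi)(z),(\operatorname{Hess}\phi)(z))\ge0$ for all $z\in U$ and all $\phi\in C^2(U,\mathbb{R})$ with $\phi\le u$ and $\phi(z)=u(z)$; it is a viscosity solution if it is both. Here this is applied with $U=(0,T)\times O\subset\mathbb{R}^{d+1}$ and $z=(t,x)$. *)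

theory Defs
  imports "HOL-Analysis.Analysis"
begin

section \<open>Exhaustion of an open set\<close>

text \<open>The library's \<^const>\<open>infdist\<close> gives distance 0 to the empty set; here that distance
  has to be \<open>\<infinity>\<close> (relevant when the open set is the whole space).\<close>

definition ext_dist :: "'a::real_normed_vector \<Rightarrow> 'a set \<Rightarrow> ereal" where
  "ext_dist x A = Inf ((\<lambda>y. ereal (norm (x - y))) ` A \<union> {\<infinity>})"

definition exhaustion :: "'a::real_normed_vector set \<Rightarrow> nat \<Rightarrow> 'a set" where
  "exhaustion \<O> n = {x \<in> \<O>. ereal (1 / real n) \<le> ext_dist x (- \<O>) \<and> norm x \<le> real n}"

section \<open>Regularity of functions\<close>

definition locally_lipschitz_on :: "'a::metric_space set \<Rightarrow> ('a \<Rightarrow> 'b::metric_space) \<Rightarrow> bool" where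
  "locally_lipschitz_on U f \<longleftrightarrow> (\<forall>z\<in>U. \<exists>e>0. \<exists>L. L-lipschitz_on (ball z e \<inter> U) f)"

definition usc_on :: "'a::topological_space set \<Rightarrow> ('a \<Rightarrow> real) \<Rightarrow> bool" where
  "usc_on U u \<longleftrightarrow> (\<forall>z\<in>U. \<forall>c. u z < c \<longrightarrow> (\<forall>\<^sub>F w in at z within U. u w < c))"

definition lsc_on :: "'a::topological_space set \<Rightarrow> ('a \<Rightarrow> real) \<Rightarrow> bool" where
  "lsc_on U u \<longleftrightarrow> (\<forall>z\<in>U. \<forall>c. c < u z \<longrightarrow> (\<forall>\<^sub>F w in at z within U. c < u w))"

definition grad :: "('a::real_inner \<Rightarrow> real) \<Rightarrow> 'a \<Rightarrow> 'a" where
  "grad f x = (THE D. GDERIV f x :> D)"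

definition hess :: "(real^'n \<Rightarrow> real) \<Rightarrow> real^'n \<Rightarrow> real^'n^'n" where
  "hess f x = matrix (frechet_derivative (grad f) (at x))"

text \<open>Only meaningful for open \<open>U\<close>, where \<^term>\<open>grad f\<close> near a point of \<open>U\<close> depends
  only on the values of \<open>f\<close> in \<open>U\<close>.\<close>

definition C2_on :: "(real^'n) set \<Rightarrow> (real^'n \<Rightarrow> real) \<Rightarrow> bool" where
  "C2_on U f \<longleftrightarrow> (\<forall>x\<in>U. f differentiable (at x)) \<and> (\<forall>x\<in>U. grad f differentiable (at x)) \<and>
     continuous_on U (hess f)"

lemma grad_eqI: "GDERIV f x :> D \<Longrightarrow> grad f x = D"
  unfolding grad_def
proof (rule the_equality)
  fix E assume "GDERIV f x :> D" "GDERIV f x :> E"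
  then have "(\<lambda>h. h \<bullet> E) = (\<lambda>h. h \<bullet> D)"
    unfolding gderiv_def by (rule has_derivative_unique[rotated])
  then show "E = D"
    by (metis vector_eq_ldot)
qed

section \<open>Viscosity solutions\<close>

definition sym_mats :: "(real^'n^'n) set" where
  "sym_mats = {A. transpose A = A}"

definition loewner_le :: "real^'n^'n \<Rightarrow> real^'n^'n \<Rightarrow> bool" where
  "loewner_le A B \<longleftrightarrow> (\<forall>x. x \<bullet> (A *v x) \<le> x \<bullet> (B *v x))"

definition degenerate_elliptic ::
    "(real^'n) set \<Rightarrow> (real^'n \<Rightarrow> real \<Rightarrow> real^'n \<Rightarrow> real^'n^'n \<Rightarrow> real) \<Rightarrow> bool" where
  "degenerate_elliptic U F \<longleftrightarrow>
     (\<forall>z\<in>U. \<forall>r p. \<forall>A\<in>sym_mats. \<forall>B\<in>sym_mats. loewner_le B A \<longrightarrow> F z r p A \<le> F z r p B)"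

text \<open>The next three notions are meant for open \<open>U\<close> and degenerate elliptic \<open>F\<close>; the operator
  they are applied to below is shown to be degenerate elliptic.\<close>

definition viscosity_subsolution ::
    "(real^'n) set \<Rightarrow> (real^'n \<Rightarrow> real \<Rightarrow> real^'n \<Rightarrow> real^'n^'n \<Rightarrow> real) \<Rightarrow> (real^'n \<Rightarrow> real) \<Rightarrow> bool" where
  "viscosity_subsolution U F u \<longleftrightarrow> usc_on U u \<and>
     (\<forall>z\<in>U. \<forall>\<phi>. C2_on U \<phi> \<and> (\<forall>y\<in>U. \<phi> y \<ge> u y) \<and> \<phi> z = u z
        \<longrightarrow> F z (\<phi> z) (grad \<phi> z) (hess \<phi> z) \<le> 0)"

definition viscosity_supersolution ::
    "(real^'n) set \<Rightarrow> (real^'n \<Rightarrow> real \<Rightarrow> real^'n \<Rightarrow> real^'n^'n \<Rightarrow> real) \<Rightarrow> (real^'n \<Rightarrow> real) \<Rightarrow> bool" where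
  "viscosity_supersolution U F u \<longleftrightarrow> lsc_on U u \<and>
     (\<forall>z\<in>U. \<forall>\<phi>. C2_on U \<phi> \<and> (\<forall>y\<in>U. \<phi> y \<le> u y) \<and> \<phi> z = u z
        \<longrightarrow> F z (\<phi> z) (grad \<phi> z) (hess \<phi> z) \<ge> 0)"

definition viscosity_solution ::
    "(real^'n) set \<Rightarrow> (real^'n \<Rightarrow> real \<Rightarrow> real^'n \<Rightarrow> real^'n^'n \<Rightarrow> real) \<Rightarrow> (real^'n \<Rightarrow> real) \<Rightarrow> bool" where
  "viscosity_solution U F u \<longleftrightarrow> viscosity_subsolution U F u \<and> viscosity_supersolution U F u"

section \<open>Time and space in one vector\<close>

text \<open>The space of dimension \<open>d + 1\<close> is \<^typ>\<open>real^('d option)\<close>: coordinate \<^const>\<open>None\<close> is time,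
  the coordinates \<open>Some i\<close> are space.\<close>

definition join_tx :: "real \<times> (real^'d) \<Rightarrow> real^('d option)" where
  "join_tx tx = (\<chi> k. case k of None \<Rightarrow> fst tx | Some i \<Rightarrow> snd tx $ i)"

definition space_part :: "real^('d option) \<Rightarrow> real^'d" where
  "space_part p = (\<chi> i. p $ Some i)"

definition space_block :: "real^('d option)^('d option) \<Rightarrow> real^'d^'d" where
  "space_block A = (\<chi> i j. A $ Some i $ Some j)"

definition split_tx :: "real^('d option) \<Rightarrow> real \<times> (real^'d)" where
  "split_tx z = (z $ None, space_part z)"

lemma split_join_tx [simp]: "split_tx (join_tx tx) = tx"
  by (simp add: split_tx_def join_tx_def space_part_def prod_eq_iff vec_eq_iff)

lemma join_split_tx [simp]: "join_tx (split_tx z) = z"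
  by (simp add: split_tx_def join_tx_def space_part_def vec_eq_iff split: option.split)

text \<open>The function \<open>F\<close> for which \<open>F = 0\<close> is the equation
  \<open>\<partial>\<^sub>t u - v u - \<langle>\<mu>, \<nabla>\<^sub>x u\<rangle> - tr (\<sigma> \<sigma>\<^sup>* Hess\<^sub>x u) = 0\<close>.\<close>

definition kolmogorov_operator ::
    "(real \<times> (real^'d) \<Rightarrow> real) \<Rightarrow> (real \<times> (real^'d) \<Rightarrow> real^'d) \<Rightarrow> (real \<times> (real^'d) \<Rightarrow> real^'m^'d) \<Rightarrow>
     real^('d option) \<Rightarrow> real \<Rightarrow> real^('d option) \<Rightarrow> real^('d option)^('d option) \<Rightarrow> real" where
  "kolmogorov_operator v \<mu> \<sigma> z r p A =
     (let tx = split_tx z in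
      p $ None - v tx * r - \<mu> tx \<bullet> space_part p
        - trace (\<sigma> tx ** transpose (\<sigma> tx) ** space_block A))"

lemma trace_sandwich:
  fixes S :: "real^'m^'d" and A :: "real^'d^'d"
  shows "trace (S ** transpose S ** A) = (\<Sum>k\<in>UNIV. column k S \<bullet> (A *v column k S))"
proof -
  have "trace (S ** transpose S ** A) = trace (transpose S ** (A ** S))"
    by (metis matrix_mul_assoc trace_mul_sym)
  also have "\<dots> = (\<Sum>k\<in>UNIV. column k S \<bullet> (A *v column k S))"
    by (simp add: trace_def matrix_matrix_mult_def transpose_def inner_vec_def
        matrix_vector_mult_def column_def)
  finally show ?thesis .
qed

lemma space_block_inner:
  "x \<bullet> (space_block A *v x) = join_tx (0, x) \<bullet> (A *v join_tx (0, x))"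
  by (simp add: inner_vec_def matrix_vector_mult_def space_block_def join_tx_def UNIV_option_conv
      sum.reindex)

lemma degenerate_elliptic_kolmogorov_operator:
  "degenerate_elliptic U (kolmogorov_operator v \<mu> \<sigma>)"
  by (auto simp: degenerate_elliptic_def kolmogorov_operator_def Let_def trace_sandwich
      space_block_inner loewner_le_def intro!: sum_mono)

end

theory Submission
  imports Defs "HOL-Complex_Analysis.Great_Picard"
begin

text \<open>If two solutions \<open>u\<^sub>1\<close>, \<open>u\<^sub>2\<close> differ, then, up to exchanging them, \<open>(u\<^sub>1 - u\<^sub>2) (T - t) exp (- \<rho> t) / V\<close> has a
  positive maximum \<open>\<theta>\<close>, which is attained in the interior because of the initial condition and of the decay
  relative to \<open>V\<close>. So \<open>u\<^sub>1 - u\<^sub>2\<close> is touched from above by \<open>\<theta> exp (\<rho> t) V / (T - t)\<close>, a strict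
  supersolution. This is impossible because \<open>u\<^sub>1 - u\<^sub>2\<close> is a viscosity subsolution: the equation is linear, and
  its coefficients are locally Lipschitz (doubling of variables and the Crandall--Ishii lemma).

  The Crandall--Ishii lemma is obtained without Alexandrov's theorem. Lasry--Lions regularizations of
  the two functions are \<open>C\<^sup>1\<^sup>,\<^sup>1\<close>, the contact set of their doubled difference is not negligible (Jensen's lemma),
  and every non-negligible set contains points near which a Lipschitz gradient is almost linear on some
  small ball. The last fact is an \<open>L\<^sup>2\<close> energy argument for second differences at dyadic scales.\<close>

section \<open>Lipschitz maps are almost linear at small scales\<close>

text \<open>The definition of a viscosity solution tests with functions lying above or below on the
  whole domain, whereas all constructions here are local; the decay relative to \<open>V\<close>
  supplies a global C2 majorant \<open>k * V\<close>, which makes local touching sufficient. Time is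
  one more coordinate in which the second-order part degenerates, so one elliptic theorem on sums
  suffices. Since \<open>v\<close> has no sign, the equation need not be monotone in the unknown;
  linearity helps instead: the test function is moved into the first subsolution, the two functions
  left add up to 0 at the touching point, and their zero-order terms cancel in the limit. In place
  of second-order jets at a point there are expansions on a ball of radius \<open>h\<close> with
  error \<open>\<eta> * h\<^sup>2\<close>; a tilt by a small paraboloid yields a touching point
  inside the ball. The gradient there is off by the Hessian bound, of order \<open>N\<close>, times
  \<open>h\<close>, so \<open>h\<close> must be small compared with \<open>1 / N\<close>. The weight
  \<open>1 / (T - t)\<close> also keeps the maximum away from time \<open>T\<close>, where no
  equation is available.\<close>

lemma integrable_lborel_bounded_support:
  fixes f :: "'a::euclidean_space \<Rightarrow> real"
  assumes "continuous_on UNIV f" and "\<And>x. R < norm x \<Longrightarrow> f x = 0"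
  shows "integrable lborel f"
proof -
  have "integrable lborel (\<lambda>x. indicator (cball 0 R) x *\<^sub>R f x)"
    by (rule borel_integrable_compact) (auto intro: continuous_on_subset[OF assms(1)])
  moreover have "(\<lambda>x. indicator (cball 0 R) x *\<^sub>R f x) = f"
    using assms(2) by (intro ext) (auto simp: indicator_def not_le)
  ultimately show ?thesis by (simp only:)
qed

lemma integral_lborel_translation:
  fixes f :: "'a::euclidean_space \<Rightarrow> real"
  assumes [measurable]: "f \<in> borel_measurable borel"
  shows "(\<integral>x. f (x + c) \<partial>lborel) = (\<integral>x. f x \<partial>lborel)"
proof -
  have "(\<integral>x. f x \<partial>lborel) = (\<integral>x. f x \<partial>distr lborel borel ((+) c))"
    by (metis lborel_distr_plus)
  also have "\<dots> = (\<integral>x. f (c + x) \<partial>lborel)"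
    by (rule integral_distr) auto
  finally show ?thesis by (simp add: add.commute)
qed

text \<open>The squared \<open>L\<^sup>2\<close> norm of the difference quotient with step \<open>h\<close> grows by a quarter of the
  squared \<open>L\<^sup>2\<close> norm of the scaled second difference when \<open>h\<close> replaces \<open>2 h\<close> (parallelogram
  identity), and it is bounded. So the second differences vanish along \<open>h = 2\<^sup>-\<^sup>j\<close>.\<close>

lemma second_difference_L2_vanishes:
  fixes G :: "'a::euclidean_space \<Rightarrow> real" and v :: 'a
  assumes lip: "C-lipschitz_on UNIV G" and supp: "\<And>x. B < norm x \<Longrightarrow> G x = 0"
  defines "h \<equiv> \<lambda>j. (1/2::real) ^ j"
  shows "(\<lambda>j. \<integral>x. ((G (x + (2 * h j) *\<^sub>R v) - 2 * G (x + h j *\<^sub>R v) + G x) / h j)\<^sup>2 \<partial>lborel) \<longlonglongrightarrow> 0"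
proof -
  define q where "q t x = (G (x + t *\<^sub>R v) - G x) / t" for t x
  define I where "I t = (\<integral>x. (q t x)\<^sup>2 \<partial>lborel)" for t
  \<comment> \<open>Outside this radius both \<open>q t\<close> and its translate by
    \<open>t *\<^sub>R v\<close> vanish for \<open>0 < t \<le> 1\<close>: the points involved are
    moved by at most \<open>2 * norm v\<close>.\<close>
  define R where "R = B + 2 * norm v"
  have contG: "continuous_on UNIV G" using lip by (rule lipschitz_on_continuous_on)
  have contq: "continuous_on UNIV (q t)" if "t \<noteq> 0" for t
    unfolding q_def using that
    by (intro continuous_intros continuous_on_compose2[OF contG]) auto
  have q0: "q t x = 0" if "R < norm x" "0 < t" "t \<le> 1" for t x
  proof -
    have "norm (t *\<^sub>R v) \<le> norm v" using that by (simp add: mult_left_le_one_le)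
    moreover have "norm x \<le> norm (x + t *\<^sub>R v) + norm (t *\<^sub>R v)"
      by (metis add_diff_cancel_right' norm_triangle_ineq4)
    ultimately have "B < norm (x + t *\<^sub>R v)" using that norm_ge_zero[of v]
      unfolding R_def by linarith
    moreover have "B < norm x" using that norm_ge_zero[of v] unfolding R_def by linarith
    ultimately show ?thesis using supp by (simp add: q_def)
  qed
  have q0': "q t (x + t *\<^sub>R v) = 0" if "R < norm x" "0 < t" "t \<le> 1" for t x
  proof -
    have "t * norm v \<le> norm v" using that by (simp add: mult_left_le_one_le)
    then have n: "norm (s *\<^sub>R t *\<^sub>R v) \<le> s * norm v" if "s \<ge> 0" for s
      using that \<open>0 < t\<close> mult_left_mono[of "t * norm v" "norm v" s] by simp
    have "norm x \<le> norm (x + t *\<^sub>R v) + norm (t *\<^sub>R v)"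
      "norm x \<le> norm (x + t *\<^sub>R v + t *\<^sub>R v) + norm (t *\<^sub>R v + t *\<^sub>R v)"
      by (metis add_diff_cancel_right' norm_triangle_ineq4,
          metis add.assoc add_diff_cancel_right' norm_triangle_ineq4)
    moreover have "norm (t *\<^sub>R v + t *\<^sub>R v) \<le> 2 * norm v"
      using n[of 2] unfolding scaleR_2[symmetric] by simp
    ultimately have "B < norm (x + t *\<^sub>R v)" "B < norm (x + t *\<^sub>R v + t *\<^sub>R v)"
      using that n[of 1] norm_ge_zero[of v] unfolding R_def scaleR_one by linarith+
    then show ?thesis using supp by (simp add: q_def)
  qed
  have contq': "continuous_on UNIV (\<lambda>x. q t (x + t *\<^sub>R v))" if "t \<noteq> 0" for t
    by (rule continuous_on_compose2[OF contq[OF that]]) (auto intro!: continuous_intros)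
  have step: "I (2 * t) = I t - (\<integral>x. (q t (x + t *\<^sub>R v) - q t x)\<^sup>2 \<partial>lborel) / 4"
    if t: "0 < t" "t \<le> 1" for t
  proof -
    define s where "s x = q t (x + t *\<^sub>R v)" for x
    have cs: "continuous_on UNIV s" and cq: "continuous_on UNIV (q t)"
      unfolding s_def using contq contq' t by auto
    have s0: "s x = 0" if "R < norm x" for x unfolding s_def by (rule q0'[OF that t])
    have int: "integrable lborel (\<lambda>x. (q t x)\<^sup>2)" "integrable lborel (\<lambda>x. (s x)\<^sup>2)"
       "integrable lborel (\<lambda>x. q t x * s x)"
      by (rule integrable_lborel_bounded_support[where R=R];
          auto intro!: continuous_intros cq cs simp: q0 s0 t)+
    have e: "x + t *\<^sub>R v + t *\<^sub>R v = x + (2 * t) *\<^sub>R v" for x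
      by (metis add.assoc scaleR_2 scaleR_scaleR)
    \<comment> \<open>The quotient with step \<open>2 * t\<close> is the mean of the quotient with
      step \<open>t\<close> and its translate. The square of a mean is the mean of the squares minus
      a quarter of the squared difference, and translation invariance gives both squares the
      integral \<open>I t\<close>.\<close>
    have dbl: "q (2 * t) x = (q t x + s x) / 2" for x
      unfolding q_def s_def e using t by (simp add: divide_simps)
    have "(\<integral>x. (s x)\<^sup>2 \<partial>lborel) = I t"
    proof -
      have "continuous_on UNIV (\<lambda>x. (q t x)\<^sup>2)" by (intro continuous_intros cq)
      then have "(\<lambda>x. (q t x)\<^sup>2) \<in> borel_measurable borel"
        by (rule borel_measurable_continuous_onI)
      from integral_lborel_translation[OF this] show ?thesis unfolding I_def s_def by simp
    qed
    moreover have "I (2 * t) = (\<integral>x. (q t x)\<^sup>2 / 4 + (s x)\<^sup>2 / 4 + (q t x * s x) / 2 \<partial>lborel)"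
      unfolding I_def dbl by (rule Bochner_Integration.integral_cong) (auto simp: power2_eq_square field_simps)
    moreover have "\<dots> = I t / 4 + (\<integral>x. (s x)\<^sup>2 \<partial>lborel) / 4 + (\<integral>x. q t x * s x \<partial>lborel) / 2"
      unfolding I_def using int by simp
    moreover have "(\<integral>x. (s x - q t x)\<^sup>2 \<partial>lborel)
        = (\<integral>x. (q t x)\<^sup>2 + (s x)\<^sup>2 - 2 * (q t x * s x) \<partial>lborel)"
      by (rule Bochner_Integration.integral_cong) (auto simp: power2_eq_square algebra_simps)
    moreover have "\<dots> = I t + (\<integral>x. (s x)\<^sup>2 \<partial>lborel) - 2 * (\<integral>x. q t x * s x \<partial>lborel)"
      unfolding I_def using int by simp
    ultimately show ?thesis unfolding s_def by (simp add: field_simps)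
  qed
  define M where "M = (C * norm v)\<^sup>2 * measure lborel (cball (0::'a) R)"
  have bound: "I t \<le> M" if t: "0 < t" "t \<le> 1" for t
  proof -
    have "I t \<le> (\<integral>x. (C * norm v)\<^sup>2 * indicator (cball (0::'a) R) x \<partial>lborel)"
      unfolding I_def
    proof (rule Bochner_Integration.integral_mono)
      show "integrable lborel (\<lambda>x. (q t x)\<^sup>2)"
        by (rule integrable_lborel_bounded_support[where R=R])
          (use t in \<open>auto intro!: continuous_intros contq simp: q0\<close>)
      show "integrable lborel (\<lambda>x. (C * norm v)\<^sup>2 * indicator (cball (0::'a) R) x)"
        by (intro integrable_mult_right integrable_real_indicator)
          (use emeasure_bounded_finite[of "cball (0::'a) R"] in auto)
      fix x
      have "\<bar>G (x + t *\<^sub>R v) - G x\<bar> \<le> C * (t * norm v)"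
        using lipschitz_onD[OF lip, of "x + t *\<^sub>R v" x] t by (simp add: dist_norm)
      then have "\<bar>q t x\<bar> \<le> C * norm v"
        using t by (simp add: q_def abs_divide field_simps)
      then have "(q t x)\<^sup>2 \<le> (C * norm v)\<^sup>2"
        by (metis abs_ge_zero power2_abs power_mono)
      then show "(q t x)\<^sup>2 \<le> (C * norm v)\<^sup>2 * indicator (cball 0 R) x"
        using q0[of x t] t by (auto simp: indicator_def)
    qed
    also have "\<dots> = M" unfolding M_def by simp
    finally show ?thesis .
  qed
  have h: "0 < h j" "h j \<le> 1" "h j = 2 * h (Suc j)" for j
    unfolding h_def by (auto simp: power_le_one)
  let ?D = "\<lambda>t. \<integral>x. (q t (x + t *\<^sub>R v) - q t x)\<^sup>2 \<partial>lborel"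
  have incr: "?D (h (Suc j)) = 4 * (I (h (Suc j)) - I (h j))" for j
    using step[OF h(1,2), of "Suc j"] h(3)[of j] by simp
  have "0 \<le> ?D t" for t by simp
  from this[of "h (Suc j)" for j] have "I (h j) \<le> I (h (Suc j))" for j unfolding incr by simp
  then have "incseq (\<lambda>j. I (h j))" by (rule incseq_SucI)
  then obtain L where L: "(\<lambda>j. I (h j)) \<longlonglongrightarrow> L"
    using incseq_convergent bound[OF h(1,2)] by blast
  have "(\<lambda>j. 4 * (I (h (Suc j)) - I (h j))) \<longlonglongrightarrow> 4 * (L - L)"
    by (intro tendsto_intros L LIMSEQ_Suc)
  then have "(\<lambda>j. ?D (h (Suc j))) \<longlonglongrightarrow> 0" unfolding incr by simp
  then have "(\<lambda>j. ?D (h j)) \<longlonglongrightarrow> 0" by (rule LIMSEQ_imp_Suc)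
  moreover have "q t (x + t *\<^sub>R v) - q t x = (G (x + (2*t) *\<^sub>R v) - 2 * G (x + t *\<^sub>R v) + G x) / t" for t x
    unfolding q_def by (simp add: diff_divide_distrib add_divide_distrib add.assoc scaleR_2[symmetric])
  ultimately show ?thesis by simp
qed

text \<open>A Chebyshev argument: finitely many squared second differences, summed over
  \<open>F\<close> and over the basis, have an integral tending to 0 along dyadic scales, while
  \<open>K\<close> has positive measure; so at a suitable scale the sum is at most
  \<open>\<eta>\<^sup>2\<close> somewhere in \<open>K\<close>. One point and one scale thus serve
  all pairs of \<open>F\<close>.\<close>

lemma near_affine_on_finite_set:
  fixes g :: "'a::euclidean_space \<Rightarrow> 'b::euclidean_space" and F :: "('a \<times> 'a) set"
  assumes lip: "C-lipschitz_on UNIV g" and K: "K \<in> sets borel" "bounded K" "\<not> negligible K"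
    and "finite F" and "0 < \<eta>"
  obtains x h where "x \<in> K" "0 < h" "h < \<eta>"
    "\<And>a v. (a, v) \<in> F \<Longrightarrow>
      norm (g (x + h *\<^sub>R (a + 2 *\<^sub>R v)) - 2 *\<^sub>R g (x + h *\<^sub>R (a + v)) + g (x + h *\<^sub>R a)) \<le> \<eta> * h"
proof -
  have C0: "0 \<le> C" using lip by (rule lipschitz_on_nonneg)
  obtain R0 where R0: "\<And>x. x \<in> K \<Longrightarrow> norm x \<le> R0"
    using K(2) bounded_iff by blast
  define S where "S = (\<Sum>(a, v)\<in>F. norm a + 2 * norm v)"
  have S: "norm a + 2 * norm v \<le> S" if "(a, v) \<in> F" for a v
    unfolding S_def using member_le_sum[of "(a,v)" F "\<lambda>(a, v). norm a + 2 * norm v"] that \<open>finite F\<close>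
    by auto
  define R where "R = \<bar>R0\<bar> + \<bar>S\<bar>"
  \<comment> \<open>The energy estimate needs bounded support, so the components of \<open>g\<close>
    are clamped between \<open>- c\<close> and \<open>c\<close>. The tent \<open>c\<close> vanishes
    outside the ball of radius \<open>B\<close>, and \<open>B\<close> is so large that nothing is
    cut on the ball of radius \<open>R\<close>, which contains every sample point because the scale
    stays below 1.\<close>
  define B where "B = norm (g 0) + (C + 1) * R"
  define c where "c x = max 0 (B - norm x)" for x :: 'a
  define G where "G b x = max (- c x) (min (g x \<bullet> b) (c x))" for b x
  define W where "W b h a v x = (G b (x + h *\<^sub>R a + (2 * h) *\<^sub>R v) - 2 * G b (x + h *\<^sub>R a + h *\<^sub>R v) + G b (x + h *\<^sub>R a)) / h"
    for b h a v x
  have G: "G b x = g x \<bullet> b" if "norm x \<le> R" "b \<in> Basis" for b x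
  proof -
    have "\<bar>g x \<bullet> b\<bar> \<le> norm (g x)" using Basis_le_norm that by blast
    also have "\<dots> \<le> norm (g 0) + C * norm x"
      using lipschitz_onD[OF lip, of x 0] norm_triangle_ineq2[of "g x" "g 0"] by (simp add: dist_norm)
    also have "\<dots> \<le> norm (g 0) + C * R" using that C0 by (simp add: mult_left_mono)
    also have "\<dots> \<le> B - norm x" using that unfolding B_def by (simp add: algebra_simps)
    finally show ?thesis unfolding G_def c_def by auto
  qed
  have Gsupp: "G b x = 0" if "B < norm x" for b x
    using that unfolding G_def c_def by auto
  have Glip: "(C + 1)-lipschitz_on UNIV (G b)" if "b \<in> Basis" for b
  proof (rule lipschitz_onI)
    fix x y
    have "\<bar>g x \<bullet> b - g y \<bullet> b\<bar> \<le> norm (g x - g y)"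
      using Basis_le_norm[OF that, of "g x - g y"] by (simp add: inner_diff_left)
    also have "\<dots> \<le> C * norm (x - y)" using lipschitz_onD[OF lip, of x y] by (simp add: dist_norm)
    also have "\<dots> \<le> (C + 1) * norm (x - y)" by (simp add: algebra_simps)
    finally have 1: "\<bar>g x \<bullet> b - g y \<bullet> b\<bar> \<le> (C + 1) * norm (x - y)" .
    have "\<bar>c x - c y\<bar> \<le> norm (x - y)" unfolding c_def using norm_triangle_ineq3[of x y] by auto
    also have "\<dots> \<le> (C + 1) * norm (x - y)" using C0 by (simp add: algebra_simps)
    finally show "dist (G b x) (G b y) \<le> (C + 1) * dist x y"
      using 1 unfolding G_def dist_norm real_norm_def by linarith
  qed (use C0 in simp)
  define h where "h j = (1/2::real) ^ j" for j
  have Wlim: "(\<lambda>j. \<integral>x. (W b (h j) a v x)\<^sup>2 \<partial>lborel) \<longlonglongrightarrow> 0" if "b \<in> Basis" for b a v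
  proof -
    have "(\<integral>x. (W b t a v x)\<^sup>2 \<partial>lborel)
      = (\<integral>x. ((G b (x + (2 * t) *\<^sub>R v) - 2 * G b (x + t *\<^sub>R v) + G b x) / t)\<^sup>2 \<partial>lborel)" if "t \<noteq> 0" for t
    proof -
      have cG: "continuous_on UNIV (G b)" using Glip[OF \<open>b \<in> Basis\<close>] by (rule lipschitz_on_continuous_on)
      have "continuous_on UNIV (\<lambda>x. ((G b (x + (2 * t) *\<^sub>R v) - 2 * G b (x + t *\<^sub>R v) + G b x) / t)\<^sup>2)"
        using that by (intro continuous_intros continuous_on_compose2[OF cG]) auto
      then have "(\<lambda>x. ((G b (x + (2 * t) *\<^sub>R v) - 2 * G b (x + t *\<^sub>R v) + G b x) / t)\<^sup>2) \<in> borel_measurable borel"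
        by (rule borel_measurable_continuous_onI)
      from integral_lborel_translation[OF this, of "t *\<^sub>R a"] show ?thesis unfolding W_def by simp
    qed
    with second_difference_L2_vanishes[OF Glip[OF that] Gsupp, where v = v] show ?thesis
      unfolding h_def by simp
  qed
  define \<Phi> where "\<Phi> j x = (\<Sum>p\<in>F. \<Sum>b\<in>Basis. (W b (h j) (fst p) (snd p) x)\<^sup>2)" for j x
  have hp: "0 < h j" for j unfolding h_def by simp
  have Wint: "integrable lborel (\<lambda>x. (W b (h j) a v x)\<^sup>2)" if "b \<in> Basis" for b j a v
  proof (rule integrable_lborel_bounded_support[where R = "B + norm (h j *\<^sub>R a) + 2 * norm (h j *\<^sub>R v)"])
    have cG: "continuous_on UNIV (G b)" using Glip[OF \<open>b \<in> Basis\<close>] by (rule lipschitz_on_continuous_on)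
    show "continuous_on UNIV (\<lambda>x. (W b (h j) a v x)\<^sup>2)" unfolding W_def
      using hp[of j] by (intro continuous_intros continuous_on_compose2[OF cG]) auto
    fix x :: 'a assume *: "B + norm (h j *\<^sub>R a) + 2 * norm (h j *\<^sub>R v) < norm x"
    have "norm x \<le> norm (x + h j *\<^sub>R a + (2 * h j) *\<^sub>R v) + norm (h j *\<^sub>R a) + 2 * norm (h j *\<^sub>R v)"
      using norm_triangle_ineq4[of "x + h j *\<^sub>R a + (2 * h j) *\<^sub>R v" "h j *\<^sub>R a + (2 * h j) *\<^sub>R v"]
       norm_triangle_ineq[of "h j *\<^sub>R a" "(2 * h j) *\<^sub>R v"] by (simp add: algebra_simps)
    moreover have "norm x \<le> norm (x + h j *\<^sub>R a + h j *\<^sub>R v) + norm (h j *\<^sub>R a) + norm (h j *\<^sub>R v)"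
      using norm_triangle_ineq4[of "x + h j *\<^sub>R a + h j *\<^sub>R v" "h j *\<^sub>R a + h j *\<^sub>R v"]
       norm_triangle_ineq[of "h j *\<^sub>R a" "h j *\<^sub>R v"] by (simp add: algebra_simps)
    moreover have "norm x \<le> norm (x + h j *\<^sub>R a) + norm (h j *\<^sub>R a)"
      using norm_triangle_ineq4[of "x + h j *\<^sub>R a" "h j *\<^sub>R a"] by simp
    ultimately show "(W b (h j) a v x)\<^sup>2 = 0"
      using * norm_ge_zero[of "h j *\<^sub>R v"] unfolding W_def by (subst (1 2 3) Gsupp) (linarith | simp)+
  qed
  have \<Phi>int: "integrable lborel (\<Phi> j)" for j
    unfolding \<Phi>_def by (intro Bochner_Integration.integrable_sum Wint)
  have "(\<integral>x. \<Phi> j x \<partial>lborel) = (\<Sum>p\<in>F. \<Sum>b\<in>Basis. \<integral>x. (W b (h j) (fst p) (snd p) x)\<^sup>2 \<partial>lborel)" for j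
    unfolding \<Phi>_def by (simp add: Bochner_Integration.integral_sum Wint)
  moreover have "(\<lambda>j. \<Sum>p\<in>F. \<Sum>b\<in>Basis. \<integral>x. (W b (h j) (fst p) (snd p) x)\<^sup>2 \<partial>lborel) \<longlonglongrightarrow> (\<Sum>p\<in>F. \<Sum>b\<in>(Basis::'b set). 0)"
    by (intro tendsto_sum Wlim)
  ultimately have \<Phi>lim: "(\<lambda>j. \<integral>x. \<Phi> j x \<partial>lborel) \<longlonglongrightarrow> 0" by simp
  have Kfin: "emeasure lborel K < \<infinity>" using emeasure_bounded_finite[OF K(2)] by (simp add: less_top)
  have "emeasure lborel K \<noteq> 0"
    using K(1,3) by (auto simp: negligible_iff_null_sets intro!: null_sets_completionI null_setsI)
  then have Kpos: "0 < measure lborel K"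
    using Kfin by (simp add: measure_def enn2real_positive_iff zero_less_iff_neq_zero)
  have "(\<lambda>j. h j) \<longlonglongrightarrow> 0" unfolding h_def by (rule LIMSEQ_realpow_zero) auto
  then have "\<forall>\<^sub>F j in sequentially. h j < min 1 \<eta>"
    using order_tendstoD(2)[of h 0 _ "min 1 \<eta>"] \<open>0 < \<eta>\<close> by simp
  moreover have "\<forall>\<^sub>F j in sequentially. (\<integral>x. \<Phi> j x \<partial>lborel) < \<eta>\<^sup>2 * measure lborel K"
    using order_tendstoD(2)[OF \<Phi>lim] \<open>0 < \<eta>\<close> Kpos by simp
  ultimately obtain j where j: "h j < min 1 \<eta>" "(\<integral>x. \<Phi> j x \<partial>lborel) < \<eta>\<^sup>2 * measure lborel K"
    using eventually_happens'[OF _ eventually_conj] by (metis (no_types, lifting) eventually_conj eventually_sequentially le_refl)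
  have "\<exists>x\<in>K. \<Phi> j x \<le> \<eta>\<^sup>2"
  proof (rule ccontr)
    assume "\<not> ?thesis"
    then have "\<eta>\<^sup>2 * indicator K x \<le> \<Phi> j x" for x
      by (cases "x \<in> K") (auto simp: \<Phi>_def intro!: sum_nonneg)
    then have "(\<integral>x. \<eta>\<^sup>2 * indicator K x \<partial>lborel) \<le> (\<integral>x. \<Phi> j x \<partial>lborel)"
      using K(1) Kfin by (intro Bochner_Integration.integral_mono \<Phi>int integrable_mult_right integrable_real_indicator) auto
    then show False using j(2) K(1) by simp
  qed
  then obtain x where x: "x \<in> K" "\<Phi> j x \<le> \<eta>\<^sup>2" by blast
  show ?thesis
  proof (rule that[OF x(1) hp])
    show "h j < \<eta>" using j(1) by simp
    fix a v assume av: "(a, v) \<in> F"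
    have bd: "norm (x + h j *\<^sub>R (a + s *\<^sub>R v)) \<le> R" if "0 \<le> s" "s \<le> 2" for s
    proof -
      have "norm (h j *\<^sub>R (a + s *\<^sub>R v)) \<le> norm (a + s *\<^sub>R v)"
        using j(1) hp[of j] by (simp add: mult_left_le_one_le)
      also have "\<dots> \<le> norm a + s * norm v" using norm_triangle_ineq[of a "s *\<^sub>R v"] that by simp
      also have "\<dots> \<le> norm a + 2 * norm v" using that by (simp add: mult_right_mono)
      also have "\<dots> \<le> S" by (rule S[OF av])
      finally show ?thesis using R0[OF x(1)] norm_triangle_ineq[of x "h j *\<^sub>R (a + s *\<^sub>R v)"]
        unfolding R_def by linarith
    qed
    define D where "D = g (x + h j *\<^sub>R (a + 2 *\<^sub>R v)) - 2 *\<^sub>R g (x + h j *\<^sub>R (a + v)) + g (x + h j *\<^sub>R a)"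
    have WD: "W b (h j) a v x = (D \<bullet> b) / h j" if "b \<in> Basis" for b
    proof -
      have e: "x + h j *\<^sub>R a + (2 * h j) *\<^sub>R v = x + h j *\<^sub>R (a + 2 *\<^sub>R v)"
        "x + h j *\<^sub>R a + h j *\<^sub>R v = x + h j *\<^sub>R (a + v)" by (simp_all add: algebra_simps)
      show ?thesis unfolding W_def D_def e using bd[of 2] bd[of 1] bd[of 0] that
        by (simp add: G inner_diff_left inner_add_left)
    qed
    have "(norm D / h j)\<^sup>2 = (\<Sum>b\<in>Basis. ((D \<bullet> b) / h j)\<^sup>2)"
      unfolding power_divide sum_divide_distrib[symmetric] power2_norm_eq_inner
      by (subst euclidean_inner) (simp add: power2_eq_square)
    also have "\<dots> = (\<Sum>b\<in>Basis. (W b (h j) a v x)\<^sup>2)" by (simp add: WD)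
    also have "\<dots> \<le> \<Phi> j x" unfolding \<Phi>_def
      using member_le_sum[OF av, of "\<lambda>p. \<Sum>b\<in>Basis. (W b (h j) (fst p) (snd p) x)\<^sup>2"] \<open>finite F\<close>
      by (simp add: sum_nonneg)
    also have "\<dots> \<le> \<eta>\<^sup>2" by (rule x(2))
    finally have "norm D / h j \<le> \<eta>" by (rule power2_le_imp_le) (use \<open>0 < \<eta>\<close> in simp)
    then show "norm D \<le> \<eta> * h j" using hp[of j] by (simp add: field_simps)
  qed
qed

text \<open>The blow-up limit below satisfies only a midpoint identity, which yields additivity;
  homogeneity comes by density from rational factors.\<close>

lemma linear_additive_continuous:
  fixes f :: "'a::real_normed_vector \<Rightarrow> 'b::real_normed_vector"
  assumes add: "\<And>x y. f (x + y) = f x + f y" and cont: "continuous_on UNIV f"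
  shows "linear f"
proof (rule linearI[OF add])
  interpret additive f by unfold_locales (rule add)
  have nat: "f (real n *\<^sub>R x) = real n *\<^sub>R f x" for n x
    by (induction n) (simp_all add: zero add scaleR_left_distrib)
  have int: "f (of_int i *\<^sub>R x) = of_int i *\<^sub>R f x" for i x
    by (cases i) (metis nat of_int_of_nat_eq, metis nat minus of_int_minus of_int_of_nat_eq scaleR_minus_left)
  have rat: "f (r *\<^sub>R x) = r *\<^sub>R f x" if "r \<in> \<rat>" for r x
  proof -
    obtain p q where r: "r = of_int p / of_int q" "q \<noteq> 0"
      using \<open>r \<in> \<rat>\<close> by (metis Rats_cases' not_less_zero of_int_0_less_iff less_irrefl)
    have "of_int q *\<^sub>R f (r *\<^sub>R x) = f (of_int p *\<^sub>R x)"
      using r by (simp add: int[symmetric])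
    also have "\<dots> = of_int q *\<^sub>R (r *\<^sub>R f x)" using r by (simp add: int)
    finally show ?thesis using r(2) by (metis of_int_eq_0_iff scaleR_left_imp_eq)
  qed
  fix c x
  have "continuous_on UNIV (\<lambda>c. f (c *\<^sub>R x) - c *\<^sub>R f x)"
    by (intro continuous_intros continuous_on_compose2[OF cont]) auto
  then have "closed {c. f (c *\<^sub>R x) - c *\<^sub>R f x = 0}"
    by (intro closed_Collect_eq continuous_on_const)
  then have "closure \<rat> \<subseteq> {c. f (c *\<^sub>R x) - c *\<^sub>R f x = 0}"
    by (intro closure_minimal) (auto simp: rat)
  then show "f (c *\<^sub>R x) = c *\<^sub>R f x"
    by (auto simp: Rats_closure_real)
qed

text \<open>A common Lipschitz constant carries the Cauchy property from a dense set to every point;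
  this completes a diagonal subsequence argument.\<close>

lemma lipschitz_convergent_everywhere:
  fixes G :: "nat \<Rightarrow> 'a::metric_space \<Rightarrow> 'b::complete_space"
  assumes lip: "\<And>k. C-lipschitz_on UNIV (G k)" and dense: "closure D = UNIV"
    and D: "\<And>d. d \<in> D \<Longrightarrow> convergent (\<lambda>k. G k d)"
  shows "convergent (\<lambda>k. G k x)"
proof (rule Cauchy_convergent, rule metric_CauchyI)
  fix e :: real assume "0 < e"
  have C: "0 \<le> C" using lip by (rule lipschitz_on_nonneg)
  define \<delta> where "\<delta> = e / (4 * (C + 1))"
  have \<delta>: "0 < \<delta>" "C * \<delta> \<le> e / 4"
    using C \<open>0 < e\<close> by (auto simp: \<delta>_def field_simps)
  obtain d where d: "d \<in> D" "dist d x < \<delta>"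
    using dense \<delta>(1) closure_approachable[of x D] by auto
  have "dist (G k d) (G k x) \<le> e / 4" for k
    using lipschitz_onD[OF lip, of d x k] mult_left_mono[of "dist d x" \<delta> C] d C \<delta> by auto
  note close = this
  from D[OF d(1)] have "Cauchy (\<lambda>k. G k d)" by (rule convergent_Cauchy)
  then obtain M where M: "\<And>m n. m \<ge> M \<Longrightarrow> n \<ge> M \<Longrightarrow> dist (G m d) (G n d) < e / 2"
    using \<open>0 < e\<close> by (metis half_gt_zero metric_CauchyD)
  have "dist (G m x) (G n x) < e" if "m \<ge> M" "n \<ge> M" for m n
    using close[of m] close[of n] M[OF that] dist_commute[of "G m d" "G m x"] dist_triangle[of "G m x" "G n x" "G m d"] dist_triangle[of "G m d" "G n x" "G n d"]
    by linarith
  then show "\<exists>M. \<forall>m\<ge>M. \<forall>n\<ge>M. dist (G m x) (G n x) < e" by blast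
qed

text \<open>A blow-up form of Rademacher's theorem. The radius \<open>h\<close> depends on the precision \<open>\<eta>\<close>, which the viscosity
  argument tolerates, so differentiability almost everywhere is not needed.\<close>

proposition lipschitz_near_linear:
  fixes g :: "'a::euclidean_space \<Rightarrow> 'b::euclidean_space"
  assumes lip: "C-lipschitz_on UNIV g" and K: "K \<in> sets borel" "bounded K" "\<not> negligible K"
    and \<eta>: "0 < \<eta>"
  obtains x h L where "x \<in> K" "0 < h" "h < \<eta>" "linear L"
    "\<And>w. norm w \<le> h \<Longrightarrow> norm (g (x + w) - g x - L w) \<le> \<eta> * h"
proof -
  have C: "0 \<le> C" using lip by (rule lipschitz_on_nonneg)
  obtain D :: "'a set" where D: "countable D" and dense: "\<And>X. open X \<Longrightarrow> X \<noteq> {} \<Longrightarrow> \<exists>d\<in>D. d \<in> X"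
    using countable_dense_setE by blast
  have "x \<in> closure D" for x
    unfolding closure_approachable using dense[OF open_ball, of x] by (auto simp: dist_commute)
  then have D: "countable D" "closure D = UNIV" using D by auto
  define e where "e = from_nat_into (D \<times> D)"
  have "D \<noteq> {}" using D(2) by auto
  have e: "range e = D \<times> D"
    unfolding e_def using D(1) \<open>D \<noteq> {}\<close> by (intro range_from_nat_into) auto
  \<comment> \<open>The pair \<open>(a, b)\<close> is encoded by the start \<open>a\<close> and the
    half step \<open>(1/2) *\<^sub>R (b - a)\<close>, so that the second difference compares the
    values at \<open>a\<close> and \<open>b\<close> with the one at their midpoint. The finite sets
    \<open>F k\<close> exhaust all pairs from the dense set \<open>D\<close>.\<close>
  define F where "F k = (\<lambda>(a, b). (a, (1/2) *\<^sub>R (b - a))) ` e ` {..k}" for k :: nat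
  have finF: "finite (F k)" for k by (simp add: F_def)
  have "\<exists>x h. x \<in> K \<and> 0 < h \<and> h < inverse (real (Suc k)) \<and> (\<forall>(a, v)\<in>F k.
      norm (g (x + h *\<^sub>R (a + 2 *\<^sub>R v)) - 2 *\<^sub>R g (x + h *\<^sub>R (a + v)) + g (x + h *\<^sub>R a)) \<le> inverse (real (Suc k)) * h)" for k
    by (rule near_affine_on_finite_set[OF lip K finF[of k], of "inverse (real (Suc k))"]) (simp, blast)
  then obtain x h where x: "\<And>k. x k \<in> K" and h: "\<And>k. 0 < h k" "\<And>k. h k < inverse (real (Suc k))"
    and xF: "\<And>k a v. (a, v) \<in> F k \<Longrightarrow>
      norm (g (x k + h k *\<^sub>R (a + 2 *\<^sub>R v)) - 2 *\<^sub>R g (x k + h k *\<^sub>R (a + v)) + g (x k + h k *\<^sub>R a))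
        \<le> inverse (real (Suc k)) * h k"
    by (metis (mono_tags, lifting) case_prodD)
  \<comment> \<open>Blow-ups of \<open>g\<close> at the selected points. They share the Lipschitz
    constant of \<open>g\<close> and vanish at 0, and their second differences at the pairs of
    \<open>F k\<close> are at most \<open>1 / (k + 1)\<close>.\<close>
  define G where "G k z = (1 / h k) *\<^sub>R (g (x k + h k *\<^sub>R z) - g (x k))" for k z
  have Glip: "C-lipschitz_on UNIV (G k)" for k
  proof (rule lipschitz_onI[OF _ C])
    fix y z
    have "dist (G k y) (G k z) = (1 / h k) * norm (g (x k + h k *\<^sub>R y) - g (x k + h k *\<^sub>R z))"
      using h(1)[of k] unfolding G_def dist_norm by (simp flip: scaleR_diff_right)
    also have "\<dots> \<le> (1 / h k) * (C * norm (h k *\<^sub>R y - h k *\<^sub>R z))"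
      using h(1)[of k] lipschitz_onD[OF lip, of "x k + h k *\<^sub>R y" "x k + h k *\<^sub>R z"]
      by (intro mult_left_mono) (auto simp: dist_norm)
    also have "\<dots> = C * dist y z" using h(1)[of k] by (simp add: dist_norm flip: scaleR_diff_right)
    finally show "dist (G k y) (G k z) \<le> C * dist y z" .
  qed
  have G0: "G k 0 = 0" for k by (simp add: G_def)
  have Gbd: "norm (G k z) \<le> C * norm z" for k z
    using lipschitz_onD[OF Glip, of z 0 k] by (simp add: G0)
  \<comment> \<open>The subsequence theorem asks for one bound valid for all indices and all points,
    hence the factor \<open>1 / (1 + norm z)\<close>, which is removed again afterwards.\<close>
  obtain r where r: "strict_mono (r :: nat \<Rightarrow> nat)"
    and rl: "\<And>z. z \<in> D \<Longrightarrow> \<exists>l. (\<lambda>n. (1 / (1 + norm z)) *\<^sub>R G (r n) z) \<longlonglongrightarrow> l"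
  proof (rule function_convergent_subsequence[OF D(1), of "\<lambda>k z. (1 / (1 + norm z)) *\<^sub>R G k z" C])
    fix k z
    have "norm (G k z) \<le> C * (1 + norm z)" using Gbd[of k z] C by (simp add: algebra_simps)
    then show "norm ((1 / (1 + norm z)) *\<^sub>R G k z) \<le> C"
      by (simp add: divide_simps add_nonneg_eq_0_iff) (smt (verit) norm_ge_zero mult.commute)
  qed blast
  have "convergent (\<lambda>n. G (r n) z)" if "z \<in> D" for z
  proof -
    obtain l where "(\<lambda>n. (1 / (1 + norm z)) *\<^sub>R G (r n) z) \<longlonglongrightarrow> l" using rl[OF \<open>z \<in> D\<close>] by blast
    then have "(\<lambda>n. (1 + norm z) *\<^sub>R ((1 / (1 + norm z)) *\<^sub>R G (r n) z)) \<longlonglongrightarrow> (1 + norm z) *\<^sub>R l"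
      by (intro tendsto_intros)
    moreover have "1 + norm z \<noteq> 0" by (smt (verit) norm_ge_zero)
    ultimately show ?thesis by (auto simp: convergent_def)
  qed
  then have "convergent (\<lambda>n. G (r n) z)" for z
    using lipschitz_convergent_everywhere[OF Glip D(2)] by blast
  then obtain L where L: "\<And>z. (\<lambda>n. G (r n) z) \<longlonglongrightarrow> L z"
    unfolding convergent_def by metis
  have Llip: "C-lipschitz_on UNIV L"
  proof (rule lipschitz_onI[OF _ C])
    fix y z
    show "dist (L y) (L z) \<le> C * dist y z"
      by (rule tendsto_upperbound[OF tendsto_dist[OF L L]]) (auto intro!: always_eventually lipschitz_onD[OF Glip])
  qed
  have contL: "continuous_on UNIV L" using Llip by (rule lipschitz_on_continuous_on)
  have "L b - 2 *\<^sub>R L ((1/2) *\<^sub>R (a + b)) + L a = 0" if "a \<in> D" "b \<in> D" for a b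
  proof -
    obtain i where i: "e i = (a, b)" using e \<open>a \<in> D\<close> \<open>b \<in> D\<close> by (metis SigmaI rangeE)
    have "norm (G k b - 2 *\<^sub>R G k ((1/2) *\<^sub>R (a + b)) + G k a) \<le> inverse (real (Suc k))" if "k \<ge> i" for k
    proof -
      have "(a, (1/2) *\<^sub>R (b - a)) \<in> F k" unfolding F_def using that i by force
      from xF[OF this] have *: "norm (g (x k + h k *\<^sub>R b) - 2 *\<^sub>R g (x k + h k *\<^sub>R ((1/2) *\<^sub>R (a + b))) + g (x k + h k *\<^sub>R a))
        \<le> inverse (real (Suc k)) * h k"
      proof -
        have "a + 2 *\<^sub>R (1/2) *\<^sub>R (b - a) = b" "a + (1/2) *\<^sub>R (b - a) = (1/2) *\<^sub>R (a + b)"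
          by (simp_all add: algebra_simps) (metis scaleR_half_double scaleR_right_distrib add_diff_cancel_right' diff_add_cancel)
        then show ?thesis using xF[OF \<open>(a, (1/2) *\<^sub>R (b - a)) \<in> F k\<close>] by simp
      qed
      have "G k b - 2 *\<^sub>R G k ((1/2) *\<^sub>R (a + b)) + G k a
        = (1 / h k) *\<^sub>R (g (x k + h k *\<^sub>R b) - 2 *\<^sub>R g (x k + h k *\<^sub>R ((1/2) *\<^sub>R (a + b))) + g (x k + h k *\<^sub>R a))"
        unfolding G_def by (simp add: algebra_simps) (simp flip: scaleR_add_left)
      moreover have "\<bar>1 / h k\<bar> * y \<le> c" if "y \<le> c * h k" for y c
        using that h(1)[of k] by (simp add: field_simps)
      ultimately show ?thesis using * by (simp only: norm_scaleR)
    qed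
    then have "\<forall>\<^sub>F k in sequentially. norm (G k b - 2 *\<^sub>R G k ((1/2) *\<^sub>R (a + b)) + G k a) \<le> inverse (real (Suc k))"
      by (auto simp: eventually_sequentially)
    then have "(\<lambda>k. G k b - 2 *\<^sub>R G k ((1/2) *\<^sub>R (a + b)) + G k a) \<longlonglongrightarrow> 0"
      by (rule Lim_null_comparison) (rule LIMSEQ_inverse_real_of_nat)
    then have "(\<lambda>n. G (r n) b - 2 *\<^sub>R G (r n) ((1/2) *\<^sub>R (a + b)) + G (r n) a) \<longlonglongrightarrow> 0"
      using LIMSEQ_subseq_LIMSEQ[OF _ r] by (simp add: o_def)
    moreover have "(\<lambda>n. G (r n) b - 2 *\<^sub>R G (r n) ((1/2) *\<^sub>R (a + b)) + G (r n) a) \<longlonglongrightarrow> L b - 2 *\<^sub>R L ((1/2) *\<^sub>R (a + b)) + L a"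
      by (intro tendsto_intros L)
    ultimately show ?thesis by (rule LIMSEQ_unique[symmetric])
  qed
  moreover have "closed {p. L (snd p) - 2 *\<^sub>R L ((1/2) *\<^sub>R (fst p + snd p)) + L (fst p) = 0}"
    by (intro closed_Collect_eq continuous_intros continuous_on_compose2[OF contL]) auto
  ultimately have "closure (D \<times> D) \<subseteq> {p. L (snd p) - 2 *\<^sub>R L ((1/2) *\<^sub>R (fst p + snd p)) + L (fst p) = 0}"
    by (intro closure_minimal) auto
  then have mid: "L b + L a = 2 *\<^sub>R L ((1/2) *\<^sub>R (a + b))" for a b
    by (auto simp: closure_Times D(2) algebra_simps subset_iff)
  have "L 0 = 0" using L[of 0] by (simp add: G0 LIMSEQ_const_iff)
  then have "L (2 *\<^sub>R a) = 2 *\<^sub>R L a" for a using mid[of 0 "2 *\<^sub>R a"] by simp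
  then have "L (a + b) = L a + L b" for a b
    using mid[of "2 *\<^sub>R b" "2 *\<^sub>R a"] by (simp flip: scaleR_add_right add: add.commute)
  then have "linear L" using contL by (rule linear_additive_continuous)
  \<comment> \<open>A finite \<open>\<delta>\<close>-net turns pointwise into uniform convergence on
    the unit ball: two Lipschitz errors and the error on the net, each at most
    \<open>\<eta> / 4\<close>.\<close>
  define \<delta> where "\<delta> = \<eta> / (4 * (C + 1))"
  have \<delta>: "0 < \<delta>" "C * \<delta> \<le> \<eta> / 4" using C \<eta> by (auto simp: \<delta>_def field_simps)
  obtain T :: "'a set" where T: "finite T" "cball 0 1 \<subseteq> (\<Union>z\<in>T. ball z \<delta>)"
    using compact_eq_totally_bounded[THEN iffD1, OF compact_cball, of 0 1] \<delta>(1) by blast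
  have "\<forall>\<^sub>F n in sequentially. \<forall>z\<in>T. dist (G (r n) z) (L z) < \<eta> / 4"
    using T(1) L \<eta> by (intro eventually_ball_finite ballI tendstoD) auto
  moreover have "(\<lambda>n. inverse (real (Suc (r n)))) \<longlonglongrightarrow> 0"
    using LIMSEQ_subseq_LIMSEQ[OF LIMSEQ_inverse_real_of_nat r] by (simp add: o_def)
  then have "\<forall>\<^sub>F n in sequentially. inverse (real (Suc (r n))) < \<eta>"
    using \<eta> by (rule order_tendstoD)
  ultimately obtain n where n: "\<And>z. z \<in> T \<Longrightarrow> dist (G (r n) z) (L z) < \<eta> / 4" "inverse (real (Suc (r n))) < \<eta>"
    using eventually_happens'[OF sequentially_bot eventually_conj] by blast
  have unif: "norm (G (r n) z - L z) \<le> \<eta>" if "norm z \<le> 1" for z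
  proof -
    obtain y where y: "y \<in> T" "dist y z < \<delta>" using T(2) \<open>norm z \<le> 1\<close> by (force simp: subset_iff)
    have "C * dist y z \<le> \<eta> / 4" using y(2) \<delta> C mult_left_mono[of "dist y z" \<delta> C] by linarith
    then have "dist (G (r n) y) (G (r n) z) \<le> \<eta> / 4" "dist (L y) (L z) \<le> \<eta> / 4"
      using lipschitz_onD[OF Glip, of y z "r n"] lipschitz_onD[OF Llip, of y z] by auto
    then have "dist (G (r n) z) (L z) \<le> \<eta>"
      using n(1)[OF y(1)] dist_triangle[of "G (r n) z" "L z" "G (r n) y"] dist_triangle[of "G (r n) y" "L z" "L y"]
        dist_commute[of "G (r n) y" "G (r n) z"] \<eta> by linarith
    then show ?thesis by (simp add: dist_norm)
  qed
  show ?thesis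
  proof (rule that[OF x[of "r n"] h(1) _ \<open>linear L\<close>])
    show "h (r n) < \<eta>" using h(2)[of "r n"] n(2) by linarith
    fix w :: 'a assume w: "norm w \<le> h (r n)"
    define z where "z = (1 / h (r n)) *\<^sub>R w"
    have z: "norm z \<le> 1" "w = h (r n) *\<^sub>R z" using w h(1)[of "r n"] by (auto simp: z_def field_simps)
    have "g (x (r n) + w) - g (x (r n)) - L w = h (r n) *\<^sub>R (G (r n) z - L z)"
      using h(1)[of "r n"] unfolding G_def z(2)
      by (simp add: linear_scale[OF \<open>linear L\<close>] scaleR_diff_right less_imp_neq[symmetric])
    then show "norm (g (x (r n) + w) - g (x (r n)) - L w) \<le> \<eta> * h (r n)"
      using unif[OF z(1)] h(1)[of "r n"] by (simp add: mult.commute mult_right_mono)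
  qed
qed

section \<open>Regularization and the theorem on sums\<close>

lemma continuous_attains_sup_coercive:
  fixes f :: "'a::euclidean_space \<Rightarrow> real"
  assumes cont: "continuous_on UNIV f" and R: "\<And>x. R < norm x \<Longrightarrow> f x \<le> f x0"
  obtains x where "\<And>y. f y \<le> f x"
proof -
  have "x0 \<in> cball 0 (max R (norm x0))" by simp
  then obtain x where x: "x \<in> cball 0 (max R (norm x0))" "\<And>y. y \<in> cball 0 (max R (norm x0)) \<Longrightarrow> f y \<le> f x"
    using continuous_attains_sup[of "cball 0 (max R (norm x0))" f] continuous_on_subset[OF cont]
    by (metis compact_cball empty_iff subset_UNIV)
  have "f y \<le> f x" for y
  proof (cases "norm y \<le> max R (norm x0)")
    case False
    then have "R < norm y" by simp
    from R[OF this] x(2)[OF \<open>x0 \<in> _\<close>] show ?thesis by (rule order_trans)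
  qed (use x(2)[of y] in auto)
  then show ?thesis by (rule that)
qed

text \<open>Expansions at \<open>x\<close> and at \<open>y\<close> both predict the value at
  \<open>y + w\<close>. With \<open>w\<close> parallel to \<open>g x - g y\<close> and as long as
  \<open>d\<close>, the predictions differ by \<open>norm e * norm d\<close> up to the errors; in
  units of \<open>(norm d)\<^sup>2\<close> these are \<open>4 * K\<close> for the displacement
  \<open>d + w\<close> and \<open>K\<close> each for \<open>d\<close> and \<open>w\<close>, whence
  the factor 6.\<close>

lemma two_sided_paraboloids_imp_lipschitz:
  fixes F :: "'a::real_inner \<Rightarrow> real"
  assumes two_sided: "\<And>x w. \<bar>F (x + w) - F x - g x \<bullet> w\<bar> \<le> K * (norm w)\<^sup>2" and "0 \<le> K"
  shows "(6 * K)-lipschitz_on UNIV g"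
proof (rule lipschitz_onI)
  fix x y :: 'a
  define d where "d = y - x"
  define e where "e = g x - g y"
  show "dist (g x) (g y) \<le> 6 * K * dist x y"
  proof (cases "e = 0")
    case False
    define w where "w = (norm d / norm e) *\<^sub>R e"
    have w: "norm w = norm d" "e \<bullet> w = norm e * norm d"
      using False unfolding w_def by (auto simp: power2_norm_eq_inner[symmetric] power2_eq_square)
    have "norm (d + w) \<le> 2 * norm d" using norm_triangle_ineq[of d w] w by simp
    then have "(norm (d + w))\<^sup>2 \<le> (2 * norm d)\<^sup>2" by (rule power_mono) simp
    then have dw: "K * (norm (d + w))\<^sup>2 \<le> 4 * (K * (norm d)\<^sup>2)"
      using mult_left_mono[OF _ \<open>0 \<le> K\<close>] by (fastforce simp: power_mult_distrib)
    have "\<bar>F (y + w) - F x - g x \<bullet> (d + w)\<bar> \<le> K * (norm (d + w))\<^sup>2"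
      using two_sided[of x "d + w"] by (simp add: d_def)
    moreover have "\<bar>F y - F x - g x \<bullet> d\<bar> \<le> K * (norm d)\<^sup>2"
      using two_sided[of x d] by (simp add: d_def)
    moreover have "\<bar>F (y + w) - F y - g y \<bullet> w\<bar> \<le> K * (norm d)\<^sup>2"
      using two_sided[of y w] by (simp add: w)
    ultimately have "e \<bullet> w \<le> 6 * (K * (norm d)\<^sup>2)"
      using dw unfolding e_def by (simp add: inner_add_right inner_diff_left)
    then have "norm e * norm d \<le> (6 * K * norm d) * norm d" by (simp add: w power2_eq_square)
    moreover have "norm d \<noteq> 0" using False by (auto simp: d_def e_def)
    ultimately have "norm e \<le> 6 * K * norm d" by (simp add: mult_le_cancel_right)
    then show ?thesis unfolding e_def d_def by (simp add: dist_norm norm_minus_commute)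
  qed (simp add: e_def \<open>0 \<le> K\<close>)
qed (use \<open>0 \<le> K\<close> in simp)

text \<open>Lasry--Lions regularization: \<open>F\<close> is an inf-convolution of a sup-convolution of \<open>a\<close> and therefore
  \<open>C\<^sup>1\<^sup>,\<^sup>1\<close>. Clause (3) is what makes it usable for viscosity solutions: where \<open>F\<close> is touched from above
  by a paraboloid of opening \<open>\<alpha>\<close>, it agrees with the sup-convolution of \<open>a\<close> of clause (2).
  The constants 1/3, 1/2, 1 satisfy 1/(1/3) = 1/(1/2) + 1/1, the semigroup law of sup-convolutions.\<close>

proposition paraboloid_regularization:
  fixes a :: "'a::euclidean_space \<Rightarrow> real"
  assumes C: "compact C" "C \<noteq> {}" and cont: "continuous_on C a" and \<alpha>: "0 < \<alpha>"
  obtains F g where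
    "\<And>x w. \<bar>F (x + w) - F x - g x \<bullet> w\<bar> \<le> \<alpha> * (norm w)\<^sup>2"
    "\<And>x c. c \<in> C \<Longrightarrow> a c - \<alpha> / 2 * (norm (x - c))\<^sup>2 \<le> F x"
    "\<And>x p. (\<And>w. F (x + w) \<le> F x + \<alpha> * (p \<bullet> w) + \<alpha> / 2 * (norm w)\<^sup>2) \<Longrightarrow>
       x + p \<in> C \<and> F x = a (x + p) - \<alpha> / 2 * (norm p)\<^sup>2"
    "\<And>x. \<exists>c\<in>C. F x \<le> a c - \<alpha> / 3 * (norm (x - c))\<^sup>2"
proof -
  have "\<exists>c\<in>C. \<forall>c'\<in>C. a c' - \<alpha> / 3 * (norm (y - c'))\<^sup>2 \<le> a c - \<alpha> / 3 * (norm (y - c))\<^sup>2" for y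
    by (rule continuous_attains_sup[OF C]) (intro continuous_intros cont)
  then obtain c where c: "\<And>y. c y \<in> C"
    and c_max: "\<And>y c'. c' \<in> C \<Longrightarrow> a c' - \<alpha> / 3 * (norm (y - c'))\<^sup>2 \<le> a (c y) - \<alpha> / 3 * (norm (y - c y))\<^sup>2"
    by metis
  define S where "S y = a (c y) - \<alpha> / 3 * (norm (y - c y))\<^sup>2" for y
  have S: "a c' - \<alpha> / 3 * (norm (y - c'))\<^sup>2 \<le> S y" if "c' \<in> C" for c' y
    unfolding S_def by (rule c_max[OF that])
  have sq: "(norm (x - y))\<^sup>2 = x \<bullet> x - 2 * (x \<bullet> y) + y \<bullet> y" for x y :: 'a
    by (simp add: power2_norm_eq_inner inner_diff_left inner_diff_right inner_commute)
  \<comment> \<open>Adding the quadratic makes \<open>S\<close> a supremum of the affine functions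
    \<open>A\<close>, one for each base point. Convexity then gives continuity of
    \<open>S\<close>.\<close>
  have "convex_on UNIV (\<lambda>y. S y + \<alpha> / 3 * (norm y)\<^sup>2)"
  proof (rule convex_onI)
    fix t :: real and x y :: 'a assume t: "0 < t" "t < 1"
    let ?z = "(1 - t) *\<^sub>R x + t *\<^sub>R y"
    define b where "b = c ?z"
    define A where "A u = a b - \<alpha> / 3 * (b \<bullet> b) + 2 * \<alpha> / 3 * (u \<bullet> b)" for u
    have A: "A u = a b - \<alpha> / 3 * (norm (u - b))\<^sup>2 + \<alpha> / 3 * (norm u)\<^sup>2" for u
      unfolding A_def sq by (simp add: power2_norm_eq_inner algebra_simps)
    have "S ?z + \<alpha> / 3 * (norm ?z)\<^sup>2 = A ?z" unfolding A S_def b_def by simp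
    also have "\<dots> = (1 - t) * A x + t * A y"
      unfolding A_def by (simp only: inner_add_left inner_scaleR_left) (simp add: field_simps)
    also have "\<dots> \<le> (1 - t) * (S x + \<alpha> / 3 * (norm x)\<^sup>2) + t * (S y + \<alpha> / 3 * (norm y)\<^sup>2)"
      using t \<alpha> S[OF c[of ?z], of x] S[OF c[of ?z], of y] unfolding A b_def
      by (intro add_mono mult_left_mono) auto
    finally show "S ?z + \<alpha> / 3 * (norm ?z)\<^sup>2
        \<le> (1 - t) * (S x + \<alpha> / 3 * (norm x)\<^sup>2) + t * (S y + \<alpha> / 3 * (norm y)\<^sup>2)" .
  qed simp
  then have "continuous_on UNIV (\<lambda>y. S y + \<alpha> / 3 * (norm y)\<^sup>2)"
    by (rule convex_on_continuous[OF open_UNIV])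
  then have "continuous_on UNIV (\<lambda>y. (S y + \<alpha> / 3 * (norm y)\<^sup>2) - \<alpha> / 3 * (norm y)\<^sup>2)"
    by (rule continuous_on_diff) (intro continuous_intros)
  then have contS: "continuous_on UNIV S" by (simp only: add_diff_cancel_right')
  have "\<exists>y. \<forall>y'. S y + \<alpha> * (norm (x - y))\<^sup>2 \<le> S y' + \<alpha> * (norm (x - y'))\<^sup>2" for x
  proof -
    obtain c0 where c0: "c0 \<in> C" using C(2) by blast
    define k where "k = norm (x - c0)"
    define m where "m = a c0 - 2 * \<alpha> / 3 * k\<^sup>2"
    \<comment> \<open>Coercivity: the penalty with constant \<open>\<alpha>\<close> outweighs the
      decrease of \<open>S\<close>, which costs at most twice \<open>\<alpha> / 3\<close>; one third
      of \<open>\<alpha>\<close> remains.\<close>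
    have low: "m + \<alpha> / 3 * (norm (x - y))\<^sup>2 \<le> S y + \<alpha> * (norm (x - y))\<^sup>2" for y
    proof -
      have "norm (y - c0) \<le> norm (x - y) + k"
        unfolding k_def by (metis dist_norm dist_triangle3 dist_commute)
      then have "(norm (y - c0))\<^sup>2 \<le> (norm (x - y) + k)\<^sup>2" by (rule power_mono) simp
      also have "\<dots> \<le> 2 * (norm (x - y))\<^sup>2 + 2 * k\<^sup>2"
        using zero_le_power2[of "norm (x - y) - k"] by (simp add: power2_eq_square algebra_simps)
      finally have "\<alpha> / 3 * (norm (y - c0))\<^sup>2 \<le> \<alpha> / 3 * (2 * (norm (x - y))\<^sup>2 + 2 * k\<^sup>2)"
        using \<alpha> by (intro mult_left_mono) auto
      then show ?thesis using S[OF c0, of y] unfolding m_def by (simp add: algebra_simps)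
    qed
    define r where "r = sqrt (max 0 ((S x - m) * 3 / \<alpha>))"
    obtain y where "\<And>y'. - (S y' + \<alpha> * (norm (x - y'))\<^sup>2) \<le> - (S y + \<alpha> * (norm (x - y))\<^sup>2)"
    proof (rule continuous_attains_sup_coercive[of _ "norm x + r" x])
      show "continuous_on UNIV (\<lambda>y. - (S y + \<alpha> * (norm (x - y))\<^sup>2))"
        by (intro continuous_intros contS)
      fix y :: 'a assume "norm x + r < norm y"
      then have "r < norm (x - y)" using norm_triangle_ineq2[of y x] by (simp add: norm_minus_commute)
      moreover have "0 \<le> r" by (simp add: r_def)
      ultimately have "r\<^sup>2 < (norm (x - y))\<^sup>2" by (rule power_strict_mono) simp
      then have "(S x - m) * 3 / \<alpha> < (norm (x - y))\<^sup>2" by (simp add: r_def)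
      then have "S x - m < \<alpha> / 3 * (norm (x - y))\<^sup>2" using \<alpha> by (simp add: field_simps)
      then show "- (S y + \<alpha> * (norm (x - y))\<^sup>2) \<le> - (S x + \<alpha> * (norm (x - x))\<^sup>2)"
        using low[of y] by simp
    qed blast
    then show ?thesis unfolding neg_le_iff_le by blast
  qed
  then obtain y where y: "\<And>x y'. S (y x) + \<alpha> * (norm (x - y x))\<^sup>2 \<le> S y' + \<alpha> * (norm (x - y'))\<^sup>2"
    by metis
  define F where "F x = S (y x) + \<alpha> * (norm (x - y x))\<^sup>2" for x
  define g where "g x = (2 * \<alpha>) *\<^sub>R (x - y x)" for x
  have F: "F x \<le> S y' + \<alpha> * (norm (x - y'))\<^sup>2" for x y' unfolding F_def by (rule y)
  have upper: "F (x + w) \<le> F x + g x \<bullet> w + \<alpha> * (norm w)\<^sup>2" for x w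
  proof -
    have e: "(norm (x + w - y x))\<^sup>2 = (norm (x - y x))\<^sup>2 + 2 * ((x - y x) \<bullet> w) + (norm w)\<^sup>2"
      by (simp add: power2_norm_eq_inner inner_diff_left inner_diff_right inner_add_left inner_add_right inner_commute)
    show ?thesis using F[of "x + w" "y x"] unfolding e F_def[of x] g_def by (simp add: distrib_left)
  qed
  \<comment> \<open>This says that \<open>F\<close> plus \<open>\<alpha> / 2\<close> times the
    squared norm is convex, because \<open>x\<close> is the mean of \<open>x - t *\<^sub>R w\<close>
    and \<open>x + w\<close> with weights proportional to 1 and \<open>t\<close>. The minimizers for
    these two points are averaged to the competitor \<open>ym\<close> for \<open>x\<close>, and the
    maximizer \<open>b\<close> for \<open>ym\<close> serves as base point everywhere.\<close>
  have semiconvex: "(1 + t) * F x \<le> F (x - t *\<^sub>R w) + t * F (x + w) + \<alpha> / 2 * t * (1 + t) * (norm w)\<^sup>2"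
    if t: "0 < t" for t x w
  proof -
    define y0 y1 where "y0 = y (x - t *\<^sub>R w)" and "y1 = y (x + w)"
    define ym where "ym = (1 / (1 + t)) *\<^sub>R (y0 + t *\<^sub>R y1)"
    have ym: "(1 + t) *\<^sub>R ym = y0 + t *\<^sub>R y1" using t unfolding ym_def by simp
    define b where "b = c ym"
    have par: "(1 + t) * ((norm A)\<^sup>2 + t * (norm B)\<^sup>2) = (norm (A + t *\<^sub>R B))\<^sup>2 + t * (norm (A - B))\<^sup>2" for A B :: 'a
      unfolding power2_norm_eq_inner
      by (simp only: inner_diff_left inner_diff_right inner_add_left inner_add_right
        inner_scaleR_left inner_scaleR_right inner_commute[of B A]) (simp add: algebra_simps)
    have sc: "(norm ((1 + t) *\<^sub>R z))\<^sup>2 = (1 + t)\<^sup>2 * (norm z)\<^sup>2" for z :: 'a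
      by (simp add: power_mult_distrib)
    define d where "d = y0 - y1"
    have 1: "(1 + t) * ((norm (y0 - b))\<^sup>2 + t * (norm (y1 - b))\<^sup>2) = (1 + t)\<^sup>2 * (norm (ym - b))\<^sup>2 + t * (norm d)\<^sup>2"
      unfolding par sc[symmetric] by (simp add: d_def scaleR_diff_right ym) (simp add: algebra_simps)
    have 2: "(1 + t) * ((norm (x - t *\<^sub>R w - y0))\<^sup>2 + t * (norm (x + w - y1))\<^sup>2)
        = (1 + t)\<^sup>2 * (norm (x - ym))\<^sup>2 + t * (norm ((1 + t) *\<^sub>R w + d))\<^sup>2"
    proof -
      have "x - t *\<^sub>R w - y0 + t *\<^sub>R (x + w - y1) = (1 + t) *\<^sub>R (x - ym)"
        by (simp add: scaleR_diff_right ym) (simp add: algebra_simps)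
      moreover have "norm (x - t *\<^sub>R w - y0 - (x + w - y1)) = norm ((1 + t) *\<^sub>R w + d)"
        by (subst norm_minus_cancel[symmetric]) (simp add: d_def algebra_simps)
      ultimately show ?thesis unfolding par sc[symmetric] by simp
    qed
    have 3: "0 \<le> 3 * (1 + t)\<^sup>2 * (norm w)\<^sup>2 + 6 * (norm ((1 + t) *\<^sub>R w + d))\<^sup>2 - 2 * (norm d)\<^sup>2"
    proof -
      have "0 \<le> (norm (3 *\<^sub>R ((1 + t) *\<^sub>R w) + 2 *\<^sub>R d))\<^sup>2" by simp
      also have "\<dots> = 3 * (norm ((1 + t) *\<^sub>R w))\<^sup>2 + 6 * (norm ((1 + t) *\<^sub>R w + d))\<^sup>2 - 2 * (norm d)\<^sup>2"
        unfolding power2_norm_eq_inner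
        by (simp only: inner_add_left inner_add_right inner_scaleR_left inner_scaleR_right inner_commute[of d w])
          (simp add: algebra_simps)
      finally show ?thesis unfolding sc by (simp add: mult.assoc)
    qed
    have "(1 + t) * F x \<le> (1 + t) * (a b - \<alpha> / 3 * (norm (ym - b))\<^sup>2 + \<alpha> * (norm (x - ym))\<^sup>2)"
      using t F[of x ym] unfolding S_def b_def by (intro mult_left_mono) auto
    moreover have "a b - \<alpha> / 3 * (norm (y0 - b))\<^sup>2 + \<alpha> * (norm (x - t *\<^sub>R w - y0))\<^sup>2 \<le> F (x - t *\<^sub>R w)"
      using S[OF c[of ym], of y0] unfolding F_def y0_def b_def by simp
    moreover have "t * (a b - \<alpha> / 3 * (norm (y1 - b))\<^sup>2 + \<alpha> * (norm (x + w - y1))\<^sup>2) \<le> t * F (x + w)"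
      using S[OF c[of ym], of y1] t unfolding F_def y1_def b_def by (intro mult_left_mono) auto
    ultimately have "(1 + t) * F x - F (x - t *\<^sub>R w) - t * F (x + w) \<le>
      (1 + t) * (- \<alpha> / 3 * (norm (ym - b))\<^sup>2 + \<alpha> * (norm (x - ym))\<^sup>2)
      + \<alpha> / 3 * ((norm (y0 - b))\<^sup>2 + t * (norm (y1 - b))\<^sup>2) - \<alpha> * ((norm (x - t *\<^sub>R w - y0))\<^sup>2 + t * (norm (x + w - y1))\<^sup>2)"
      by (simp add: algebra_simps)
    then have "(1 + t) * ((1 + t) * F x - F (x - t *\<^sub>R w) - t * F (x + w)) \<le> (1 + t) * (
      (1 + t) * (- \<alpha> / 3 * (norm (ym - b))\<^sup>2 + \<alpha> * (norm (x - ym))\<^sup>2)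
      + \<alpha> / 3 * ((norm (y0 - b))\<^sup>2 + t * (norm (y1 - b))\<^sup>2) - \<alpha> * ((norm (x - t *\<^sub>R w - y0))\<^sup>2 + t * (norm (x + w - y1))\<^sup>2))"
      using t by (intro mult_left_mono) auto
    also have "\<dots> = (1 + t)\<^sup>2 * (- \<alpha> / 3 * (norm (ym - b))\<^sup>2 + \<alpha> * (norm (x - ym))\<^sup>2)
      + \<alpha> / 3 * ((1 + t) * ((norm (y0 - b))\<^sup>2 + t * (norm (y1 - b))\<^sup>2))
      - \<alpha> * ((1 + t) * ((norm (x - t *\<^sub>R w - y0))\<^sup>2 + t * (norm (x + w - y1))\<^sup>2))"
      by (simp add: field_simps power2_eq_square)
    also have "\<dots> = \<alpha> * t / 6 * (2 * (norm d)\<^sup>2 - 6 * (norm ((1 + t) *\<^sub>R w + d))\<^sup>2)"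
      unfolding 1 2 by (simp add: field_simps)
    also have "\<dots> \<le> \<alpha> * t / 6 * (3 * (1 + t)\<^sup>2 * (norm w)\<^sup>2)"
      using 3 t \<alpha> by (intro mult_left_mono) auto
    also have "\<dots> = (1 + t) * (\<alpha> / 2 * t * (1 + t) * (norm w)\<^sup>2)" by (simp add: power2_eq_square)
    finally show ?thesis using t by simp
  qed
  \<comment> \<open>Semiconvexity combined with \<open>upper\<close> gives the constant
    \<open>\<alpha> / 2 * (1 + 3 * t)\<close>, and \<open>t = 1/3\<close> is the largest value for
    which this is at most \<open>\<alpha>\<close>.\<close>
  have lower: "F x + g x \<bullet> w - \<alpha> * (norm w)\<^sup>2 \<le> F (x + w)" for x w
    using semiconvex[of "1/3" x w] upper[of x "- (1/3) *\<^sub>R w"]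
    by (simp add: power_mult_distrib power2_eq_square field_simps)
  \<comment> \<open>The semigroup law as a completed square: \<open>\<alpha> / 2\<close> times the
    square of \<open>v\<close>, minus \<open>\<alpha> / 3\<close> times that of
    \<open>v - u\<close>, plus \<open>\<alpha>\<close> times that of \<open>u\<close>, equals
    \<open>\<alpha> / 6\<close> times that of \<open>v + 2 *\<^sub>R u\<close>. The fact named 3 in
    the proof of \<open>semiconvex\<close> is the same inequality with
    \<open>v = (1 + t) *\<^sub>R w\<close> and \<open>u = v + d\<close>.\<close>
  have sup_conv: "a c' - \<alpha> / 2 * (norm (x - c'))\<^sup>2 \<le> F x" if "c' \<in> C" for x c'
  proof -
    define u v where "u = x - y x" and "v = x - c'"
    have e: "y x - c' = v - u" by (simp add: u_def v_def)
    have "0 \<le> (norm (v + 2 *\<^sub>R u))\<^sup>2" by simp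
    then have "2 * (norm (v - u))\<^sup>2 \<le> 3 * (norm v)\<^sup>2 + 6 * (norm u)\<^sup>2"
      unfolding power2_norm_eq_inner
      by (simp only: inner_diff_left inner_diff_right inner_add_left inner_add_right inner_scaleR_left inner_scaleR_right inner_commute[of u v])
         simp
    then have "\<alpha> / 6 * (2 * (norm (v - u))\<^sup>2) \<le> \<alpha> / 6 * (3 * (norm v)\<^sup>2 + 6 * (norm u)\<^sup>2)"
      using \<alpha> by (intro mult_left_mono) auto
    then show ?thesis using S[OF that, of "y x"] unfolding F_def e u_def[symmetric] v_def[symmetric]
      by (simp add: algebra_simps)
  qed
  have contact: "x + p \<in> C \<and> F x = a (x + p) - \<alpha> / 2 * (norm p)\<^sup>2"
    if "\<And>w. F (x + w) \<le> F x + \<alpha> * (p \<bullet> w) + \<alpha> / 2 * (norm w)\<^sup>2" for x p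
  proof -
    \<comment> \<open>If \<open>F\<close> has gradient \<open>\<alpha> *\<^sub>R p\<close> at
      \<open>x\<close>, then \<open>g x = (2 * \<alpha>) *\<^sub>R (x - y x)\<close> places the
      minimizer at \<open>y0\<close>. Its base point is \<open>x + e\<close>; testing the paraboloid
      at half of \<open>e - p\<close> and comparing forces \<open>e = p\<close>.\<close>
    define y0 where "y0 = x - (1/2) *\<^sub>R p"
    define e where "e = c y0 - x"
    define w where "w = (1/2) *\<^sub>R (e - p)"
    have "F x \<le> a (x + e) - \<alpha> / 3 * (norm (e + (1/2) *\<^sub>R p))\<^sup>2 + \<alpha> * (norm ((1/2) *\<^sub>R p))\<^sup>2"
      using F[of x y0] unfolding S_def e_def y0_def by (simp add: norm_minus_commute algebra_simps)
    then have 1: "F x \<le> a (x + e) - \<alpha> / 3 * (e \<bullet> e + e \<bullet> p + (p \<bullet> p) / 4) + \<alpha> * (p \<bullet> p) / 4"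
      unfolding power2_norm_eq_inner
      by (simp only: inner_add_left inner_add_right inner_scaleR_left inner_scaleR_right inner_commute[of p e]) (simp add: algebra_simps)
    have "a (x + e) - \<alpha> / 2 * (norm ((1/2) *\<^sub>R (e + p)))\<^sup>2 \<le> F (x + w)"
    proof -
      have "x + w - c y0 = - ((1/2) *\<^sub>R (e + p))"
        unfolding w_def e_def by (simp add: algebra_simps) (simp flip: scaleR_add_left)
      then show ?thesis using sup_conv[OF c[of y0], of "x + w"] by (simp add: e_def)
    qed
    also have "\<dots> \<le> F x + \<alpha> * (p \<bullet> w) + \<alpha> / 2 * (norm w)\<^sup>2" by (rule that)
    finally have 2: "a (x + e) - \<alpha> / 8 * (e \<bullet> e + 2 * (e \<bullet> p) + p \<bullet> p)
        \<le> F x + \<alpha> / 2 * (e \<bullet> p - p \<bullet> p) + \<alpha> / 8 * (e \<bullet> e - 2 * (e \<bullet> p) + p \<bullet> p)"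
      unfolding w_def power2_norm_eq_inner
      by (simp only: inner_add_left inner_add_right inner_diff_left inner_diff_right inner_scaleR_left inner_scaleR_right inner_commute[of p e]) (simp add: field_simps)
    have "\<alpha> * (e \<bullet> e - 2 * (e \<bullet> p) + p \<bullet> p) \<le> 0"
      using 1 2 by (simp add: field_simps)
    then have "(norm (e - p))\<^sup>2 \<le> 0" using \<alpha> unfolding sq by (simp add: mult_le_0_iff)
    then have "e = p" by simp
    moreover have "x + e \<in> C" using c[of y0] by (simp add: e_def)
    ultimately have p: "x + p \<in> C" by simp
    have "F x \<le> a (x + p) - \<alpha> / 2 * (norm p)\<^sup>2"
      using 1 unfolding \<open>e = p\<close> by (simp add: power2_norm_eq_inner algebra_simps)
    then show ?thesis using p sup_conv[OF p, of x] by simp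
  qed
  show ?thesis
  proof
    show "\<bar>F (x + w) - F x - g x \<bullet> w\<bar> \<le> \<alpha> * (norm w)\<^sup>2" for x w
      using upper[of x w] lower[of x w] by linarith
    show "\<exists>c\<in>C. F x \<le> a c - \<alpha> / 3 * (norm (x - c))\<^sup>2" for x
      using F[of x x] c[of x] by (auto simp: S_def)
  qed (fact sup_conv contact)+
qed

section \<open>Second-order behaviour at contact points\<close>

lemma two_sided_paraboloids_imp_has_derivative:
  fixes F :: "'a::real_inner \<Rightarrow> real"
  assumes two_sided: "\<And>x w. \<bar>F (x + w) - F x - g x \<bullet> w\<bar> \<le> K * (norm w)\<^sup>2"
  shows "(F has_derivative (\<lambda>w. g x \<bullet> w)) (at x)"
proof -
  have "((\<lambda>w. norm (F (x + w) - F x - g x \<bullet> w) / norm w) \<longlongrightarrow> 0) (at 0)"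
  proof (rule Lim_null_comparison)
    show "((\<lambda>w::'a. K * norm w) \<longlongrightarrow> 0) (at 0)"
      by (rule tendsto_eq_intros refl)+ simp
    have "norm (norm (F (x + w) - F x - g x \<bullet> w) / norm w) \<le> K * norm w" for w
      using two_sided[of x w] by (cases "w = 0") (auto simp: divide_simps power2_eq_square mult.assoc)
    then show "\<forall>\<^sub>F w in at 0. norm (norm (F (x + w) - F x - g x \<bullet> w) / norm w) \<le> K * norm w"
      by simp
  qed
  then show ?thesis unfolding has_derivative_at by (simp add: bounded_linear_inner_right)
qed

text \<open>Mean value theorem along the segment, after the first-order and second-order model is
  subtracted: the derivative at \<open>t\<close> is the defect of \<open>g\<close> from linearity at
  \<open>t *\<^sub>R w\<close>, paired with \<open>w\<close>. The error is relative to
  \<open>h\<close>, not to \<open>norm w\<close>, because linearity is known at the scale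
  \<open>h\<close> only.\<close>

lemma second_order_expansion:
  fixes F :: "'a::real_inner \<Rightarrow> real"
  assumes two_sided: "\<And>x w. \<bar>F (x + w) - F x - g x \<bullet> w\<bar> \<le> K * (norm w)\<^sup>2"
    and L: "linear L" and near: "\<And>w. norm w \<le> h \<Longrightarrow> norm (g (x + w) - g x - L w) \<le> \<eta> * h"
    and w: "norm w \<le> h" and "0 \<le> \<eta>"
  shows "\<bar>F (x + w) - F x - g x \<bullet> w - (w \<bullet> L w) / 2\<bar> \<le> \<eta> * h\<^sup>2"
proof -
  define f where "f t = F (x + t *\<^sub>R w) - t * (g x \<bullet> w) - t\<^sup>2 / 2 * (w \<bullet> L w)" for t
  have der: "(f has_real_derivative ((g (x + t *\<^sub>R w) - g x - L (t *\<^sub>R w)) \<bullet> w)) (at t)" for t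
  proof -
    have "((\<lambda>t. x + t *\<^sub>R w) has_derivative (\<lambda>s. s *\<^sub>R w)) (at t)"
      by (auto intro!: derivative_eq_intros)
    from has_derivative_compose[OF this two_sided_paraboloids_imp_has_derivative[OF two_sided]]
    have "((\<lambda>t. F (x + t *\<^sub>R w)) has_real_derivative (g (x + t *\<^sub>R w) \<bullet> w)) (at t)"
      unfolding has_field_derivative_def by (simp add: mult.commute[of _ "g _ \<bullet> w"])
    then show ?thesis unfolding f_def
      by (auto intro!: derivative_eq_intros simp: linear_scale[OF L] inner_diff_left inner_diff_right inner_commute)
  qed
  obtain t where t: "0 < t" "t < 1" "f 1 - f 0 = (1 - 0) * ((g (x + t *\<^sub>R w) - g x - L (t *\<^sub>R w)) \<bullet> w)"
    using MVT2[of 0 1 f, OF _ der] by auto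
  have h: "0 \<le> h" using w norm_ge_zero order_trans by blast
  have "norm (t *\<^sub>R w) \<le> h"
    using t w mult_left_le_one_le[of "norm w" t] by auto
  have "\<bar>f 1 - f 0\<bar> \<le> norm (g (x + t *\<^sub>R w) - g x - L (t *\<^sub>R w)) * norm w"
    unfolding t by (simp add: Cauchy_Schwarz_ineq2)
  also have "\<dots> \<le> (\<eta> * h) * h"
    using near[OF \<open>norm (t *\<^sub>R w) \<le> h\<close>] w h \<open>0 \<le> \<eta>\<close> by (intro mult_mono) auto
  finally show ?thesis by (simp add: f_def power2_eq_square)
qed

text \<open>Jensen's lemma. The gradient maps the contact set onto a ball, so the contact set is not
  negligible.\<close>

lemma contact_set_not_negligible:
  fixes F :: "'a::euclidean_space \<Rightarrow> real"
  assumes two_sided: "\<And>x w. \<bar>F (x + w) - F x - g x \<bullet> w\<bar> \<le> K * (norm w)\<^sup>2" and "0 \<le> K"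
    and coercive: "\<And>p x. norm p \<le> \<eta> \<Longrightarrow> B < norm x \<Longrightarrow> F x - p \<bullet> x < F 0" and "0 < \<eta>"
  defines "S \<equiv> {x. norm (g x) \<le> \<eta> \<and> (\<forall>w. F (x + w) \<le> F x + g x \<bullet> w)}"
  shows "closed S" "bounded S" "\<not> negligible S"
proof -
  have lip: "(6 * K)-lipschitz_on UNIV g"
    by (rule two_sided_paraboloids_imp_lipschitz[OF two_sided \<open>0 \<le> K\<close>])
  have contg: "continuous_on UNIV g" using lip by (rule lipschitz_on_continuous_on)
  have contF: "continuous_on UNIV F"
    using two_sided_paraboloids_imp_has_derivative[OF two_sided]
    by (meson continuous_at_imp_continuous_on has_derivative_continuous)
  show "closed S" unfolding S_def
    by (intro closed_Collect_conj closed_Collect_all closed_Collect_le continuous_intros contg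
        contF continuous_on_compose2[OF contF]) auto
  have "norm x \<le> B" if "x \<in> S" for x
  proof (rule ccontr)
    assume "\<not> norm x \<le> B"
    then have "F x - g x \<bullet> x < F 0" using coercive that unfolding S_def by auto
    moreover have "F (x + - x) \<le> F x + g x \<bullet> - x" using that unfolding S_def by blast
    ultimately show False by simp
  qed
  then show "bounded S" by (rule boundedI)
  have "p \<in> g ` S" if "norm p \<le> \<eta>" for p
  proof -
    have "continuous_on UNIV (\<lambda>x. F x - p \<bullet> x)" by (intro continuous_intros contF)
    then obtain x where x: "\<And>y. F y - p \<bullet> y \<le> F x - p \<bullet> x"
      by (rule continuous_attains_sup_coercive[of _ B 0])
        (use coercive[OF \<open>norm p \<le> \<eta>\<close>] in \<open>auto intro: less_imp_le\<close>)
    have up: "F (x + w) \<le> F x + p \<bullet> w" for w using x[of "x + w"] by (simp add: inner_add_right)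
    define e where "e = g x - p"
    \<comment> \<open>Where the tilted function is maximal its gradient must be \<open>p\<close>: a
      step \<open>t *\<^sub>R e\<close> gains \<open>t\<close> times the squared norm of
      \<open>e\<close> and loses at most \<open>K\<close> times the square of the step, which is
      less once \<open>K * t < 1\<close>.\<close>
    define t where "t = 1 / (2 * (K + 1))"
    have t: "0 < t" "K * t < 1" using \<open>0 \<le> K\<close> by (auto simp: t_def field_simps)
    have "e \<bullet> (t *\<^sub>R e) \<le> K * (norm (t *\<^sub>R e))\<^sup>2"
      using two_sided[of x "t *\<^sub>R e"] up[of "t *\<^sub>R e"] inner_diff_left[of "g x" p "t *\<^sub>R e", folded e_def]
      by linarith
    then have "t * (norm e)\<^sup>2 \<le> t * ((K * t) * (norm e)\<^sup>2)"
      by (simp add: power2_norm_eq_inner power_mult_distrib) (simp add: power2_eq_square algebra_simps)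
    then have "(norm e)\<^sup>2 \<le> (K * t) * (norm e)\<^sup>2" using t by simp
    then have "(1 - K * t) * (norm e)\<^sup>2 \<le> 0" by (simp add: algebra_simps)
    then have "norm e = 0" using t(2) by (simp add: mult_le_0_iff)
    then have "g x = p" by (simp add: e_def)
    then show ?thesis using up that by (auto simp: S_def intro!: image_eqI[of _ _ x])
  qed
  then have "ball 0 \<eta> \<subseteq> g ` S" by auto
  moreover have "negligible (g ` S)" if "negligible S"
  proof (rule negligible_locally_Lipschitz_image[OF _ that])
    fix x assume "x \<in> S"
    have "norm (g y - g x) \<le> 6 * K * norm (y - x)" for y
      using lipschitz_onD[OF lip, of y x] by (simp add: dist_norm)
    then show "\<exists>T B. open T \<and> x \<in> T \<and> (\<forall>y\<in>S \<inter> T. norm (g y - g x) \<le> B * norm (y - x))"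
      by blast
  qed simp
  moreover have "\<not> negligible (ball (0::'a) \<eta>)"
    using \<open>0 < \<eta>\<close> by (intro open_not_negligible) auto
  ultimately show "\<not> negligible S" using negligible_subset by blast
qed

text \<open>A form of the Crandall--Ishii lemma. The points \<open>z + p\<close>, \<open>z' + p'\<close> are the base points in \<open>C\<close>
  of the sup-convolutions at the contact point \<open>(z, z')\<close>.\<close>

proposition theorem_on_sums:
  fixes a b :: "'a::euclidean_space \<Rightarrow> real"
  assumes C: "compact C" "C \<noteq> {}" and conta: "continuous_on C a" and contb: "continuous_on C b"
    and \<alpha>: "0 < \<alpha>" and \<eta>: "0 < \<eta>"
  obtains r r' p z z' p' h L L' where
    "norm r \<le> \<eta>" "norm r' \<le> \<eta>"
    "\<alpha> *\<^sub>R p = r + \<alpha> *\<^sub>R (z - z')" "\<alpha> *\<^sub>R p' = r' - \<alpha> *\<^sub>R (z - z')"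
    "z + p \<in> C" "z' + p' \<in> C"
    "\<And>x x' c c'. c \<in> C \<Longrightarrow> c' \<in> C \<Longrightarrow>
       a c + b c' - \<alpha> / 2 * ((norm (x - c))\<^sup>2 + (norm (x' - c'))\<^sup>2 + (norm (x - x'))\<^sup>2) - r \<bullet> x - r' \<bullet> x'
       \<le> a (z + p) + b (z' + p') - \<alpha> / 2 * ((norm p)\<^sup>2 + (norm p')\<^sup>2 + (norm (z - z'))\<^sup>2) - r \<bullet> z - r' \<bullet> z'"
    "0 < h" "h < \<eta>" "linear L" "linear L'"
    "\<And>w. norm (L w) \<le> (6 * \<alpha> + \<eta>) * norm w" "\<And>w. norm (L' w) \<le> (6 * \<alpha> + \<eta>) * norm w"
    "\<And>w w'. w \<bullet> L w + w' \<bullet> L' w' \<le> \<alpha> * (norm (w - w'))\<^sup>2 + 4 * \<eta> * ((norm w)\<^sup>2 + (norm w')\<^sup>2)"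
    "\<And>w. norm w \<le> h \<Longrightarrow> z + p + w \<in> C \<Longrightarrow>
       a (z + p + w) \<le> a (z + p) + \<alpha> * (p \<bullet> w) + (w \<bullet> L w) / 2 + \<eta> * h\<^sup>2"
    "\<And>w. norm w \<le> h \<Longrightarrow> z' + p' + w \<in> C \<Longrightarrow>
       b (z' + p' + w) \<le> b (z' + p') + \<alpha> * (p' \<bullet> w) + (w \<bullet> L' w) / 2 + \<eta> * h\<^sup>2"
proof -
  obtain Fa ga where Fa: "\<And>x w. \<bar>Fa (x + w) - Fa x - ga x \<bullet> w\<bar> \<le> \<alpha> * (norm w)\<^sup>2"
    and Fa_ge: "\<And>x c. c \<in> C \<Longrightarrow> a c - \<alpha> / 2 * (norm (x - c))\<^sup>2 \<le> Fa x"
    and Fa_contact: "\<And>x p. (\<And>w. Fa (x + w) \<le> Fa x + \<alpha> * (p \<bullet> w) + \<alpha> / 2 * (norm w)\<^sup>2) \<Longrightarrow>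
       x + p \<in> C \<and> Fa x = a (x + p) - \<alpha> / 2 * (norm p)\<^sup>2"
    and Fa_le: "\<And>x. \<exists>c\<in>C. Fa x \<le> a c - \<alpha> / 3 * (norm (x - c))\<^sup>2"
    using paraboloid_regularization[OF C conta \<alpha>] by metis
  obtain Fb gb where Fb: "\<And>x w. \<bar>Fb (x + w) - Fb x - gb x \<bullet> w\<bar> \<le> \<alpha> * (norm w)\<^sup>2"
    and Fb_ge: "\<And>x c. c \<in> C \<Longrightarrow> b c - \<alpha> / 2 * (norm (x - c))\<^sup>2 \<le> Fb x"
    and Fb_contact: "\<And>x p. (\<And>w. Fb (x + w) \<le> Fb x + \<alpha> * (p \<bullet> w) + \<alpha> / 2 * (norm w)\<^sup>2) \<Longrightarrow>
       x + p \<in> C \<and> Fb x = b (x + p) - \<alpha> / 2 * (norm p)\<^sup>2"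
    and Fb_le: "\<And>x. \<exists>c\<in>C. Fb x \<le> b c - \<alpha> / 3 * (norm (x - c))\<^sup>2"
    using paraboloid_regularization[OF C contb \<alpha>] by metis
  have sq_add: "(norm (x + y))\<^sup>2 = (norm x)\<^sup>2 + 2 * (x \<bullet> y) + (norm y)\<^sup>2" for x y :: 'a
    by (simp add: power2_norm_eq_inner inner_add_left inner_add_right inner_commute)
  have sq_add_le: "(norm (x + y))\<^sup>2 \<le> 2 * (norm x)\<^sup>2 + 2 * (norm y)\<^sup>2" for x y :: 'a
  proof -
    have "0 \<le> (norm (x - y))\<^sup>2" by simp
    then show ?thesis by (simp add: power2_norm_eq_inner inner_diff_left inner_diff_right inner_add_left inner_add_right inner_commute)
  qed
  have fst_le: "norm (fst Q) \<le> norm Q" and snd_le: "norm (snd Q) \<le> norm Q" for Q :: "'a \<times> 'a"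
    by (metis norm_fst_le prod.collapse, metis norm_snd_le prod.collapse)
  \<comment> \<open>\<open>G\<close> below is the gradient of this doubled function. The constant
    \<open>2 * \<alpha>\<close> in \<open>H_two_sided\<close> is the sum of \<open>\<alpha>\<close>
    from the regularizations and \<open>\<alpha>\<close> from the penalization.\<close>
  define H where "H Z = Fa (fst Z) + Fb (snd Z) - \<alpha> / 2 * (norm (fst Z - snd Z))\<^sup>2" for Z
  define G where "G Z = (ga (fst Z) - \<alpha> *\<^sub>R (fst Z - snd Z), gb (snd Z) + \<alpha> *\<^sub>R (fst Z - snd Z))" for Z
  have H_expand: "H (Z + W) - H Z - G Z \<bullet> W = (Fa (fst Z + fst W) - Fa (fst Z) - ga (fst Z) \<bullet> fst W)
      + (Fb (snd Z + snd W) - Fb (snd Z) - gb (snd Z) \<bullet> snd W) - \<alpha> / 2 * (norm (fst W - snd W))\<^sup>2" for Z W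
  proof -
    have e: "fst (Z + W) - snd (Z + W) = (fst Z - snd Z) + (fst W - snd W)" by simp
    show ?thesis unfolding H_def e sq_add G_def
      by (simp add: inner_prod_def inner_diff_left inner_diff_right inner_add_left algebra_simps)
  qed
  have normP: "(norm W)\<^sup>2 = (norm (fst W))\<^sup>2 + (norm (snd W))\<^sup>2" for W :: "'a \<times> 'a"
    by (simp add: power2_norm_eq_inner inner_prod_def)
  have H_two_sided: "\<bar>H (Z + W) - H Z - G Z \<bullet> W\<bar> \<le> (2 * \<alpha>) * (norm W)\<^sup>2" for Z W
  proof -
    have "\<alpha> / 2 * (norm (fst W - snd W))\<^sup>2 \<le> \<alpha> / 2 * (2 * (norm (fst W))\<^sup>2 + 2 * (norm (snd W))\<^sup>2)"
      using sq_add_le[of "fst W" "- snd W"] \<alpha> by (intro mult_left_mono) auto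
    moreover have "0 \<le> \<alpha> / 2 * (norm (fst W - snd W))\<^sup>2" using \<alpha> by simp
    ultimately show ?thesis unfolding H_expand normP
      using Fa[of "fst Z" "fst W"] Fb[of "snd Z" "snd W"] by (simp add: distrib_left)
  qed
  obtain R where R: "\<And>c. c \<in> C \<Longrightarrow> norm c \<le> R"
    using compact_imp_bounded[OF C(1)] unfolding bounded_iff by blast
  obtain Ma where Ma: "\<And>c. c \<in> C \<Longrightarrow> a c \<le> Ma" using continuous_attains_sup[OF C conta] by blast
  obtain Mb where Mb: "\<And>c. c \<in> C \<Longrightarrow> b c \<le> Mb" using continuous_attains_sup[OF C contb] by blast
  define M where "M = Ma + Mb + 2 * \<alpha> / 3 * R\<^sup>2"
  \<comment> \<open>Quadratic decay from the last clause of the regularization, since base points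
    stay in the bounded set \<open>C\<close>; it makes tilts of size \<open>\<eta>\<close> harmless
    outside the radius \<open>B\<close>.\<close>
  have H_le: "H Z \<le> M - \<alpha> / 6 * (norm Z)\<^sup>2" for Z
  proof -
    have far: "\<alpha> / 6 * (norm x)\<^sup>2 \<le> \<alpha> / 3 * (norm (x - c))\<^sup>2 + \<alpha> / 3 * R\<^sup>2" if "c \<in> C" for x c
    proof -
      have "(norm c)\<^sup>2 \<le> R\<^sup>2" using R[OF that] by (intro power_mono) auto
      then have "(norm x)\<^sup>2 \<le> 2 * (norm (x - c))\<^sup>2 + 2 * R\<^sup>2" using sq_add_le[of "x - c" c] by simp
      then have "\<alpha> / 6 * (norm x)\<^sup>2 \<le> \<alpha> / 6 * (2 * (norm (x - c))\<^sup>2 + 2 * R\<^sup>2)"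
        using \<alpha> by (intro mult_left_mono) auto
      then show ?thesis by (simp add: distrib_left)
    qed
    obtain c where "c \<in> C" "Fa (fst Z) \<le> a c - \<alpha> / 3 * (norm (fst Z - c))\<^sup>2"
      using Fa_le by blast
    moreover obtain c' where "c' \<in> C" "Fb (snd Z) \<le> b c' - \<alpha> / 3 * (norm (snd Z - c'))\<^sup>2"
      using Fb_le by blast
    moreover have "0 \<le> \<alpha> / 2 * (norm (fst Z - snd Z))\<^sup>2" using \<alpha> by simp
    ultimately show ?thesis
      using far[of c "fst Z"] far[of c' "snd Z"] Ma[of c] Mb[of c'] unfolding H_def M_def normP
      by (simp add: distrib_left)
  qed
  define B where "B = 1 + 6 / \<alpha> * (\<eta> + \<bar>M - H 0\<bar>)"
  have coercive: "H Z - P \<bullet> Z < H 0" if "norm P \<le> \<eta>" "B < norm Z" for P Z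
  proof -
    define s where "s = norm Z"
    have "1 \<le> B" using \<alpha> \<eta> by (simp add: B_def)
    then have s: "1 < s" "B < s" using that s_def by auto
    have "\<bar>P \<bullet> Z\<bar> \<le> norm P * s" unfolding s_def by (rule Cauchy_Schwarz_ineq2)
    also have "\<dots> \<le> \<eta> * s" using that s by (intro mult_right_mono) auto
    finally have 1: "- (P \<bullet> Z) \<le> \<eta> * s" by linarith
    have 2: "\<bar>M - H 0\<bar> \<le> \<bar>M - H 0\<bar> * s" using s by (simp add: mult_le_cancel_left1)
    have "\<alpha> / 6 + \<eta> + \<bar>M - H 0\<bar> = \<alpha> / 6 * B" using \<alpha> unfolding B_def by (simp add: field_simps)
    then have "\<eta> + \<bar>M - H 0\<bar> < \<alpha> / 6 * B" using \<alpha> by linarith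
    also have "\<dots> < \<alpha> / 6 * s" using s \<alpha> by simp
    finally have "(\<eta> + \<bar>M - H 0\<bar>) * s < (\<alpha> / 6 * s) * s" using s by (intro mult_strict_right_mono) auto
    then have "\<eta> * s + \<bar>M - H 0\<bar> < \<alpha> / 6 * s\<^sup>2" using 2 by (simp add: power2_eq_square distrib_right)
    then show ?thesis using H_le[of Z] 1 unfolding s_def by linarith
  qed
  define S where "S = {Z. norm (G Z) \<le> \<eta> \<and> (\<forall>W. H (Z + W) \<le> H Z + G Z \<bullet> W)}"
  have "0 \<le> 2 * \<alpha>" using \<alpha> by simp
  note S = contact_set_not_negligible[OF H_two_sided this coercive \<eta>, folded S_def]
  \<comment> \<open>The almost linear map is sought for the two gradients without the penalization,
    whose contribution to \<open>G\<close> is exactly linear. The diagonal blocks of the map then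
    serve as separate Hessians of \<open>Fa\<close> and \<open>Fb\<close>.\<close>
  define \<Gamma> where "\<Gamma> Z = (ga (fst Z), gb (snd Z))" for Z
  have lipa: "(6 * \<alpha>)-lipschitz_on UNIV ga" and lipb: "(6 * \<alpha>)-lipschitz_on UNIV gb"
    using two_sided_paraboloids_imp_lipschitz[OF Fa] two_sided_paraboloids_imp_lipschitz[OF Fb] \<alpha> by auto
  have lip: "(6 * \<alpha>)-lipschitz_on UNIV \<Gamma>"
  proof (rule lipschitz_onI)
    fix Y Z :: "'a \<times> 'a"
    have "(dist (\<Gamma> Y) (\<Gamma> Z))\<^sup>2 = (dist (ga (fst Y)) (ga (fst Z)))\<^sup>2 + (dist (gb (snd Y)) (gb (snd Z)))\<^sup>2"
      by (simp add: \<Gamma>_def dist_Pair_Pair)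
    also have "\<dots> \<le> (6 * \<alpha> * dist (fst Y) (fst Z))\<^sup>2 + (6 * \<alpha> * dist (snd Y) (snd Z))\<^sup>2"
      using lipschitz_onD[OF lipa] lipschitz_onD[OF lipb] by (intro add_mono power_mono) auto
    also have "\<dots> = (6 * \<alpha> * dist Y Z)\<^sup>2"
      by (simp add: dist_prod_def power_mult_distrib distrib_left)
    finally show "dist (\<Gamma> Y) (\<Gamma> Z) \<le> 6 * \<alpha> * dist Y Z"
      by (rule power2_le_imp_le) (use \<alpha> in simp)
  qed (use \<alpha> in simp)
  obtain Z h \<Lambda> where Z: "Z \<in> S" and h: "0 < h" "h < \<eta>" and \<Lambda>: "linear \<Lambda>"
    and near: "\<And>W. norm W \<le> h \<Longrightarrow> norm (\<Gamma> (Z + W) - \<Gamma> Z - \<Lambda> W) \<le> \<eta> * h"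
    using lipschitz_near_linear[OF lip borel_closed[OF S(1)] S(2,3) \<eta>] by blast
  obtain z z' where zz: "Z = (z, z')" by (cases Z)
  define L where "L w = fst (\<Lambda> (w, 0))" for w
  define L' where "L' w = snd (\<Lambda> (0, w))" for w
  have "linear (fst \<circ> \<Lambda> \<circ> (\<lambda>w. (w, 0)))" "linear (snd \<circ> \<Lambda> \<circ> (\<lambda>w. (0, w)))"
    by (intro linear_compose linear_fst linear_snd \<Lambda> linearI; simp)+
  then have L: "linear L" "linear L'"
    unfolding L_def L'_def o_def by simp_all
  have neara: "norm (ga (z + w) - ga z - L w) \<le> \<eta> * h" if "norm w \<le> h" for w
    using near[of "(w, 0)"] that fst_le[of "\<Gamma> (Z + (w, 0)) - \<Gamma> Z - \<Lambda> (w, 0)"]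
    by (simp add: \<Gamma>_def zz L_def)
  have nearb: "norm (gb (z' + w) - gb z' - L' w) \<le> \<eta> * h" if "norm w \<le> h" for w
    using near[of "(0, w)"] that snd_le[of "\<Gamma> (Z + (0, w)) - \<Gamma> Z - \<Lambda> (0, w)"]
    by (simp add: \<Gamma>_def zz L'_def)
  define r where "r = ga z - \<alpha> *\<^sub>R (z - z')"
  define r' where "r' = gb z' + \<alpha> *\<^sub>R (z - z')"
  have GZ: "G Z = (r, r')" by (simp add: G_def zz r_def r'_def)
  define p where "p = (1 / \<alpha>) *\<^sub>R ga z"
  define p' where "p' = (1 / \<alpha>) *\<^sub>R gb z'"
  have p: "\<alpha> *\<^sub>R p = ga z" "\<alpha> *\<^sub>R p' = gb z'" using \<alpha> by (simp_all add: p_def p'_def)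
  have pi: "\<alpha> * (p \<bullet> w) = ga z \<bullet> w" "\<alpha> * (p' \<bullet> w) = gb z' \<bullet> w" for w
    using p by (metis inner_scaleR_left)+
  have contact: "H (Z + W) \<le> H Z + G Z \<bullet> W" for W using Z unfolding S_def by blast
  \<comment> \<open>Moving the first variable alone, the penalization costs exactly a paraboloid of
    opening \<open>\<alpha>\<close> besides linear terms, so \<open>Fa\<close> is touched from above
    as clause (3) requires and \<open>z + p\<close> is a genuine base point.\<close>
  have "Fa (z + w) \<le> Fa z + \<alpha> * (p \<bullet> w) + \<alpha> / 2 * (norm w)\<^sup>2" for w
    using contact[of "(w, 0)"] H_expand[of Z "(w, 0)"] unfolding pi by (simp add: zz)
  from Fa_contact[OF this] have za: "z + p \<in> C" "Fa z = a (z + p) - \<alpha> / 2 * (norm p)\<^sup>2" by auto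
  have "Fb (z' + w) \<le> Fb z' + \<alpha> * (p' \<bullet> w) + \<alpha> / 2 * (norm w)\<^sup>2" for w
    using contact[of "(0, w)"] H_expand[of Z "(0, w)"] unfolding pi by (simp add: zz)
  from Fb_contact[OF this] have zb: "z' + p' \<in> C" "Fb z' = b (z' + p') - \<alpha> / 2 * (norm p')\<^sup>2" by auto
  have expa: "\<bar>Fa (z + w) - Fa z - ga z \<bullet> w - (w \<bullet> L w) / 2\<bar> \<le> \<eta> * h\<^sup>2" if "norm w \<le> h" for w
    using second_order_expansion[OF Fa L(1) neara that] \<eta> by simp
  have expb: "\<bar>Fb (z' + w) - Fb z' - gb z' \<bullet> w - (w \<bullet> L' w) / 2\<bar> \<le> \<eta> * h\<^sup>2" if "norm w \<le> h" for w
    using second_order_expansion[OF Fb L(2) nearb that] \<eta> by simp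
  \<comment> \<open>The error bound is useful at the scale \<open>h\<close>; by homogeneity the
    estimate is read off at the multiple of \<open>w\<close> of norm \<open>h\<close>.\<close>
  have bound: "norm (\<Theta> w) \<le> (6 * \<alpha> + \<eta>) * norm w"
    if "linear \<Theta>" "(6 * \<alpha>)-lipschitz_on UNIV g" "\<And>w. norm w \<le> h \<Longrightarrow> norm (g (x + w) - g x - \<Theta> w) \<le> \<eta> * h"
    for \<Theta> g and x w :: 'a
  proof (cases "w = 0")
    case False
    define y where "y = (h / norm w) *\<^sub>R w"
    have y: "norm y = h" using False h by (simp add: y_def)
    have "norm (\<Theta> y) \<le> norm (g (x + y) - g x) + norm (g (x + y) - g x - \<Theta> y)"
      using norm_triangle_ineq4[of "g (x + y) - g x" "g (x + y) - g x - \<Theta> y"] by simp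
    also have "\<dots> \<le> 6 * \<alpha> * h + \<eta> * h"
      using lipschitz_onD[OF that(2), of "x + y" x] that(3)[of y] y by (simp add: dist_norm)
    finally have "h * norm (\<Theta> w) / norm w \<le> (6 * \<alpha> + \<eta>) * h"
      using h by (simp add: y_def linear_scale[OF that(1)] distrib_right)
    then have "h * norm (\<Theta> w) \<le> h * ((6 * \<alpha> + \<eta>) * norm w)"
      using False by (simp add: field_simps)
    then show ?thesis using h(1) by (rule mult_left_le_imp_le)
  qed (simp add: linear_0[OF that(1)])
  show ?thesis
  proof (rule that[of r r' p z z' p'])
    show "norm r \<le> \<eta>" "norm r' \<le> \<eta>"
      using Z fst_le[of "G Z"] snd_le[of "G Z"] by (auto simp: S_def GZ)
    show "\<alpha> *\<^sub>R p = r + \<alpha> *\<^sub>R (z - z')" "\<alpha> *\<^sub>R p' = r' - \<alpha> *\<^sub>R (z - z')"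
      unfolding p by (simp_all add: r_def r'_def)
    show "z + p \<in> C" "z' + p' \<in> C" by (fact za zb)+
    show "a c + b c' - \<alpha> / 2 * ((norm (x - c))\<^sup>2 + (norm (x' - c'))\<^sup>2 + (norm (x - x'))\<^sup>2) - r \<bullet> x - r' \<bullet> x'
       \<le> a (z + p) + b (z' + p') - \<alpha> / 2 * ((norm p)\<^sup>2 + (norm p')\<^sup>2 + (norm (z - z'))\<^sup>2) - r \<bullet> z - r' \<bullet> z'"
      if "c \<in> C" "c' \<in> C" for x x' c c'
    proof -
      have "H (x, x') \<le> H (z, z') + r \<bullet> (x - z) + r' \<bullet> (x' - z')"
        using contact[of "(x - z, x' - z')"] unfolding GZ by (simp add: zz)
      then show ?thesis using Fa_ge[OF that(1), of x] Fb_ge[OF that(2), of x'] za(2) zb(2)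
        unfolding H_def by (simp add: inner_diff_right distrib_left)
    qed
    show "0 < h" "h < \<eta>" "linear L" "linear L'" by (fact h L)+
    show "norm (L w) \<le> (6 * \<alpha> + \<eta>) * norm w" for w by (rule bound[OF L(1) lipa neara])
    show "norm (L' w) \<le> (6 * \<alpha> + \<eta>) * norm w" for w by (rule bound[OF L(2) lipb nearb])
    \<comment> \<open>Both vectors are scaled so that the longer one has norm \<open>h\<close>. The
      two expansions err by \<open>\<eta> * h\<^sup>2\<close> each, and the factor 1/2 at the
      quadratic forms doubles this to 4.\<close>
    show "w \<bullet> L w + w' \<bullet> L' w' \<le> \<alpha> * (norm (w - w'))\<^sup>2 + 4 * \<eta> * ((norm w)\<^sup>2 + (norm w')\<^sup>2)" for w w'
    proof -
      define s where "s = max (norm w) (norm w')"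
      show ?thesis
      proof (cases "s = 0")
        case True
        then have "norm w = 0" "norm w' = 0" unfolding s_def by (smt (verit) norm_ge_zero)+
        then show ?thesis by simp
      next
        case False
        then have s: "0 < s" unfolding s_def by (smt (verit) norm_ge_zero)
        define t where "t = h / s"
        have t: "0 < t" "t * s = h" using s h by (auto simp: t_def)
        have "t * norm w \<le> h" "t * norm w' \<le> h"
          unfolding t(2)[symmetric] using t(1) by (auto simp: s_def intro!: mult_left_mono)
        then have n: "norm (t *\<^sub>R w) \<le> h" "norm (t *\<^sub>R w') \<le> h" using t(1) by auto
        have "(t *\<^sub>R w) \<bullet> L (t *\<^sub>R w) + (t *\<^sub>R w') \<bullet> L' (t *\<^sub>R w')
            \<le> \<alpha> * (norm (t *\<^sub>R w - t *\<^sub>R w'))\<^sup>2 + 4 * \<eta> * h\<^sup>2"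
          using contact[of "(t *\<^sub>R w, t *\<^sub>R w')"] H_expand[of Z "(t *\<^sub>R w, t *\<^sub>R w')"] expa[OF n(1)] expb[OF n(2)]
          by (simp add: zz)
        moreover have "norm (t *\<^sub>R w - t *\<^sub>R w') = t * norm (w - w')"
          using t(1) by (simp flip: scaleR_diff_right)
        ultimately have "t\<^sup>2 * (w \<bullet> L w + w' \<bullet> L' w') \<le> t\<^sup>2 * (\<alpha> * (norm (w - w'))\<^sup>2 + 4 * \<eta> * s\<^sup>2)"
          unfolding t(2)[symmetric] using L
          by (simp add: linear_scale power_mult_distrib) (simp add: power2_eq_square algebra_simps)
        then have "w \<bullet> L w + w' \<bullet> L' w' \<le> \<alpha> * (norm (w - w'))\<^sup>2 + 4 * \<eta> * s\<^sup>2"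
          using t(1) by simp
        moreover have "4 * \<eta> * s\<^sup>2 \<le> 4 * \<eta> * ((norm w)\<^sup>2 + (norm w')\<^sup>2)"
          using \<eta> by (intro mult_left_mono) (auto simp: s_def max_def)
        ultimately show ?thesis by linarith
      qed
    qed
    \<comment> \<open>Moving a point and its base point by the same \<open>w\<close> leaves the cost
      of the sup-convolution unchanged, so the expansion of \<open>Fa\<close> at \<open>z\<close>
      bounds \<open>a\<close> near \<open>z + p\<close> from above.\<close>
    show "a (z + p + w) \<le> a (z + p) + \<alpha> * (p \<bullet> w) + (w \<bullet> L w) / 2 + \<eta> * h\<^sup>2"
      if "norm w \<le> h" "z + p + w \<in> C" for w
      using Fa_ge[OF that(2), of "z + w"] expa[OF that(1)] za(2) unfolding pi by simp
    show "b (z' + p' + w) \<le> b (z' + p') + \<alpha> * (p' \<bullet> w) + (w \<bullet> L' w) / 2 + \<eta> * h\<^sup>2"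
      if "norm w \<le> h" "z' + p' + w \<in> C" for w
      using Fb_ge[OF that(2), of "z' + w"] expb[OF that(1)] zb(2) unfolding pi by simp
  qed
qed

section \<open>Test functions of class \<open>C\<^sup>2\<close>\<close>

text \<open>\<open>grad\<close> and \<open>hess\<close> are given by description and by a Frechet
  derivative, which is awkward for calculations. Explicit candidates for gradient and Hessian
  compose under sums and products, and on an open set they are converted back to
  \<open>C2_on\<close>, \<open>grad\<close> and \<open>hess\<close>.\<close>

definition has_C2_witness :: "(real^'n) set \<Rightarrow> (real^'n \<Rightarrow> real) \<Rightarrow> (real^'n \<Rightarrow> real^'n) \<Rightarrow> (real^'n \<Rightarrow> real^'n^'n) \<Rightarrow> bool" where
  "has_C2_witness U f g A \<longleftrightarrow> (\<forall>x\<in>U. GDERIV f x :> g x) \<and>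
     (\<forall>x\<in>U. (g has_derivative (*v) (A x)) (at x)) \<and> continuous_on U A"

definition outer :: "real^'n \<Rightarrow> real^'n \<Rightarrow> real^'n^'n" where
  "outer a b = (\<chi> i j. a $ i * b $ j)"

lemma outer_mult_vec: "outer a b *v h = (b \<bullet> h) *\<^sub>R a"
  by (simp add: outer_def matrix_vector_mult_def vec_eq_iff inner_vec_def sum_distrib_left mult_ac)

lemma outer_zero [simp]: "outer 0 a = 0" "outer a 0 = 0"
  by (simp_all add: outer_def vec_eq_iff)

lemma has_C2_witnessD:
  assumes "has_C2_witness U f g A" "x \<in> U"
  shows "GDERIV f x :> g x" "(g has_derivative (*v) (A x)) (at x)" "continuous_on U A"
  using assms by (auto simp: has_C2_witness_def)

lemma has_C2_witness_continuous:
  assumes "has_C2_witness U f g A"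
  shows "continuous_on U f" "continuous_on U g" "continuous_on U A"
proof -
  have "isCont f x" "isCont g x" if "x \<in> U" for x
    using assms that unfolding has_C2_witness_def gderiv_def by (metis has_derivative_continuous)+
  then show "continuous_on U f" "continuous_on U g"
    by (auto intro: continuous_at_imp_continuous_on)
qed (use assms in \<open>simp add: has_C2_witness_def\<close>)

lemma has_C2_witness_const: "has_C2_witness U (\<lambda>x :: real^'n. c) (\<lambda>x. 0) (\<lambda>x. 0)"
proof -
  have "(*v) (0 :: real^'n^'n) = (\<lambda>h. 0)" by (simp add: fun_eq_iff)
  then show ?thesis by (simp add: has_C2_witness_def GDERIV_const)
qed

lemma has_C2_witness_add:
  assumes "has_C2_witness U f g A" "has_C2_witness U f' g' A'"
  shows "has_C2_witness U (\<lambda>x. f x + f' x) (\<lambda>x. g x + g' x) (\<lambda>x. A x + A' x)"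
  using assms unfolding has_C2_witness_def
  by (auto intro!: GDERIV_add continuous_intros derivative_eq_intros simp: matrix_vector_mult_add_rdistrib)

lemma has_C2_witness_mult:
  assumes "has_C2_witness U f g A" "has_C2_witness U f' g' A'"
  shows "has_C2_witness U (\<lambda>x. f x * f' x) (\<lambda>x. f x *\<^sub>R g' x + f' x *\<^sub>R g x)
     (\<lambda>x. f x *\<^sub>R A' x + f' x *\<^sub>R A x + outer (g x) (g' x) + outer (g' x) (g x))"
  unfolding has_C2_witness_def
proof (intro conjI ballI)
  fix x assume x: "x \<in> U"
  note w = has_C2_witnessD[OF assms(1) x] has_C2_witnessD[OF assms(2) x]
  show "GDERIV (\<lambda>x. f x * f' x) x :> f x *\<^sub>R g' x + f' x *\<^sub>R g x"
    by (rule GDERIV_mult[OF w(1) w(4)])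
  show "((\<lambda>x. f x *\<^sub>R g' x + f' x *\<^sub>R g x) has_derivative
      (*v) (f x *\<^sub>R A' x + f' x *\<^sub>R A x + outer (g x) (g' x) + outer (g' x) (g x))) (at x)"
    by (rule derivative_eq_intros w(2,5) w(1,4)[unfolded gderiv_def] refl)+
      (simp add: fun_eq_iff matrix_vector_mult_add_rdistrib outer_mult_vec scaleR_matrix_vector_assoc inner_commute)
next
  note w = has_C2_witness_continuous[OF assms(1)] has_C2_witness_continuous[OF assms(2)]
  show "continuous_on U (\<lambda>x. f x *\<^sub>R A' x + f' x *\<^sub>R A x + outer (g x) (g' x) + outer (g' x) (g x))"
    unfolding outer_def by (intro continuous_intros w continuous_on_vec_lambda continuous_on_component)
qed

lemma has_C2_witness_quadratic:
  assumes "transpose A = A"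
  shows "has_C2_witness U (\<lambda>y. c + q \<bullet> (y - z) + ((y - z) \<bullet> (A *v (y - z))) / 2)
    (\<lambda>y. q + A *v (y - z)) (\<lambda>y. A)"
  unfolding has_C2_witness_def gderiv_def
proof (intro conjI ballI)
  fix y
  have sym: "a \<bullet> (A *v b) = b \<bullet> (A *v a)" for a b
    by (metis assms dot_lmul_matrix inner_commute transpose_matrix_vector)
  have d: "((\<lambda>y. A *v (y - z)) has_derivative (*v) A) (at y)"
  proof -
    have "((\<lambda>y. y - z) has_derivative (\<lambda>h. h)) (at y)"
      by (auto intro!: derivative_eq_intros)
    from bounded_linear.has_derivative[OF matrix_vector_mul_bounded_linear[of A] this]
    show ?thesis by simp
  qed
  show "((\<lambda>y. q + A *v (y - z)) has_derivative (*v) A) (at y)"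
    by (rule derivative_eq_intros d refl)+ simp
  have "((\<lambda>y. c + q \<bullet> (y - z) + (y - z) \<bullet> (A *v (y - z)) / 2) has_derivative
      (\<lambda>h. q \<bullet> h + ((y - z) \<bullet> (A *v h) + h \<bullet> (A *v (y - z))) / 2)) (at y)"
    by (auto intro!: derivative_eq_intros d)
  moreover have "q \<bullet> h + ((y - z) \<bullet> (A *v h) + h \<bullet> (A *v (y - z))) / 2 = h \<bullet> (q + A *v (y - z))" for h
    using sym[of "y - z" h] by (simp add: inner_add_right inner_commute[of q])
  ultimately show "((\<lambda>y. c + q \<bullet> (y - z) + (y - z) \<bullet> (A *v (y - z)) / 2) has_derivative
      (\<lambda>h. h \<bullet> (q + A *v (y - z)))) (at y)"
    by simp
qed simp

lemma has_C2_witness_imp_C2_on: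
  assumes "open U" and w: "has_C2_witness U f g A"
  shows "C2_on U f" "\<And>x. x \<in> U \<Longrightarrow> grad f x = g x" "\<And>x. x \<in> U \<Longrightarrow> hess f x = A x"
proof -
  show grad: "grad f x = g x" if "x \<in> U" for x
    by (rule grad_eqI) (rule has_C2_witnessD(1)[OF w that])
  have der: "(grad f has_derivative (*v) (A x)) (at x)" if "x \<in> U" for x
    using has_C2_witnessD(2)[OF w that] \<open>open U\<close> that
    by (rule has_derivative_transform_within_open) (simp add: grad)
  show hess: "hess f x = A x" if "x \<in> U" for x
    unfolding hess_def frechet_derivative_at[OF der[OF that], symmetric] by (rule matrix_of_matrix_vector_mul)
  have "continuous_on U (hess f)"
    using has_C2_witness_continuous(3)[OF w] by (simp add: hess cong: continuous_on_cong)
  then show "C2_on U f" unfolding C2_on_def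
    using has_C2_witnessD(1)[OF w] der by (auto simp: gderiv_def differentiable_def)
qed

lemma C2_on_imp_has_C2_witness:
  assumes "C2_on U f"
  shows "has_C2_witness U f (grad f) (hess f)"
  unfolding has_C2_witness_def
proof (intro conjI ballI)
  fix x assume x: "x \<in> U"
  obtain f' where f': "(f has_derivative f') (at x)"
    using assms x by (auto simp: C2_on_def differentiable_def)
  then have "linear f'" by (rule has_derivative_linear)
  then have "f' = (\<lambda>h. h \<bullet> adjoint f' 1)" by (auto simp: adjoint_works)
  with f' have "GDERIV f x :> adjoint f' 1" by (simp add: gderiv_def)
  then show "GDERIV f x :> grad f x" using grad_eqI by metis
  have "(grad f has_derivative frechet_derivative (grad f) (at x)) (at x)"
    using assms x by (simp add: C2_on_def frechet_derivative_works)
  moreover from this have "(*v) (hess f x) = frechet_derivative (grad f) (at x)"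
    unfolding hess_def
    by (intro ext matrix_works) (simp add: scalar_mult_eq_scaleR[abs_def] has_derivative_linear flip: linear_def)
  ultimately show "(grad f has_derivative (*v) (hess f x)) (at x)" by simp
qed (use assms in \<open>simp add: C2_on_def\<close>)

text \<open>The quartic factor vanishes to third order at \<open>z\<close>, and \<open>1 + D\<^sup>2 + f\<^sup>2\<close> dominates \<open>D - f\<close>.\<close>

lemma viscosity_subsolution_local_test:
  assumes "open U" and sub: "viscosity_subsolution U F u"
    and D: "has_C2_witness U D gD AD" "\<And>y. y \<in> U \<Longrightarrow> u y \<le> D y"
    and f: "has_C2_witness U f g A" and z: "z \<in> U" "f z = u z"
    and "0 < r" and near: "\<And>y. y \<in> U \<Longrightarrow> dist y z < r \<Longrightarrow> u y \<le> f y"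
  shows "F z (u z) (g z) (A z) \<le> 0"
proof -
  \<comment> \<open>Written with zero constant and linear parts so that the witness for quadratic
    polynomials matches; the value is at least 1 outside the ball of radius
    \<open>r\<close>.\<close>
  define s where "s y = 0 + 0 \<bullet> (y - z) + ((y - z) \<bullet> (((2 / r\<^sup>2) *\<^sub>R mat 1) *v (y - z))) / 2" for y
  have s: "s y = (norm (y - z))\<^sup>2 / r\<^sup>2" for y
    unfolding s_def by (simp add: scaleR_matrix_vector_assoc[symmetric] power2_norm_eq_inner)
  obtain gs As where ws: "has_C2_witness U s gs As" and "gs z = 0"
  proof
    show "has_C2_witness U s (\<lambda>y. 0 + ((2 / r\<^sup>2) *\<^sub>R mat 1) *v (y - z)) (\<lambda>y. (2 / r\<^sup>2) *\<^sub>R mat 1)"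
      unfolding s_def by (rule has_C2_witness_quadratic) (simp add: transpose_def mat_def vec_eq_iff)
  qed simp
  note wss = has_C2_witness_mult[OF ws ws]
  note wW = has_C2_witness_add[OF has_C2_witness_const[of U 1]
    has_C2_witness_add[OF has_C2_witness_mult[OF D(1) D(1)] has_C2_witness_mult[OF f f]]]
  note w = has_C2_witness_add[OF f has_C2_witness_mult[OF wss wW]]
  \<comment> \<open>A test function has to majorize \<open>u\<close> on all of \<open>U\<close>.
    Near \<open>z\<close> this is done by \<open>f\<close>, elsewhere by the correction built from
    the global majorant \<open>D\<close>.\<close>
  define \<psi> where "\<psi> y = f y + s y * s y * (1 + (D y * D y + f y * f y))" for y
  have "s z = 0" by (simp add: s)
  have "u y \<le> \<psi> y" if y: "y \<in> U" for y
  proof (cases "dist y z < r")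
    case True
    then have "u y \<le> f y" using near y by blast
    moreover have "0 \<le> s y * s y * (1 + (D y * D y + f y * f y))" by simp
    ultimately show ?thesis unfolding \<psi>_def by linarith
  next
    case False
    then have "r\<^sup>2 \<le> (norm (y - z))\<^sup>2" using \<open>0 < r\<close> by (intro power_mono) (auto simp: dist_norm)
    then have "1 \<le> s y" using \<open>0 < r\<close> by (simp add: s)
    then have "1 \<le> s y * s y" by (metis mult_mono' mult.left_neutral zero_le_one)
    have "0 \<le> (D y - 1)\<^sup>2 + (D y)\<^sup>2 + (f y + 1)\<^sup>2 + (f y)\<^sup>2" by simp
    then have "D y - f y \<le> 1 + (D y * D y + f y * f y)" by (simp add: power2_eq_square algebra_simps)
    also have "\<dots> \<le> s y * s y * (1 + (D y * D y + f y * f y))"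
      using mult_right_mono[OF \<open>1 \<le> s y * s y\<close>, of "1 + (D y * D y + f y * f y)"] by simp
    finally show ?thesis using D(2)[OF y] unfolding \<psi>_def by linarith
  qed
  moreover have "\<psi> z = u z" by (simp add: \<psi>_def \<open>s z = 0\<close> z)
  moreover note C2 = has_C2_witness_imp_C2_on[OF \<open>open U\<close> w, folded \<psi>_def]
  ultimately have "F z (\<psi> z) (grad \<psi> z) (hess \<psi> z) \<le> 0"
    using sub z(1) unfolding viscosity_subsolution_def by blast
  then show ?thesis
    using \<open>\<psi> z = u z\<close> C2(2,3)[OF z(1)] by (simp add: \<open>s z = 0\<close> \<open>gs z = 0\<close>)
qed

lemma viscosity_supersolution_uminus:
  assumes "open U" and super: "viscosity_supersolution U F u"
    and odd: "\<And>z r p A. z \<in> U \<Longrightarrow> F z (- r) (- p) (- A) = - F z r p A"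
  shows "viscosity_subsolution U F (\<lambda>z. - u z)"
  unfolding viscosity_subsolution_def
proof (intro conjI ballI allI impI)
  have "\<forall>z\<in>U. \<forall>c. c < u z \<longrightarrow> (\<forall>\<^sub>F w in at z within U. c < u w)"
    using super by (simp add: viscosity_supersolution_def lsc_on_def)
  then show "usc_on U (\<lambda>z. - u z)"
    unfolding usc_on_def by (metis (no_types, lifting) eventually_mono minus_less_iff)
  fix z \<phi> assume z: "z \<in> U" and *: "C2_on U \<phi> \<and> (\<forall>y\<in>U. \<phi> y \<ge> - u y) \<and> \<phi> z = - u z"
  have w: "has_C2_witness U (\<lambda>y. (-1) * \<phi> y) (\<lambda>y. (-1) *\<^sub>R grad \<phi> y + \<phi> y *\<^sub>R 0)
     (\<lambda>y. (-1) *\<^sub>R hess \<phi> y + \<phi> y *\<^sub>R 0 + outer 0 (grad \<phi> y) + outer (grad \<phi> y) 0)"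
    using * by (intro has_C2_witness_mult has_C2_witness_const C2_on_imp_has_C2_witness) auto
  note C2 = has_C2_witness_imp_C2_on[OF \<open>open U\<close> w]
  have "F z (- 1 * \<phi> z) (grad (\<lambda>y. - 1 * \<phi> y) z) (hess (\<lambda>y. - 1 * \<phi> y) z) \<ge> 0"
    using super z * C2(1) unfolding viscosity_supersolution_def by force
  then show "F z (\<phi> z) (grad \<phi> z) (hess \<phi> z) \<le> 0"
    using odd[OF z] C2(2,3)[OF z] by simp
qed

section \<open>Sums of viscosity subsolutions of linear equations\<close>

text \<open>The paraboloids produced by the theorem on sums touch on small balls only, hence the
  radius \<open>r\<close>. Continuity is assumed separately where it is needed.\<close>

definition local_subsolution ::
    "(real^'n) set \<Rightarrow> (real^'n \<Rightarrow> real \<Rightarrow> real^'n \<Rightarrow> real^'n^'n \<Rightarrow> real) \<Rightarrow> (real^'n \<Rightarrow> real) \<Rightarrow> bool" where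
  "local_subsolution U F u \<longleftrightarrow> (\<forall>z\<in>U. \<forall>f g A r. has_C2_witness U f g A \<and> f z = u z \<and> 0 < r \<and>
     (\<forall>y\<in>U. dist y z < r \<longrightarrow> u y \<le> f y) \<longrightarrow> F z (u z) (g z) (A z) \<le> 0)"

lemma local_subsolutionD:
  assumes "local_subsolution U F u" "has_C2_witness U f g A" "z \<in> U" "f z = u z" "0 < r"
    "\<And>y. y \<in> U \<Longrightarrow> dist y z < r \<Longrightarrow> u y \<le> f y"
  shows "F z (u z) (g z) (A z) \<le> 0"
  using assms unfolding local_subsolution_def by blast

text \<open>A linear equation in non-divergence form on time-space: \<open>\<beta>\<close> will
  contain the time derivative, and the diffusion matrix is given by a square root, the vector fields
  \<open>\<tau> k\<close>. This factorization lets the matrix inequality of the theorem on sums act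
  together with Lipschitz coefficients.\<close>

definition linear_operator ::
    "(real^'n \<Rightarrow> real^'n) \<Rightarrow> (real^'n \<Rightarrow> real) \<Rightarrow> ('m::finite \<Rightarrow> real^'n \<Rightarrow> real^'n) \<Rightarrow>
     real^'n \<Rightarrow> real \<Rightarrow> real^'n \<Rightarrow> real^'n^'n \<Rightarrow> real" where
  "linear_operator \<beta> v \<tau> z r p A = \<beta> z \<bullet> p - v z * r - (\<Sum>k\<in>UNIV. \<tau> k z \<bullet> (A *v \<tau> k z))"

lemma linear_operator_add:
  "linear_operator \<beta> v \<tau> z (r + r') (p + p') (A + A')
     = linear_operator \<beta> v \<tau> z r p A + linear_operator \<beta> v \<tau> z r' p' A'"
  by (simp add: linear_operator_def inner_add_right matrix_vector_mult_add_rdistrib sum.distrib algebra_simps)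

text \<open>The additional paraboloid moves the maximum off the boundary: on the sphere of radius
  \<open>h\<close> it subtracts \<open>2 * \<eta> * h\<^sup>2\<close>, twice the permitted error, so
  the value there is below the one at the centre.\<close>

lemma near_paraboloid_touched:
  fixes f :: "'a::euclidean_space \<Rightarrow> real"
  assumes cont: "continuous_on (cball \<zeta> h) f" "continuous_on UNIV Q" and "0 < h" "0 < \<eta>" "Q 0 = 0"
    and le: "\<And>w. norm w \<le> h \<Longrightarrow> f (\<zeta> + w) \<le> f \<zeta> + Q w + \<eta> * h\<^sup>2"
  obtains w0 where "norm w0 < h"
    "\<And>w. norm w \<le> h \<Longrightarrow> f (\<zeta> + w) - Q w - 2 * \<eta> * (norm w)\<^sup>2 \<le> f (\<zeta> + w0) - Q w0 - 2 * \<eta> * (norm w0)\<^sup>2"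
proof -
  have "cball (0::'a) h \<noteq> {}" using \<open>0 < h\<close> by auto
  moreover have "continuous_on (cball 0 h) (\<lambda>w. f (\<zeta> + w) - Q w - 2 * \<eta> * (norm w)\<^sup>2)"
    by (intro continuous_intros continuous_on_compose2[OF cont(1)] continuous_on_subset[OF cont(2)])
      (auto simp: dist_norm)
  ultimately have "\<exists>w0\<in>cball 0 h. \<forall>w\<in>cball 0 h. f (\<zeta> + w) - Q w - 2 * \<eta> * (norm w)\<^sup>2
      \<le> f (\<zeta> + w0) - Q w0 - 2 * \<eta> * (norm w0)\<^sup>2"
    by (rule continuous_attains_sup[OF compact_cball])
  then obtain w0 where w0: "w0 \<in> cball 0 h"
    "\<And>w. w \<in> cball 0 h \<Longrightarrow> f (\<zeta> + w) - Q w - 2 * \<eta> * (norm w)\<^sup>2 \<le> f (\<zeta> + w0) - Q w0 - 2 * \<eta> * (norm w0)\<^sup>2"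
    by blast
  have "norm w0 \<noteq> h"
  proof
    assume "norm w0 = h"
    moreover from this have "f (\<zeta> + w0) \<le> f \<zeta> + Q w0 + \<eta> * h\<^sup>2" by (intro le) simp
    moreover have "0 < \<eta> * h\<^sup>2" using \<open>0 < \<eta>\<close> \<open>0 < h\<close> by simp
    ultimately show False using w0(2)[of 0] \<open>0 < h\<close> \<open>Q 0 = 0\<close> by simp
  qed
  with w0 show ?thesis by (intro that[of w0]) auto
qed

text \<open>An approximate paraboloid bound at \<open>\<zeta>\<close> is turned into the viscosity
  inequality at a nearby point \<open>y\<close>. There the paraboloid has gradient \<open>q\<close>
  plus its Hessian applied to a vector shorter than \<open>h\<close>; this causes the error on the
  right, with \<open>4 * \<eta>\<close> coming from the added paraboloid.\<close>

lemma local_subsolution_near_paraboloid: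
  fixes \<beta> :: "real^'n \<Rightarrow> real^'n" and \<tau> :: "'m::finite \<Rightarrow> real^'n \<Rightarrow> real^'n"
  assumes sub: "local_subsolution U (linear_operator \<beta> v \<tau>) (\<lambda>y. \<Psi> y + a y)"
    and w: "has_C2_witness U \<Psi> g\<Psi> A\<Psi>" and U: "cball \<zeta> h \<subseteq> U" and a: "continuous_on (cball \<zeta> h) a"
    and L: "linear L" "\<And>w. norm (L w) \<le> K * norm w" and pos: "0 < h" "0 < \<eta>" "0 \<le> K"
    and le: "\<And>w. norm w \<le> h \<Longrightarrow> a (\<zeta> + w) \<le> a \<zeta> + q \<bullet> w + (w \<bullet> L w) / 2 + \<eta> * h\<^sup>2"
  obtains y where "dist y \<zeta> < h"
    "linear_operator \<beta> v \<tau> y (\<Psi> y) (g\<Psi> y) (A\<Psi> y) + \<beta> y \<bullet> q - v y * a y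
      - (\<Sum>k\<in>UNIV. \<tau> k y \<bullet> L (\<tau> k y) + 4 * \<eta> * (norm (\<tau> k y))\<^sup>2) \<le> (K + 4 * \<eta>) * h * norm (\<beta> y)"
proof -
  have contL: "continuous_on UNIV L"
    using L(1) by (simp add: linear_continuous_on linear_conv_bounded_linear)
  have contQ: "continuous_on UNIV (\<lambda>w. q \<bullet> w + (w \<bullet> L w) / 2)"
    by (intro continuous_intros contL) simp
  have leQ: "a (\<zeta> + w) \<le> a \<zeta> + (q \<bullet> w + (w \<bullet> L w) / 2) + \<eta> * h\<^sup>2" if "norm w \<le> h" for w
    using le[OF that] by simp
  obtain w0 where w0: "norm w0 < h" and touch: "\<And>w. norm w \<le> h \<Longrightarrow>
      a (\<zeta> + w) - (q \<bullet> w + (w \<bullet> L w) / 2) - 2 * \<eta> * (norm w)\<^sup>2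
      \<le> a (\<zeta> + w0) - (q \<bullet> w0 + (w0 \<bullet> L w0) / 2) - 2 * \<eta> * (norm w0)\<^sup>2"
  proof (rule near_paraboloid_touched[OF a contQ pos(1,2) _ leQ], goal_cases)
    case prems: 3
    show ?case by (rule that) (fact prems)+
  qed simp_all
  define M where "M = matrix L"
  have M: "M *v x = L x" for x
    unfolding M_def using L(1) by (simp add: matrix_works linear_def scalar_mult_eq_scaleR[abs_def])
  \<comment> \<open>\<open>L\<close> need not be symmetric, but a Hessian is; the symmetric part has
    the same quadratic form. The multiple of the identity is the Hessian of
    \<open>2 * \<eta> * (norm w)\<^sup>2\<close>.\<close>
  define A where "A = (1 / 2) *\<^sub>R (M + transpose M) + (4 * \<eta>) *\<^sub>R mat 1"
  have bilin: "x \<bullet> (A *v y) = (x \<bullet> L y + L x \<bullet> y) / 2 + 4 * \<eta> * (x \<bullet> y)" for x y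
  proof -
    have "x \<bullet> (transpose M *v y) = L x \<bullet> y"
      unfolding M[symmetric] dot_lmul_matrix[symmetric] by (simp flip: transpose_matrix_vector)
    then show ?thesis unfolding A_def
      by (simp add: matrix_vector_mult_add_rdistrib scaleR_matrix_vector_assoc[symmetric] M inner_add_right)
  qed
  have quad: "x \<bullet> (A *v x) = x \<bullet> L x + 4 * \<eta> * (norm x)\<^sup>2" for x
    unfolding bilin power2_norm_eq_inner by (simp add: inner_commute)
  have "transpose A = A"
    by (simp add: A_def transpose_def mat_def vec_eq_iff)
  define y0 where "y0 = \<zeta> + w0"
  define c where "c = a y0 - q \<bullet> w0 - (w0 \<bullet> (A *v w0)) / 2"
  note wit = has_C2_witness_add[OF w has_C2_witness_quadratic[OF \<open>transpose A = A\<close>, of U c q \<zeta>]]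
  have "linear_operator \<beta> v \<tau> y0 (\<Psi> y0 + a y0) (g\<Psi> y0 + (q + A *v (y0 - \<zeta>))) (A\<Psi> y0 + A) \<le> 0"
  proof (rule local_subsolutionD[OF sub wit])
    show "y0 \<in> U" using U w0 unfolding y0_def by (auto simp: subset_iff dist_norm)
    show "\<Psi> y0 + (c + q \<bullet> (y0 - \<zeta>) + (y0 - \<zeta>) \<bullet> (A *v (y0 - \<zeta>)) / 2) = \<Psi> y0 + a y0"
      unfolding c_def y0_def by simp
    show "0 < h - norm w0" using w0 by simp
    fix y assume "dist y y0 < h - norm w0"
    moreover have "norm (y - \<zeta>) \<le> norm (y - y0) + norm w0"
      using norm_triangle_ineq[of "y - y0" w0] by (simp add: y0_def)
    ultimately have "norm (y - \<zeta>) \<le> h" by (simp add: dist_norm)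
    from touch[OF this] show "\<Psi> y + a y \<le> \<Psi> y + (c + q \<bullet> (y - \<zeta>) + (y - \<zeta>) \<bullet> (A *v (y - \<zeta>)) / 2)"
      unfolding c_def quad by (simp add: y0_def add_divide_distrib diff_divide_distrib)
  qed
  then have F: "linear_operator \<beta> v \<tau> y0 (\<Psi> y0) (g\<Psi> y0) (A\<Psi> y0) + \<beta> y0 \<bullet> q + \<beta> y0 \<bullet> (A *v w0) - v y0 * a y0
      - (\<Sum>k\<in>UNIV. \<tau> k y0 \<bullet> L (\<tau> k y0) + 4 * \<eta> * (norm (\<tau> k y0))\<^sup>2) \<le> 0"
    unfolding linear_operator_add unfolding linear_operator_def[of _ _ _ _ "a y0"] quad
    by (simp add: y0_def inner_add_right)
  define P where "P = norm w0 * norm (\<beta> y0)"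
  have "\<bar>\<beta> y0 \<bullet> L w0\<bar> \<le> norm (\<beta> y0) * (K * norm w0)"
    by (rule order_trans[OF Cauchy_Schwarz_ineq2]) (simp add: L mult_left_mono)
  also have "\<dots> = K * P" by (simp add: P_def)
  finally have 1: "\<bar>\<beta> y0 \<bullet> L w0\<bar> \<le> K * P" .
  have "\<bar>L (\<beta> y0) \<bullet> w0\<bar> \<le> (K * norm (\<beta> y0)) * norm w0"
    by (rule order_trans[OF Cauchy_Schwarz_ineq2]) (simp add: L mult_right_mono)
  also have "\<dots> = K * P" by (simp add: P_def)
  finally have 2: "\<bar>L (\<beta> y0) \<bullet> w0\<bar> \<le> K * P" .
  have "4 * \<eta> * \<bar>\<beta> y0 \<bullet> w0\<bar> \<le> 4 * \<eta> * (norm (\<beta> y0) * norm w0)"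
    using pos by (intro mult_left_mono Cauchy_Schwarz_ineq2) auto
  then have 3: "\<bar>4 * \<eta> * (\<beta> y0 \<bullet> w0)\<bar> \<le> 4 * \<eta> * P"
    using pos by (simp add: abs_mult P_def mult.commute)
  have "(K + 4 * \<eta>) * norm w0 * norm (\<beta> y0) = K * P + 4 * \<eta> * P"
    by (simp add: P_def distrib_right)
  moreover have "\<bar>(x + y) / 2 + z\<bar> \<le> k + l" if "\<bar>x\<bar> \<le> k" "\<bar>y\<bar> \<le> k" "\<bar>z\<bar> \<le> l" for x y z k l :: real
    using that by (auto simp: abs_le_iff field_simps)
  ultimately have "\<bar>\<beta> y0 \<bullet> (A *v w0)\<bar> \<le> (K + 4 * \<eta>) * norm w0 * norm (\<beta> y0)"
    using 1 2 3 unfolding bilin by metis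
  also have "\<dots> \<le> (K + 4 * \<eta>) * h * norm (\<beta> y0)"
    using w0 pos by (intro mult_right_mono mult_left_mono) auto
  finally have "- (\<beta> y0 \<bullet> (A *v w0)) \<le> (K + 4 * \<eta>) * h * norm (\<beta> y0)" by linarith
  then show ?thesis using F w0 by (intro that[of y0]) (auto simp: y0_def dist_norm)
qed

section \<open>Doubling of variables\<close>

lemma locally_lipschitz_on_finite_family:
  fixes f :: "'k::finite \<Rightarrow> 'a::metric_space \<Rightarrow> 'b::metric_space"
  assumes "open U" "z \<in> U" and lip: "\<And>k. locally_lipschitz_on U (f k)"
  obtains R \<Lambda> where "0 < R" "cball z R \<subseteq> U" "\<And>k. \<Lambda>-lipschitz_on (cball z R) (f k)"
proof -
  have "\<forall>k. \<exists>e L. 0 < e \<and> L-lipschitz_on (ball z e \<inter> U) (f k)"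
    using lip \<open>z \<in> U\<close> by (auto simp: locally_lipschitz_on_def)
  then obtain e L where e: "\<And>k. 0 < e k" and L: "\<And>k. (L k)-lipschitz_on (ball z (e k) \<inter> U) (f k)"
    by metis
  obtain r where r: "0 < r" "cball z r \<subseteq> U" using assms(1,2) open_contains_cball by blast
  define R where "R = min r (Min (range e) / 2)"
  have "0 < Min (range e)" using e by simp
  then have R: "0 < R" using r by (simp add: R_def)
  have Re: "R < e k" for k
  proof -
    have "Min (range e) \<le> e k" by simp
    then show ?thesis using \<open>0 < Min (range e)\<close> unfolding R_def by linarith
  qed
  show ?thesis
  proof (rule that[of R "Max (range L)"])
    show "cball z R \<subseteq> U" using r by (auto simp: R_def)
    then have "cball z R \<subseteq> ball z (e k) \<inter> U" for k using Re[of k] by auto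
    then show "(Max (range L))-lipschitz_on (cball z R) (f k)" for k
      by (intro lipschitz_on_mono[OF L]) auto
  qed (fact R)
qed

text \<open>Adding this function to a test function makes the touching at \<open>z\<close> strict
  without changing the second-order data there.\<close>

lemma quartic_has_C2_witness:
  fixes z :: "real^'n"
  obtains g A where "has_C2_witness U (\<lambda>y. ((norm (y - z))\<^sup>2)\<^sup>2) g A" "g z = 0" "A z = 0"
proof -
  define s where "s y = 0 + 0 \<bullet> (y - z) + ((y - z) \<bullet> ((2 *\<^sub>R mat 1) *v (y - z))) / 2" for y
  have s: "s y = (norm (y - z))\<^sup>2" for y
    unfolding s_def by (simp add: scaleR_matrix_vector_assoc[symmetric] power2_norm_eq_inner)
  have "has_C2_witness U s (\<lambda>y. 0 + (2 *\<^sub>R mat 1) *v (y - z)) (\<lambda>y. 2 *\<^sub>R mat 1)"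
    unfolding s_def by (rule has_C2_witness_quadratic) (simp add: transpose_def mat_def vec_eq_iff)
  note w = has_C2_witness_mult[OF this this]
  have "(\<lambda>y. s y * s y) = (\<lambda>y. ((norm (y - z))\<^sup>2)\<^sup>2)"
    unfolding s by (intro ext) (rule power2_eq_square[symmetric])
  from w[unfolded this] show ?thesis by (rule that) (simp_all add: s)
qed

text \<open>Doubling of variables: \<open>N \<rightarrow> \<infinity>\<close> is the penalization and \<open>\<eta> = 1 / N\<^sup>2\<close> the precision in the
  theorem on sums.\<close>

theorem linear_operator_sum_of_subsolutions:
  fixes \<beta> :: "real^'n \<Rightarrow> real^'n" and \<tau> :: "'m::finite \<Rightarrow> real^'n \<Rightarrow> real^'n"
  assumes "open U" and zh: "zh \<in> U" and contv: "continuous_on U v"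
    and lip: "locally_lipschitz_on U \<beta>" "\<And>k. locally_lipschitz_on U (\<tau> k)"
    and sub1: "local_subsolution U (linear_operator \<beta> v \<tau>) u1" and cont1: "continuous_on U u1"
    and sub2: "local_subsolution U (linear_operator \<beta> v \<tau>) u2" and cont2: "continuous_on U u2"
    and w: "has_C2_witness U \<Psi> g\<Psi> A\<Psi>"
    and touch: "u1 zh + u2 zh = \<Psi> zh" "\<And>y. y \<in> U \<Longrightarrow> u1 y + u2 y \<le> \<Psi> y"
  shows "linear_operator \<beta> v \<tau> zh (\<Psi> zh) (g\<Psi> zh) (A\<Psi> zh) \<le> 0"
proof -
  let ?F = "linear_operator \<beta> v \<tau>"
  \<comment> \<open>Drift and noise fields form one finite family, so that a single ball and a
    single Lipschitz constant serve them all.\<close>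
  define \<gamma> where "\<gamma> k = (case k of None \<Rightarrow> \<beta> | Some k \<Rightarrow> \<tau> k)" for k
  have "locally_lipschitz_on U (\<gamma> k)" for k
    using lip by (auto simp: \<gamma>_def split: option.split)
  then obtain R \<Lambda> where R: "0 < R" "cball zh R \<subseteq> U" and \<gamma>lip: "\<And>k. \<Lambda>-lipschitz_on (cball zh R) (\<gamma> k)"
    using locally_lipschitz_on_finite_family[OF \<open>open U\<close> zh, of \<gamma>] by blast
  define C where "C = cball zh R"
  have C: "compact C" "C \<noteq> {}" "zh \<in> C" "C \<subseteq> U" using R by (auto simp: C_def)
  have \<beta>lip: "\<Lambda>-lipschitz_on C \<beta>" and \<tau>lip: "\<And>k. \<Lambda>-lipschitz_on C (\<tau> k)"
    using \<gamma>lip[of None] \<gamma>lip[of "Some _"] by (auto simp: \<gamma>_def C_def)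
  have \<Lambda>: "0 \<le> \<Lambda>" using \<beta>lip by (rule lipschitz_on_nonneg)
  define B where "B = (\<Sum>k\<in>UNIV. norm (\<gamma> k zh)) + \<Lambda> * R"
  have \<gamma>B: "norm (\<gamma> k y) \<le> B" if "y \<in> C" for k y
  proof -
    have "norm (\<gamma> k zh) \<le> (\<Sum>k\<in>UNIV. norm (\<gamma> k zh))" by (rule member_le_sum) auto
    moreover have "dist (\<gamma> k y) (\<gamma> k zh) \<le> \<Lambda> * dist y zh"
      using lipschitz_onD[OF \<gamma>lip] that R(1) by (simp add: C_def)
    moreover have "\<Lambda> * dist y zh \<le> \<Lambda> * R"
      using that \<Lambda> by (intro mult_left_mono) (auto simp: C_def dist_commute)
    ultimately show ?thesis
      using norm_triangle_ineq2[of "\<gamma> k y" "\<gamma> k zh"] by (simp add: B_def dist_norm)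
  qed
  then have \<beta>B: "norm (\<beta> y) \<le> B" and \<tau>B: "norm (\<tau> k y) \<le> B" if "y \<in> C" for k y
    using that \<gamma>B[of y None] \<gamma>B[of y "Some k"] by (auto simp: \<gamma>_def)
  have B: "0 \<le> B" using \<beta>B[OF C(3)] norm_ge_zero order_trans by blast
  obtain gq Aq where q: "has_C2_witness U (\<lambda>y. ((norm (y - zh))\<^sup>2)\<^sup>2) gq Aq" "gq zh = 0" "Aq zh = 0"
    by (rule quartic_has_C2_witness)
  define \<Phi> where "\<Phi> y = \<Psi> y + ((norm (y - zh))\<^sup>2)\<^sup>2" for y
  define g where "g y = g\<Psi> y + gq y" for y
  define A where "A y = A\<Psi> y + Aq y" for y
  have wit: "has_C2_witness U \<Phi> g A"
    unfolding \<Phi>_def g_def A_def by (rule has_C2_witness_add[OF w q(1)])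
  \<comment> \<open>By linearity the equation for \<open>u1\<close> reads as one for
    \<open>a\<close> with the continuous function \<open>E\<close> as additional term. The sum
    \<open>a + b\<close> vanishes at \<open>zh\<close> and is at most minus the quartic on
    \<open>C\<close>.\<close>
  define a where "a y = u1 y - \<Phi> y" for y
  define b where "b = u2"
  have sub_a: "local_subsolution U ?F (\<lambda>y. \<Phi> y + a y)" using sub1 by (simp add: a_def)
  have sub_b: "local_subsolution U ?F (\<lambda>y. 0 + b y)" using sub2 by (simp add: b_def)
  have conta: "continuous_on U a"
    unfolding a_def by (intro continuous_intros cont1 has_C2_witness_continuous[OF wit])
  have contb: "continuous_on U b" using cont2 by (simp add: b_def)
  define E where "E y = ?F y (\<Phi> y) (g y) (A y)" for y
  have contE: "continuous_on U E"
  proof -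
    have ll: "continuous_on U f" if "locally_lipschitz_on U f" for f :: "real^'n \<Rightarrow> real^'n"
    proof (rule continuous_at_imp_continuous_on, rule ballI)
      fix y assume y: "y \<in> U"
      then obtain e L where e: "0 < e" "L-lipschitz_on (ball y e \<inter> U) f"
        using \<open>locally_lipschitz_on U f\<close> by (auto simp: locally_lipschitz_on_def)
      then have "continuous_on (ball y e \<inter> U) f" using lipschitz_on_continuous_on by blast
      then show "isCont f y"
        using y e \<open>open U\<close> by (simp add: continuous_on_eq_continuous_at open_Int)
    qed
    have "E = (\<lambda>y. \<beta> y \<bullet> g y - v y * \<Phi> y - (\<Sum>k\<in>UNIV. \<Sum>i\<in>UNIV. \<tau> k y $ i * (\<Sum>j\<in>UNIV. A y $ i $ j * \<tau> k y $ j)))"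
      unfolding E_def linear_operator_def by (simp add: inner_vec_def matrix_vector_mult_def)
    then show ?thesis
      by (simp only:) (intro continuous_intros continuous_on_component ll[OF lip(1)] ll[OF lip(2)] contv
        has_C2_witness_continuous[OF wit])
  qed
  have ab0: "a zh + b zh = 0" using touch(1) by (simp add: a_def b_def \<Phi>_def)
  have ab_le: "a y + b y \<le> - ((norm (y - zh))\<^sup>2)\<^sup>2" if "y \<in> C" for y
    using touch(2)[of y] that C(4) by (auto simp: a_def b_def \<Phi>_def)
  define m where "m = real CARD('m)"
  \<comment> \<open>One round of doubling with penalization \<open>N\<close>. Here \<open>t\<close>
    is the square root of the sum of the three penalized squares at the contact point. The location
    estimates hold always, the viscosity inequality only when both base points keep the distance
    \<open>i\<^sup>2\<close> from the boundary of \<open>C\<close>, so that the balls of radius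
    \<open>h\<close> fit in.\<close>
  have step: "\<exists>\<zeta> \<zeta>' t y y'. \<zeta> \<in> C \<and> \<zeta>' \<in> C \<and> 0 \<le> t \<and> norm (\<zeta> - \<zeta>') \<le> 3 * t + 2 * i\<^sup>2 \<and>
      (N / 2 - 2 * i\<^sup>2) * t\<^sup>2 \<le> a \<zeta> + b \<zeta>' + 2 * i\<^sup>2 * (R + 1) \<and>
      (norm (\<zeta> - zh) + i\<^sup>2 \<le> R \<longrightarrow> norm (\<zeta>' - zh) + i\<^sup>2 \<le> R \<longrightarrow>
        norm (y - \<zeta>) \<le> i\<^sup>2 \<and> norm (y' - \<zeta>') \<le> i\<^sup>2 \<and>
        E y - v y * a y - v y' * b y' \<le> \<Lambda> * (3 * (N * t\<^sup>2) + 4 * i * t) + 2 * B * i\<^sup>2 + 2 * B * (6 * i + 5 * (i\<^sup>2)\<^sup>2)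
          + m * (\<Lambda>\<^sup>2 * (9 * (N * t\<^sup>2) + 24 * i * t + 16 * i * i\<^sup>2) + 16 * i\<^sup>2 * B\<^sup>2))"
    if N: "1 \<le> N" and i: "i = 1 / N" for N i
  proof -
    define \<eta> where "\<eta> = i\<^sup>2"
    have "0 < N" using N by simp
    have i01: "0 < i" "i \<le> 1" "N * i = 1" using N i by auto
    have "N * \<eta> = (N * i) * i" by (simp add: \<eta>_def power2_eq_square)
    then have \<eta>: "0 < \<eta>" "\<eta> \<le> 1" "N * \<eta> = i"
      unfolding i01(3) using i01(1,2) by (auto simp: \<eta>_def power_le_one)
    obtain r r' p z z' p' h L L' where
      r: "norm r \<le> \<eta>" "norm r' \<le> \<eta>" and
      p: "N *\<^sub>R p = r + N *\<^sub>R (z - z')" "N *\<^sub>R p' = r' - N *\<^sub>R (z - z')" and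
      inC: "z + p \<in> C" "z' + p' \<in> C" and
      max: "\<And>x x' c c'. c \<in> C \<Longrightarrow> c' \<in> C \<Longrightarrow>
       a c + b c' - N / 2 * ((norm (x - c))\<^sup>2 + (norm (x' - c'))\<^sup>2 + (norm (x - x'))\<^sup>2) - r \<bullet> x - r' \<bullet> x'
       \<le> a (z + p) + b (z' + p') - N / 2 * ((norm p)\<^sup>2 + (norm p')\<^sup>2 + (norm (z - z'))\<^sup>2) - r \<bullet> z - r' \<bullet> z'" and
      h: "0 < h" "h < \<eta>" and L: "linear L" "linear L'"
      "\<And>w. norm (L w) \<le> (6 * N + \<eta>) * norm w" "\<And>w. norm (L' w) \<le> (6 * N + \<eta>) * norm w" and
      LL: "\<And>w w'. w \<bullet> L w + w' \<bullet> L' w' \<le> N * (norm (w - w'))\<^sup>2 + 4 * \<eta> * ((norm w)\<^sup>2 + (norm w')\<^sup>2)" and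
      expa: "\<And>w. norm w \<le> h \<Longrightarrow> z + p + w \<in> C \<Longrightarrow>
       a (z + p + w) \<le> a (z + p) + N * (p \<bullet> w) + (w \<bullet> L w) / 2 + \<eta> * h\<^sup>2" and
      expb: "\<And>w. norm w \<le> h \<Longrightarrow> z' + p' + w \<in> C \<Longrightarrow>
       b (z' + p' + w) \<le> b (z' + p') + N * (p' \<bullet> w) + (w \<bullet> L' w) / 2 + \<eta> * h\<^sup>2"
    proof (rule theorem_on_sums[OF C(1,2) continuous_on_subset[OF conta C(4)]
          continuous_on_subset[OF contb C(4)] \<open>0 < N\<close> \<eta>(1)], goal_cases)
      case prems: 1
      show ?case by (rule that) (fact prems)+
    qed
    define \<zeta> where "\<zeta> = z + p"
    define \<zeta>' where "\<zeta>' = z' + p'"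
    define s where "s = (norm p)\<^sup>2 + (norm p')\<^sup>2 + (norm (z - z'))\<^sup>2"
    define t where "t = sqrt s"
    have s: "0 \<le> s" by (simp add: s_def)
    have t: "0 \<le> t" "t\<^sup>2 = s" using s by (auto simp: t_def)
    have dt: "norm (z - z') \<le> t"
      by (rule power2_le_imp_le) (auto simp: t s_def)
    \<comment> \<open>Up to the tilts, \<open>p = z - z'\<close> and \<open>p' = z' - z\<close>, so
      the base points are three times as far apart as the contact points.\<close>
    have dist_\<zeta>: "norm (\<zeta> - \<zeta>') \<le> 3 * t + 2 * \<eta>"
    proof -
      have "N *\<^sub>R (\<zeta> - \<zeta>') = (3 * N) *\<^sub>R (z - z') + r - r'"
      proof -
        have "N *\<^sub>R (\<zeta> - \<zeta>') = N *\<^sub>R (z - z') + N *\<^sub>R p - N *\<^sub>R p'"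
          unfolding \<zeta>_def \<zeta>'_def by (simp add: algebra_simps)
        also have "\<dots> = N *\<^sub>R (z - z') + (N *\<^sub>R (z - z') + N *\<^sub>R (z - z')) + r - r'" unfolding p by simp
        also have "N *\<^sub>R (z - z') + (N *\<^sub>R (z - z') + N *\<^sub>R (z - z')) = (3 * N) *\<^sub>R (z - z')"
          unfolding scaleR_add_left[symmetric] by simp
        finally show ?thesis .
      qed
      moreover have "N * norm (\<zeta> - \<zeta>') = norm (N *\<^sub>R (\<zeta> - \<zeta>'))" using N by simp
      ultimately have "N * norm (\<zeta> - \<zeta>') = norm ((3 * N) *\<^sub>R (z - z') + r - r')" by simp
      also have "\<dots> \<le> norm ((3 * N) *\<^sub>R (z - z')) + norm r + norm r'"
        using norm_triangle_ineq4[of "(3 * N) *\<^sub>R (z - z') + r" r'] norm_triangle_ineq[of "(3 * N) *\<^sub>R (z - z')" r]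
        by linarith
      also have "\<dots> \<le> N * (3 * t + 2 * \<eta>)"
      proof -
        have "norm ((3 * N) *\<^sub>R (z - z')) = 3 * N * norm (z - z')" using N by simp
        moreover have "3 * N * norm (z - z') \<le> 3 * N * t" using dt N by (intro mult_left_mono) auto
        moreover have "1 * (2 * \<eta>) \<le> N * (2 * \<eta>)" using N \<eta>(1) by (intro mult_right_mono) auto
        moreover have "N * (3 * t + 2 * \<eta>) = 3 * N * t + N * (2 * \<eta>)" by (simp add: distrib_left)
        ultimately show ?thesis using r by linarith
      qed
      finally show ?thesis using \<open>0 < N\<close> by (rule mult_left_le_imp_le)
    qed
    \<comment> \<open>The contact point is compared with \<open>zh\<close> taken for all four
      arguments, where the penalization and \<open>a + b\<close> vanish. The tilts cost at most
      \<open>\<eta>\<close> times a distance, and the distances are at most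
      \<open>R + 1 + s\<close>.\<close>
    have pen: "(N / 2 - 2 * \<eta>) * t\<^sup>2 \<le> a \<zeta> + b \<zeta>' + 2 * \<eta> * (R + 1)"
    proof -
      have near: "norm (zh - x) \<le> R + 1 + s" if "x + y \<in> C" "(norm y)\<^sup>2 \<le> s" for x y
      proof -
        have "norm (zh - x) \<le> norm (zh - (x + y)) + norm y"
          using norm_triangle_ineq[of "zh - (x + y)" y] by simp
        moreover have "norm (zh - (x + y)) \<le> R" using that(1) by (simp add: C_def dist_norm)
        moreover have "0 \<le> (norm y - 1)\<^sup>2" by simp
        then have "2 * norm y \<le> 1 + (norm y)\<^sup>2" by (simp add: power2_eq_square algebra_simps)
        then have "norm y \<le> 1 + (norm y)\<^sup>2" using norm_ge_zero[of y] by linarith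
        ultimately show ?thesis using that(2) by linarith
      qed
      have "norm (zh - z) \<le> R + 1 + s" using near[OF inC(1)] by (simp add: s_def)
      moreover have "norm (zh - z') \<le> R + 1 + s" using near[OF inC(2)] by (simp add: s_def)
      moreover have "r \<bullet> x \<le> \<eta> * y" if "norm r \<le> \<eta>" "norm x \<le> y" for r x :: "real^'n" and y
        using Cauchy_Schwarz_ineq2[of r x] mult_mono[OF that] \<eta>(1) by simp
      ultimately have "r \<bullet> (zh - z) \<le> \<eta> * (R + 1 + s)" "r' \<bullet> (zh - z') \<le> \<eta> * (R + 1 + s)"
        using r by blast+
      moreover have "- r \<bullet> zh - r' \<bullet> zh \<le> a \<zeta> + b \<zeta>' - N / 2 * s - r \<bullet> z - r' \<bullet> z'"
        using max[OF C(3) C(3), of zh zh] ab0 by (simp add: \<zeta>_def \<zeta>'_def s_def)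
      ultimately have "N / 2 * s \<le> a \<zeta> + b \<zeta>' + 2 * (\<eta> * (R + 1 + s))"
        by (simp add: inner_diff_right)
      then show ?thesis unfolding t(2) by (simp add: algebra_simps)
    qed
    show ?thesis
    proof (cases "norm (\<zeta> - zh) + \<eta> \<le> R \<and> norm (\<zeta>' - zh) + \<eta> \<le> R")
      case False
      then show ?thesis
        using inC dist_\<zeta> pen t(1) unfolding \<eta>_def \<zeta>_def[symmetric] \<zeta>'_def[symmetric] by blast
    next
      case True
      have ballC: "cball \<zeta> h \<subseteq> C" "cball \<zeta>' h \<subseteq> C"
      proof -
        have "dist zh x \<le> R" if "norm (c - zh) + \<eta> \<le> R" "dist c x \<le> h" for c x
          using that h dist_triangle[of zh x c] by (simp add: dist_norm norm_minus_commute)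
        then show "cball \<zeta> h \<subseteq> C" "cball \<zeta>' h \<subseteq> C" using True unfolding C_def by auto
      qed
      have memC: "\<zeta> + w \<in> C" "\<zeta>' + w \<in> C" if "norm w \<le> h" for w
        using ballC that by (auto simp: subset_iff dist_norm)
      obtain y where y: "dist y \<zeta> < h" and Fy: "E y + \<beta> y \<bullet> (N *\<^sub>R p) - v y * a y
        - (\<Sum>k\<in>UNIV. \<tau> k y \<bullet> L (\<tau> k y) + 4 * \<eta> * (norm (\<tau> k y))\<^sup>2) \<le> (6 * N + \<eta> + 4 * \<eta>) * h * norm (\<beta> y)"
        unfolding E_def
      proof (rule local_subsolution_near_paraboloid[OF sub_a wit _ _ L(1,3) h(1) \<eta>(1)])
        show "cball \<zeta> h \<subseteq> U" "continuous_on (cball \<zeta> h) a"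
          using ballC C(4) continuous_on_subset[OF conta] by blast+
        show "a (\<zeta> + w) \<le> a \<zeta> + (N *\<^sub>R p) \<bullet> w + w \<bullet> L w / 2 + \<eta> * h\<^sup>2" if "norm w \<le> h" for w
          using expa[of w] memC[of w] that by (simp add: \<zeta>_def)
      qed (use N \<eta>(1) in auto)
      obtain y' where y': "dist y' \<zeta>' < h" and Fy': "?F y' 0 0 0 + \<beta> y' \<bullet> (N *\<^sub>R p') - v y' * b y'
        - (\<Sum>k\<in>UNIV. \<tau> k y' \<bullet> L' (\<tau> k y') + 4 * \<eta> * (norm (\<tau> k y'))\<^sup>2) \<le> (6 * N + \<eta> + 4 * \<eta>) * h * norm (\<beta> y')"
      proof (rule local_subsolution_near_paraboloid[OF sub_b has_C2_witness_const _ _ L(2,4) h(1) \<eta>(1)])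
        show "cball \<zeta>' h \<subseteq> U" "continuous_on (cball \<zeta>' h) b"
          using ballC C(4) continuous_on_subset[OF contb] by blast+
        show "b (\<zeta>' + w) \<le> b \<zeta>' + (N *\<^sub>R p') \<bullet> w + w \<bullet> L' w / 2 + \<eta> * h\<^sup>2" if "norm w \<le> h" for w
          using expb[of w] memC[of w] that by (simp add: \<zeta>'_def)
      qed (use N \<eta>(1) in auto)
      have yC: "y \<in> C" "y' \<in> C" using y y' ballC by (auto simp: dist_commute)
      define e where "e = 3 * t + 4 * \<eta>"
      have e: "norm (y - y') \<le> e" "0 \<le> e"
      proof -
        have "dist y y' \<le> dist y \<zeta> + dist \<zeta> \<zeta>' + dist y' \<zeta>'"
          using dist_triangle[of y y' \<zeta>] dist_triangle[of \<zeta> y' \<zeta>'] by (simp add: dist_commute)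
        then show "norm (y - y') \<le> e" using y y' h dist_\<zeta> by (simp add: e_def dist_norm)
        show "0 \<le> e" using t \<eta> by (simp add: e_def)
      qed
      have lipe: "norm (f y - f y') \<le> \<Lambda> * e" if "\<Lambda>-lipschitz_on C f" for f :: "real^'n \<Rightarrow> real^'n"
        using lipschitz_onD[OF that yC] mult_left_mono[OF e(1) \<Lambda>] by (simp add: dist_norm)
      \<comment> \<open>Up to the tilts the two gradients are opposite, so only the difference of
        the drifts enters, and its Lipschitz estimate absorbs the factor
        \<open>N * norm (z - z')\<close>.\<close>
      have drift: "- (\<beta> y \<bullet> (N *\<^sub>R p) + \<beta> y' \<bullet> (N *\<^sub>R p')) \<le> \<Lambda> * (N * e * t) + 2 * B * \<eta>"
      proof -
        have eq: "\<beta> y \<bullet> (N *\<^sub>R p) + \<beta> y' \<bullet> (N *\<^sub>R p') = N * ((\<beta> y - \<beta> y') \<bullet> (z - z')) + \<beta> y \<bullet> r + \<beta> y' \<bullet> r'"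
          unfolding p by (simp add: inner_add_right inner_diff_right inner_diff_left algebra_simps)
        have "\<bar>(\<beta> y - \<beta> y') \<bullet> (z - z')\<bar> \<le> (\<Lambda> * e) * t"
          using lipe[OF \<beta>lip] dt \<Lambda> e(2)
          by (intro order_trans[OF Cauchy_Schwarz_ineq2] mult_mono) auto
        then have "N * \<bar>(\<beta> y - \<beta> y') \<bullet> (z - z')\<bar> \<le> N * ((\<Lambda> * e) * t)"
          using N by (intro mult_left_mono) auto
        moreover have "N * - ((\<beta> y - \<beta> y') \<bullet> (z - z')) \<le> N * \<bar>(\<beta> y - \<beta> y') \<bullet> (z - z')\<bar>"
          using N by (intro mult_left_mono) auto
        moreover have "N * ((\<Lambda> * e) * t) = \<Lambda> * (N * e * t)" by simp
        ultimately have "- (N * ((\<beta> y - \<beta> y') \<bullet> (z - z'))) \<le> \<Lambda> * (N * e * t)"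
          unfolding mult_minus_right by linarith
        moreover have "\<bar>\<beta> y \<bullet> r\<bar> \<le> B * \<eta>" "\<bar>\<beta> y' \<bullet> r'\<bar> \<le> B * \<eta>"
          using \<beta>B[OF yC(1)] \<beta>B[OF yC(2)] r B by (auto intro!: order_trans[OF Cauchy_Schwarz_ineq2] mult_mono)
        ultimately show ?thesis unfolding eq by linarith
      qed
      \<comment> \<open>The matrix inequality is used with \<open>w = \<tau> k y\<close> and
        \<open>w' = \<tau> k y'\<close>, which leaves \<open>N\<close> times a squared Lipschitz
        difference. The constant 16 comes from \<open>4 * \<eta>\<close> in that inequality and
        \<open>4 * \<eta>\<close> in the tilted Hessians, for two vectors each.\<close>
      have diffusion: "(\<Sum>k\<in>UNIV. \<tau> k y \<bullet> L (\<tau> k y) + 4 * \<eta> * (norm (\<tau> k y))\<^sup>2)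
          + (\<Sum>k\<in>UNIV. \<tau> k y' \<bullet> L' (\<tau> k y') + 4 * \<eta> * (norm (\<tau> k y'))\<^sup>2) \<le> m * (\<Lambda>\<^sup>2 * (N * e\<^sup>2) + 16 * \<eta> * B\<^sup>2)"
      proof -
        have "\<tau> k y \<bullet> L (\<tau> k y) + 4 * \<eta> * (norm (\<tau> k y))\<^sup>2 + (\<tau> k y' \<bullet> L' (\<tau> k y') + 4 * \<eta> * (norm (\<tau> k y'))\<^sup>2)
          \<le> \<Lambda>\<^sup>2 * (N * e\<^sup>2) + 16 * \<eta> * B\<^sup>2" for k
        proof -
          have "(norm (\<tau> k y - \<tau> k y'))\<^sup>2 \<le> (\<Lambda> * e)\<^sup>2" by (intro power_mono lipe \<tau>lip) simp
          then have "N * (norm (\<tau> k y - \<tau> k y'))\<^sup>2 \<le> N * (\<Lambda> * e)\<^sup>2" using N by simp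
          moreover have "(norm (\<tau> k y))\<^sup>2 \<le> B\<^sup>2" "(norm (\<tau> k y'))\<^sup>2 \<le> B\<^sup>2"
            using \<tau>B yC by (auto intro!: power_mono)
          then have "8 * \<eta> * ((norm (\<tau> k y))\<^sup>2 + (norm (\<tau> k y'))\<^sup>2) \<le> 8 * \<eta> * (B\<^sup>2 + B\<^sup>2)"
            using \<eta>(1) by (intro mult_left_mono) auto
          ultimately show ?thesis using LL[of "\<tau> k y" "\<tau> k y'"]
            by (simp add: power_mult_distrib algebra_simps)
        qed
        then show ?thesis unfolding sum.distrib[symmetric] m_def
          by (intro order_trans[OF sum_bounded_above]) auto
      qed
      \<comment> \<open>The reason for the choice \<open>\<eta> = 1 / N\<^sup>2\<close>: the Hessian
        bound of order \<open>N\<close> times the radius \<open>h < \<eta>\<close> still tends to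
        0.\<close>
      have gradient: "(6 * N + \<eta> + 4 * \<eta>) * h * norm (\<beta> x) \<le> B * (6 * i + 5 * \<eta>\<^sup>2)" if "x \<in> C" for x
      proof -
        have "(6 * N + \<eta> + 4 * \<eta>) * h * norm (\<beta> x) \<le> (6 * N + \<eta> + 4 * \<eta>) * \<eta> * B"
          using N \<eta>(1) h \<beta>B[OF that] by (intro mult_mono) auto
        also have "\<dots> = B * (6 * (N * \<eta>) + 5 * \<eta>\<^sup>2)" by (simp add: power2_eq_square algebra_simps)
        finally show ?thesis unfolding \<eta>(3) .
      qed
      have "N * e * t = 3 * (N * t\<^sup>2) + 4 * (N * \<eta>) * t"
        by (simp add: e_def power2_eq_square algebra_simps)
      then have et: "N * e * t = 3 * (N * t\<^sup>2) + 4 * i * t" unfolding \<eta>(3) .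
      have "N * e\<^sup>2 = 9 * (N * t\<^sup>2) + 24 * (N * \<eta>) * t + 16 * (N * \<eta>) * \<eta>"
        by (simp add: e_def power2_eq_square algebra_simps)
      then have ee: "N * e\<^sup>2 = 9 * (N * t\<^sup>2) + 24 * i * t + 16 * i * \<eta>" unfolding \<eta>(3) .
      have "?F y' 0 0 0 = 0" by (simp add: linear_operator_def)
      then have "E y - v y * a y - v y' * b y' \<le> \<Lambda> * (3 * (N * t\<^sup>2) + 4 * i * t) + 2 * B * \<eta> + 2 * B * (6 * i + 5 * \<eta>\<^sup>2)
          + m * (\<Lambda>\<^sup>2 * (9 * (N * t\<^sup>2) + 24 * i * t + 16 * i * \<eta>) + 16 * \<eta> * B\<^sup>2)"
        using Fy Fy' drift diffusion gradient[OF yC(1)] gradient[OF yC(2)] unfolding et ee by linarith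
      moreover have "norm (y - \<zeta>) \<le> \<eta>" "norm (y' - \<zeta>') \<le> \<eta>" using y y' h by (auto simp: dist_norm)
      ultimately show ?thesis
        using inC dist_\<zeta> pen t(1) unfolding \<eta>_def \<zeta>_def[symmetric] \<zeta>'_def[symmetric] by blast
    qed
  qed
  define N where "N n = real (Suc n)" for n
  define i where "i n = 1 / N n" for n
  define P where "P n \<zeta> \<zeta>' t y y' \<longleftrightarrow> \<zeta> \<in> C \<and> \<zeta>' \<in> C \<and> 0 \<le> t \<and> norm (\<zeta> - \<zeta>') \<le> 3 * t + 2 * (i n)\<^sup>2 \<and>
      (N n / 2 - 2 * (i n)\<^sup>2) * t\<^sup>2 \<le> a \<zeta> + b \<zeta>' + 2 * (i n)\<^sup>2 * (R + 1) \<and>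
      (norm (\<zeta> - zh) + (i n)\<^sup>2 \<le> R \<longrightarrow> norm (\<zeta>' - zh) + (i n)\<^sup>2 \<le> R \<longrightarrow>
        norm (y - \<zeta>) \<le> (i n)\<^sup>2 \<and> norm (y' - \<zeta>') \<le> (i n)\<^sup>2 \<and>
        E y - v y * a y - v y' * b y' \<le> \<Lambda> * (3 * (N n * t\<^sup>2) + 4 * i n * t) + 2 * B * (i n)\<^sup>2
          + 2 * B * (6 * i n + 5 * ((i n)\<^sup>2)\<^sup>2)
          + m * (\<Lambda>\<^sup>2 * (9 * (N n * t\<^sup>2) + 24 * i n * t + 16 * i n * (i n)\<^sup>2) + 16 * (i n)\<^sup>2 * B\<^sup>2))"
    for n \<zeta> \<zeta>' t y y'
  have "\<forall>n. \<exists>\<zeta> \<zeta>' t y y'. P n \<zeta> \<zeta>' t y y'"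
    unfolding P_def by (intro allI step) (auto simp: N_def i_def)
  then obtain \<zeta> \<zeta>' t y y' where P: "\<And>n. P n (\<zeta> n) (\<zeta>' n) (t n) (y n) (y' n)" by metis
  have \<zeta>C: "\<zeta> n \<in> C" "\<zeta>' n \<in> C" for n using P[of n] by (simp_all add: P_def)
  have ilim: "i \<longlonglongrightarrow> 0"
    using LIMSEQ_inverse_real_of_nat unfolding i_def N_def by (simp add: inverse_eq_divide)
  have i2lim: "(\<lambda>n. (i n)\<^sup>2) \<longlonglongrightarrow> 0" using tendsto_power[OF ilim, of 2] by simp
  have CU: "continuous_on C a" "continuous_on C b"
    using conta contb continuous_on_subset C(4) by blast+
  obtain Ma where Ma: "\<And>c. c \<in> C \<Longrightarrow> a c \<le> Ma" using continuous_attains_sup[OF C(1,2) CU(1)] by blast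
  obtain Mb where Mb: "\<And>c. c \<in> C \<Longrightarrow> b c \<le> Mb" using continuous_attains_sup[OF C(1,2) CU(2)] by blast
  \<comment> \<open>From \<open>n = 7\<close> on one has \<open>N n \<ge> 8\<close>, so
    \<open>2 * (i n)\<^sup>2\<close> is at most a quarter of \<open>N n\<close>.\<close>
  have pen: "N n * (t n)\<^sup>2 \<le> 4 * (a (\<zeta> n) + b (\<zeta>' n) + 2 * (i n)\<^sup>2 * (R + 1))" if "7 \<le> n" for n
  proof -
    have "8 \<le> N n" using that by (simp add: N_def)
    moreover have "(i n)\<^sup>2 \<le> 1" by (simp add: i_def N_def power_le_one)
    ultimately have "N n / 4 \<le> N n / 2 - 2 * (i n)\<^sup>2" by linarith
    then have "N n / 4 * (t n)\<^sup>2 \<le> (N n / 2 - 2 * (i n)\<^sup>2) * (t n)\<^sup>2" by (rule mult_right_mono) simp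
    also have "\<dots> \<le> a (\<zeta> n) + b (\<zeta>' n) + 2 * (i n)\<^sup>2 * (R + 1)" using P[of n] by (simp add: P_def)
    finally show ?thesis by simp
  qed
  have tlim: "t \<longlonglongrightarrow> 0"
  proof -
    have "norm ((t n)\<^sup>2) \<le> 4 * (Ma + Mb + 2 * (R + 1)) * i n" if "7 \<le> n" for n
    proof -
      have "(i n)\<^sup>2 \<le> 1" by (simp add: i_def N_def power_le_one)
      define u where "u = (i n)\<^sup>2 * (R + 1)"
      have "u \<le> 1 * (R + 1)"
        unfolding u_def using R(1) \<open>(i n)\<^sup>2 \<le> 1\<close> by (intro mult_right_mono) auto
      have "N n * (t n)\<^sup>2 \<le> 4 * (a (\<zeta> n) + b (\<zeta>' n) + 2 * u)"
        using pen[OF that] by (simp only: u_def mult.assoc)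
      moreover have "4 * (a (\<zeta> n) + b (\<zeta>' n) + 2 * u) \<le> 4 * (Ma + Mb + 2 * (R + 1))"
        using Ma[OF \<zeta>C(1)[of n]] Mb[OF \<zeta>C(2)[of n]] \<open>u \<le> 1 * (R + 1)\<close>
        by (intro mult_left_mono add_mono) auto
      ultimately have "N n * (t n)\<^sup>2 \<le> 4 * (Ma + Mb + 2 * (R + 1))"
        by (rule order_trans)
      then show ?thesis by (simp add: i_def N_def field_simps)
    qed
    then have "\<forall>\<^sub>F n in sequentially. norm ((t n)\<^sup>2) \<le> 4 * (Ma + Mb + 2 * (R + 1)) * i n"
      by (auto simp: eventually_sequentially)
    then have "(\<lambda>n. (t n)\<^sup>2) \<longlonglongrightarrow> 0"
      by (rule Lim_null_comparison) (intro tendsto_mult_right_zero ilim)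
    then show ?thesis by simp
  qed
  have \<zeta>\<zeta>: "(\<lambda>n. \<zeta> n - \<zeta>' n) \<longlonglongrightarrow> 0"
  proof (rule Lim_null_comparison)
    show "\<forall>\<^sub>F n in sequentially. norm (\<zeta> n - \<zeta>' n) \<le> 3 * t n + 2 * (i n)\<^sup>2"
      using P by (auto simp: P_def)
    show "(\<lambda>n. 3 * t n + 2 * (i n)\<^sup>2) \<longlonglongrightarrow> 0"
      by (rule tendsto_eq_intros tlim i2lim refl)+ simp
  qed
  \<comment> \<open>Boundedness of \<open>a\<close> and \<open>b\<close> has only given that
    \<open>t\<close> tends to 0. Replacing \<open>a (\<zeta> n)\<close> by its bound,
    \<open>- b (\<zeta> n)\<close> minus the quartic, leaves \<open>D\<close>, which tends to 0 by
    uniform continuity of \<open>b\<close>. Hence both \<open>N n * (t n)\<^sup>2\<close> and the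
    quartic tend to 0, and the points converge to \<open>zh\<close>.\<close>
  define D where "D n = b (\<zeta>' n) - b (\<zeta> n) + 2 * (i n)\<^sup>2 * (R + 1)" for n
  have Dlim: "D \<longlonglongrightarrow> 0"
  proof -
    have "uniformly_continuous_on C b" by (rule compact_uniformly_continuous[OF CU(2) C(1)])
    moreover have "(\<lambda>n. dist (\<zeta>' n) (\<zeta> n)) \<longlonglongrightarrow> 0"
      using tendsto_norm_zero[OF \<zeta>\<zeta>] by (simp add: dist_norm norm_minus_commute)
    ultimately have "(\<lambda>n. dist (b (\<zeta>' n)) (b (\<zeta> n))) \<longlonglongrightarrow> 0"
      using \<zeta>C unfolding uniformly_continuous_on_sequentially by blast
    then have "(\<lambda>n. b (\<zeta>' n) - b (\<zeta> n)) \<longlonglongrightarrow> 0"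
      by (simp add: dist_norm tendsto_rabs_zero_iff)
    moreover have "(\<lambda>n. 2 * (i n)\<^sup>2 * (R + 1)) \<longlonglongrightarrow> 0"
      by (rule tendsto_eq_intros i2lim refl)+ simp
    ultimately show ?thesis unfolding D_def using tendsto_add_zero by blast
  qed
  have D: "((norm (\<zeta> n - zh))\<^sup>2)\<^sup>2 \<le> D n" "N n * (t n)\<^sup>2 \<le> 4 * D n" if "7 \<le> n" for n
  proof -
    have "q \<le> b2 - b1 + w" "X \<le> 4 * (b2 - b1 + w)"
      if "0 \<le> X" "0 \<le> q" "X \<le> 4 * (a1 + b2 + w)" "a1 + b1 \<le> - q" for X q a1 b1 b2 w :: real
      using that by simp_all
    from this[OF _ _ pen[OF that] ab_le[OF \<zeta>C(1)[of n]]]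
    show "((norm (\<zeta> n - zh))\<^sup>2)\<^sup>2 \<le> D n" "N n * (t n)\<^sup>2 \<le> 4 * D n"
      unfolding D_def by (simp_all add: N_def)
  qed
  have Xlim: "(\<lambda>n. N n * (t n)\<^sup>2) \<longlonglongrightarrow> 0"
  proof (rule Lim_null_comparison)
    show "(\<lambda>n. 4 * D n) \<longlonglongrightarrow> 0" by (intro tendsto_mult_right_zero Dlim)
    show "\<forall>\<^sub>F n in sequentially. norm (N n * (t n)\<^sup>2) \<le> 4 * D n"
      using D(2) by (auto simp: eventually_sequentially N_def)
  qed
  have "(\<lambda>n. ((norm (\<zeta> n - zh))\<^sup>2)\<^sup>2) \<longlonglongrightarrow> 0"
    by (rule Lim_null_comparison[OF _ Dlim]) (use D(1) in \<open>auto simp: eventually_sequentially\<close>)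
  then have nlim: "(\<lambda>n. norm (\<zeta> n - zh)) \<longlonglongrightarrow> 0" by simp
  have nlim': "(\<lambda>n. norm (\<zeta>' n - zh)) \<longlonglongrightarrow> 0"
  proof (rule Lim_null_comparison)
    have "norm (\<zeta>' n - zh) \<le> norm (\<zeta> n - zh) + norm (\<zeta> n - \<zeta>' n)" for n
      using norm_triangle_ineq4[of "\<zeta> n - zh" "\<zeta> n - \<zeta>' n"] by simp
    then show "\<forall>\<^sub>F n in sequentially. norm (norm (\<zeta>' n - zh)) \<le> norm (\<zeta> n - zh) + norm (\<zeta> n - \<zeta>' n)"
      by simp
    show "(\<lambda>n. norm (\<zeta> n - zh) + norm (\<zeta> n - \<zeta>' n)) \<longlonglongrightarrow> 0"
      by (intro tendsto_add_zero nlim tendsto_norm_zero \<zeta>\<zeta>)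
  qed
  have ev: "\<forall>\<^sub>F n in sequentially. norm (\<zeta> n - zh) + (i n)\<^sup>2 \<le> R \<and> norm (\<zeta>' n - zh) + (i n)\<^sup>2 \<le> R"
    using order_tendstoD(2)[OF tendsto_add_zero[OF nlim i2lim] R(1)]
      order_tendstoD(2)[OF tendsto_add_zero[OF nlim' i2lim] R(1)]
    by eventually_elim simp
  have close: "\<forall>\<^sub>F n in sequentially. norm (y n - zh) \<le> (i n)\<^sup>2 + norm (\<zeta> n - zh) \<and>
      norm (y' n - zh) \<le> (i n)\<^sup>2 + norm (\<zeta>' n - zh)"
    using ev
  proof eventually_elim
    case (elim n)
    then have "norm (y n - \<zeta> n) \<le> (i n)\<^sup>2" "norm (y' n - \<zeta>' n) \<le> (i n)\<^sup>2"
      using P[of n] by (auto simp: P_def)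
    then show ?case
      using norm_triangle_ineq[of "y n - \<zeta> n" "\<zeta> n - zh"] norm_triangle_ineq[of "y' n - \<zeta>' n" "\<zeta>' n - zh"] by simp
  qed
  have "(\<lambda>n. y n - zh) \<longlonglongrightarrow> 0"
    by (rule Lim_null_comparison[OF _ tendsto_add_zero[OF i2lim nlim]]) (use close in eventually_elim, simp)
  then have ylim: "y \<longlonglongrightarrow> zh" by (simp add: LIM_zero_iff)
  have "(\<lambda>n. y' n - zh) \<longlonglongrightarrow> 0"
    by (rule Lim_null_comparison[OF _ tendsto_add_zero[OF i2lim nlim']]) (use close in eventually_elim, simp)
  then have ylim': "y' \<longlonglongrightarrow> zh" by (simp add: LIM_zero_iff)
  have lim: "(\<lambda>n. f (x n)) \<longlonglongrightarrow> f zh" if "continuous_on U f" "x \<longlonglongrightarrow> zh" for f :: "real^'n \<Rightarrow> real" and x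
    using that(1) zh by (intro isCont_tendsto_compose[OF _ that(2)]) (simp add: continuous_on_eq_continuous_at[OF \<open>open U\<close>])
  have "E zh - v zh * a zh - v zh * b zh \<le> 0"
  proof (rule tendsto_le[OF sequentially_bot])
    show "(\<lambda>n. E (y n) - v (y n) * a (y n) - v (y' n) * b (y' n)) \<longlonglongrightarrow> E zh - v zh * a zh - v zh * b zh"
      by (intro tendsto_intros lim[OF contE ylim] lim[OF contv ylim] lim[OF contv ylim'] lim[OF conta ylim] lim[OF contb ylim'])
    show "(\<lambda>n. \<Lambda> * (3 * (N n * (t n)\<^sup>2) + 4 * i n * t n) + 2 * B * (i n)\<^sup>2
          + 2 * B * (6 * i n + 5 * ((i n)\<^sup>2)\<^sup>2)
          + m * (\<Lambda>\<^sup>2 * (9 * (N n * (t n)\<^sup>2) + 24 * i n * t n + 16 * i n * (i n)\<^sup>2) + 16 * (i n)\<^sup>2 * B\<^sup>2)) \<longlonglongrightarrow> 0"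
      by (rule tendsto_eq_intros Xlim tlim ilim i2lim refl)+ simp
    show "\<forall>\<^sub>F n in sequentially. E (y n) - v (y n) * a (y n) - v (y' n) * b (y' n)
        \<le> \<Lambda> * (3 * (N n * (t n)\<^sup>2) + 4 * i n * t n) + 2 * B * (i n)\<^sup>2
          + 2 * B * (6 * i n + 5 * ((i n)\<^sup>2)\<^sup>2)
          + m * (\<Lambda>\<^sup>2 * (9 * (N n * (t n)\<^sup>2) + 24 * i n * t n + 16 * i n * (i n)\<^sup>2) + 16 * (i n)\<^sup>2 * B\<^sup>2)"
      using ev
    proof eventually_elim
      case (elim n)
      then show ?case using P[of n] unfolding P_def by blast
    qed
  qed
  \<comment> \<open>The zero-order terms cancel whatever the sign of \<open>v\<close>, since
    \<open>a + b\<close> vanishes at \<open>zh\<close>.\<close>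
  moreover have "v zh * a zh + v zh * b zh = 0" using ab0 by (metis distrib_left mult_zero_right)
  ultimately have "E zh \<le> 0" by linarith
  then show ?thesis by (simp add: E_def \<Phi>_def g_def A_def q(2,3))
qed

section \<open>The Kolmogorov equation\<close>

lemma linear_operator_uminus:
  "linear_operator \<beta> v \<tau> z (- r) (- p) (- A) = - linear_operator \<beta> v \<tau> z r p A"
proof -
  have "(- A) *v x = - (A *v x)" for x
    by (metis add.right_inverse add_eq_0_iff matrix_vector_mult_add_rdistrib matrix_vector_mult_0)
  then show ?thesis by (simp add: linear_operator_def sum_negf)
qed

section \<open>Calculus in joint time-space coordinates\<close>

lemma sum_UNIV_option:
  fixes f :: "'k::finite option \<Rightarrow> 'b::comm_monoid_add"
  shows "(\<Sum>k\<in>UNIV. f k) = f None + (\<Sum>i\<in>UNIV. f (Some i))"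
  by (simp add: UNIV_option_conv sum.reindex)

lemma inner_time_space: "z \<bullet> w = z $ None * w $ None + space_part z \<bullet> space_part w"
  by (simp add: inner_vec_def sum_UNIV_option space_part_def)

lemma join_tx_nth [simp]: "join_tx tx $ None = fst tx" "join_tx tx $ Some i = snd tx $ i"
  by (simp_all add: join_tx_def)

lemma space_part_join_tx [simp]: "space_part (join_tx tx) = snd tx"
  by (simp add: space_part_def)

lemma linear_space_part: "linear space_part"
  by (rule linearI) (simp_all add: space_part_def vec_eq_iff)

lemma linear_join_tx: "linear join_tx"
  by (rule linearI) (simp_all add: join_tx_def vec_eq_iff split: option.split)

lemma norm_join_tx: "norm (join_tx tx) = norm tx"
  by (simp add: norm_eq_sqrt_inner inner_time_space inner_prod_def)

lemma dist_join_tx: "dist (join_tx p) (join_tx q) = dist p q"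
  unfolding dist_norm linear_diff[OF linear_join_tx, symmetric] by (rule norm_join_tx)

lemma dist_split_tx: "dist (split_tx z) (split_tx w) = dist z w"
  by (metis dist_join_tx join_split_tx)

lemma continuous_on_split_tx: "continuous_on S split_tx"
  by (rule lipschitz_on_continuous_on[of 1]) (auto intro!: lipschitz_onI simp: dist_split_tx)

lemma image_join_tx: "join_tx ` S = split_tx -` S"
  by (auto simp: image_iff) (metis join_split_tx)

lemma open_image_join_tx: "open S \<Longrightarrow> open (join_tx ` S)"
  unfolding image_join_tx by (rule open_vimage[OF _ continuous_on_split_tx])

lemma continuous_on_image_join_tx:
  "continuous_on S f \<Longrightarrow> continuous_on (join_tx ` S) (\<lambda>z. f (split_tx z))"
  by (rule continuous_on_compose2[OF _ continuous_on_split_tx]) (auto simp: image_join_tx)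

lemma locally_lipschitz_on_image_join_tx:
  assumes f: "locally_lipschitz_on S f" and g: "\<And>p q. dist (g p) (g q) \<le> dist p q"
  shows "locally_lipschitz_on (join_tx ` S) (\<lambda>z. g (f (split_tx z)))"
  unfolding locally_lipschitz_on_def
proof
  fix z assume "z \<in> join_tx ` S"
  then have "split_tx z \<in> S" by (auto simp: image_join_tx)
  then obtain e L where e: "0 < e" "L-lipschitz_on (ball (split_tx z) e \<inter> S) f"
    using f by (auto simp: locally_lipschitz_on_def)
  have "L-lipschitz_on (ball z e \<inter> join_tx ` S) (\<lambda>z. g (f (split_tx z)))"
  proof (rule lipschitz_onI)
    fix x y assume "x \<in> ball z e \<inter> join_tx ` S" "y \<in> ball z e \<inter> join_tx ` S"
    then have "split_tx x \<in> ball (split_tx z) e \<inter> S" "split_tx y \<in> ball (split_tx z) e \<inter> S"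
      by (auto simp: dist_split_tx)
    from lipschitz_onD[OF e(2) this] show "dist (g (f (split_tx x))) (g (f (split_tx y))) \<le> L * dist x y"
      using g order_trans unfolding dist_split_tx by blast
  qed (rule lipschitz_on_nonneg[OF e(2)])
  then show "\<exists>e>0. \<exists>L. L-lipschitz_on (ball z e \<inter> join_tx ` S) (\<lambda>z. g (f (split_tx z)))"
    using e(1) by blast
qed

lemma dist_column_le: "dist (column k A) (column k B) \<le> dist A (B :: real^'m^'d)"
proof -
  have "norm (column k (A - B)) \<le> norm (A - B)"
    unfolding norm_vec_def[of "column k (A - B)"] norm_vec_def[of "A - B"]
    by (rule L2_set_mono) (simp_all add: column_def component_le_norm_cart flip: vector_minus_component)
  moreover have "column k (A - B) = column k A - column k B" by (simp add: column_def vec_eq_iff)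
  ultimately show ?thesis by (simp add: dist_norm)
qed

text \<open>The time component 1 turns the pairing with the gradient into the time derivative; the
  sign of \<open>\<mu>\<close> matches its place in the equation.\<close>

definition drift_field :: "(real \<times> (real^'d) \<Rightarrow> real^'d) \<Rightarrow> real^('d option) \<Rightarrow> real^('d option)" where
  "drift_field \<mu> z = join_tx (1, - \<mu> (split_tx z))"

text \<open>With zero time component the second-order part is degenerate in the time
  direction.\<close>

definition noise_field :: "(real \<times> (real^'d) \<Rightarrow> real^'m^'d) \<Rightarrow> 'm \<Rightarrow> real^('d option) \<Rightarrow> real^('d option)" where
  "noise_field \<sigma> k z = join_tx (0, column k (\<sigma> (split_tx z)))"

lemma kolmogorov_operator_eq:
  "kolmogorov_operator v \<mu> \<sigma> = linear_operator (drift_field \<mu>) (\<lambda>z. v (split_tx z)) (noise_field \<sigma>)"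
  by (intro ext) (simp add: kolmogorov_operator_def linear_operator_def Let_def drift_field_def
      noise_field_def trace_sandwich space_block_inner inner_time_space)

lemma locally_lipschitz_drift_field:
  assumes "locally_lipschitz_on S \<mu>"
  shows "locally_lipschitz_on (join_tx ` S) (drift_field \<mu>)"
proof -
  have "dist (join_tx (1, - p)) (join_tx (1, - q)) \<le> dist p q" for p q :: "real^'a"
    by (simp add: dist_join_tx dist_Pair_Pair) (simp add: dist_norm norm_minus_commute)
  from locally_lipschitz_on_image_join_tx[OF assms this] show ?thesis
    by (simp add: drift_field_def[abs_def])
qed

lemma locally_lipschitz_noise_field:
  assumes "locally_lipschitz_on S \<sigma>"
  shows "locally_lipschitz_on (join_tx ` S) (noise_field \<sigma> k)"
  using locally_lipschitz_on_image_join_tx[OF assms, of "\<lambda>A. join_tx (0, column k A)"]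
  by (simp add: noise_field_def[abs_def] dist_join_tx dist_Pair_Pair dist_column_le)

lemma has_C2_witness_time:
  fixes U :: "(real^('d::finite option)) set"
  assumes f: "\<And>z. z \<in> U \<Longrightarrow> (f has_real_derivative f' (z $ None)) (at (z $ None))"
    "\<And>z. z \<in> U \<Longrightarrow> (f' has_real_derivative f'' (z $ None)) (at (z $ None))"
    and "continuous_on ((\<lambda>z. z $ None) ` U) f''"
  shows "has_C2_witness U (\<lambda>z. f (z $ None)) (\<lambda>z. f' (z $ None) *\<^sub>R axis None 1)
    (\<lambda>z. f'' (z $ None) *\<^sub>R outer (axis None 1) (axis None 1))"
  unfolding has_C2_witness_def gderiv_def
proof (intro conjI ballI)
  fix z assume z: "z \<in> U"
  have nth: "((\<lambda>z. z $ None) has_derivative (\<lambda>h. h $ None)) (at z)"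
    by (rule bounded_linear_imp_has_derivative) (rule bounded_linear_vec_nth)
  show "((\<lambda>z. f (z $ None)) has_derivative (\<lambda>h. h \<bullet> (f' (z $ None) *\<^sub>R axis None 1))) (at z)"
    using has_derivative_compose[OF nth f(1)[OF z, unfolded has_field_derivative_def]]
    by (simp add: inner_axis)
  show "((\<lambda>z. f' (z $ None) *\<^sub>R axis None 1) has_derivative
      (*v) (f'' (z $ None) *\<^sub>R outer (axis None 1) (axis None 1))) (at z)"
  proof -
    have "(*v) (f'' (z $ None) *\<^sub>R outer (axis None 1) (axis None 1)) = (\<lambda>h. (f'' (z $ None) * h $ None) *\<^sub>R (axis None 1 :: real^('d option)))"
      by (simp add: fun_eq_iff scaleR_matrix_vector_assoc[symmetric] outer_mult_vec inner_axis')
    then show ?thesis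
      using has_derivative_scaleR_left[OF has_derivative_compose[OF nth f(2)[OF z, unfolded has_field_derivative_def]], of "axis None 1 :: real^('d option)"]
      by simp
  qed
next
  have "continuous_on U (\<lambda>z. f'' (z $ None))"
    by (rule continuous_on_compose2[OF assms(3)]) (auto intro: continuous_intros)
  then show "continuous_on U (\<lambda>z. f'' (z $ None) *\<^sub>R outer (axis None 1) (axis None 1))"
    by (intro continuous_intros)
qed

text \<open>The Hessian is that of \<open>V\<close> padded with zeros in the time row and column. It
  is exported through its action on vectors, which is what evaluating quadratic forms
  requires.\<close>

lemma has_C2_witness_space:
  fixes U :: "(real^('d::finite option)) set"
  assumes V: "has_C2_witness S V g A" and U: "\<And>z. z \<in> U \<Longrightarrow> space_part z \<in> S"
  obtains B where "has_C2_witness U (\<lambda>z. V (space_part z)) (\<lambda>z. join_tx (0, g (space_part z))) B"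
    "\<And>z h. B z *v h = join_tx (0, A (space_part z) *v space_part h)"
proof
  define B where "B z = (\<chi> i j. case i of None \<Rightarrow> 0 | Some i \<Rightarrow> (case j of None \<Rightarrow> 0 | Some j \<Rightarrow> A (space_part z) $ i $ j))"
    for z :: "real^('d option)"
  show B: "B z *v h = join_tx (0, A (space_part z) *v space_part h)" for z h
    by (simp add: B_def vec_eq_iff matrix_vector_mult_def sum_UNIV_option join_tx_def space_part_def split: option.split)
  have bl: "bounded_linear space_part" "bounded_linear (\<lambda>x. join_tx (0 :: real, x :: real^'d))"
    unfolding linear_conv_bounded_linear[symmetric]
    by (rule linear_space_part) (rule linearI; simp add: join_tx_def vec_eq_iff split: option.split)
  have sp: "(space_part has_derivative space_part) (at z)" for z :: "real^('d option)"
    by (rule bounded_linear_imp_has_derivative[OF bl(1)])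
  show "has_C2_witness U (\<lambda>z. V (space_part z)) (\<lambda>z. join_tx (0, g (space_part z))) B"
    unfolding has_C2_witness_def gderiv_def
  proof (intro conjI ballI)
    fix z assume "z \<in> U"
    note D = has_C2_witnessD[OF V U[OF this], unfolded gderiv_def]
    show "((\<lambda>z. V (space_part z)) has_derivative (\<lambda>h. h \<bullet> join_tx (0, g (space_part z)))) (at z)"
      using has_derivative_compose[OF sp D(1)] by (simp add: inner_time_space)
    have "(*v) (B z) = (\<lambda>h. join_tx (0, A (space_part z) *v space_part h))" by (simp add: fun_eq_iff B)
    then show "((\<lambda>z. join_tx (0, g (space_part z))) has_derivative (*v) (B z)) (at z)"
      using bounded_linear.has_derivative[OF bl(2) has_derivative_compose[OF sp D(2)]] by simp
  next
    have cA: "continuous_on U (\<lambda>z. A (space_part z))"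
      using has_C2_witness_continuous(3)[OF V] bl(1) U
      by (intro continuous_on_compose2[of S A U space_part]) (auto intro: linear_continuous_on)
    show "continuous_on U B"
      unfolding B_def
    proof (intro continuous_on_vec_lambda)
      show "continuous_on U (\<lambda>x. case i of None \<Rightarrow> 0
          | Some i \<Rightarrow> (case j of None \<Rightarrow> 0 | Some j \<Rightarrow> A (space_part x) $ i $ j))" for i j
        by (cases i; cases j) (simp_all add: continuous_on_component cA)
    qed
  qed
qed

section \<open>Decay outside compact sets and comparison\<close>

lemma compact_exhaustion:
  fixes S :: "'a::euclidean_space set"
  assumes "n \<ge> 1"
  shows "compact (exhaustion S n)"
proof -
  have "exhaustion S n = cball 0 (real n) \<inter> (\<Inter>y\<in>- S. {x. 1 / real n \<le> norm (x - y)})"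
  proof -
    have "ereal (1 / real n) \<le> ext_dist x (- S) \<longleftrightarrow> (\<forall>y\<in>- S. 1 / real n \<le> norm (x - y))" for x
      unfolding ext_dist_def le_Inf_iff by auto
    \<comment> \<open>A point outside \<open>S\<close> would have distance 0 from itself, so for
      \<open>n \<ge> 1\<close> the distance condition already implies membership in
      \<open>S\<close>, and what remains is a closed condition.\<close>
    moreover have "x \<in> S" if "\<forall>y\<in>- S. 1 / real n \<le> norm (x - y)" for x
      using that[rule_format, of x] assms by (cases "x \<in> S") auto
    ultimately show ?thesis unfolding exhaustion_def by auto
  qed
  moreover have "closed {x. 1 / real n \<le> norm (x - y)}" for y :: 'a
    by (intro closed_Collect_le continuous_intros)
  ultimately show ?thesis
    by (simp only:) (intro compact_Int_closed compact_cball closed_INT ballI)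
qed

lemma outside_exhaustion_bound:
  assumes lim: "(\<lambda>n. SUP (t, x) \<in> I \<times> (S - exhaustion S n). ereal (\<bar>u (t, x)\<bar> / V x)) \<longlonglongrightarrow> 0"
    and V: "\<And>x. x \<in> S \<Longrightarrow> 0 < V x" and "0 < \<epsilon>"
  shows "\<forall>\<^sub>F n in sequentially. \<forall>t\<in>I. \<forall>x\<in>S - exhaustion S n. \<bar>u (t, x)\<bar> \<le> \<epsilon> * V x"
proof -
  have "\<forall>\<^sub>F n in sequentially. (SUP (t, x) \<in> I \<times> (S - exhaustion S n). ereal (\<bar>u (t, x)\<bar> / V x)) < ereal \<epsilon>"
    using order_tendstoD(2)[OF lim, of "ereal \<epsilon>"] \<open>0 < \<epsilon>\<close> by simp
  then show ?thesis
  proof eventually_elim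
    case (elim n)
    show ?case
    proof (intro ballI)
      fix t x assume "t \<in> I" and x: "x \<in> S - exhaustion S n"
      then have "ereal (\<bar>u (t, x)\<bar> / V x) \<le> (SUP (t, x) \<in> I \<times> (S - exhaustion S n). ereal (\<bar>u (t, x)\<bar> / V x))"
        by (intro SUP_upper2[of "(t, x)"]) auto
      with elim have "ereal (\<bar>u (t, x)\<bar> / V x) < ereal \<epsilon>" by (rule le_less_trans[rotated])
      then show "\<bar>u (t, x)\<bar> \<le> \<epsilon> * V x" using V[of x] x by (simp add: field_simps)
    qed
  qed
qed

text \<open>A one-sided statement, for a subsolution and a supersolution, so that uniqueness follows
  by exchanging the two functions.\<close>

lemma viscosity_comparison:
  fixes \<O> :: "(real^'d) set" and v :: "real \<times> (real^'d) \<Rightarrow> real"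
    and \<mu> :: "real \<times> (real^'d) \<Rightarrow> real^'d" and \<sigma> :: "real \<times> (real^'d) \<Rightarrow> real^'m^'d"
  assumes T: "0 < T" and \<O>: "open \<O>" and v: "continuous_on ({0<..<T} \<times> \<O>) v"
    and \<mu>: "locally_lipschitz_on ({0<..<T} \<times> \<O>) \<mu>" and \<sigma>: "locally_lipschitz_on ({0<..<T} \<times> \<O>) \<sigma>"
    and V: "C2_on \<O> V" and Vpos: "\<And>x. x \<in> \<O> \<Longrightarrow> 0 < V x"
    and lyap: "\<And>t x. t \<in> {0<..<T} \<Longrightarrow> x \<in> \<O> \<Longrightarrow> v (t, x) * V x + \<mu> (t, x) \<bullet> grad V x
             + trace (\<sigma> (t, x) ** transpose (\<sigma> (t, x)) ** hess V x) \<le> \<rho> * V x"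
    and cont1: "continuous_on ({0..T} \<times> \<O>) u1" and cont2: "continuous_on ({0..T} \<times> \<O>) u2"
    and init: "\<And>x. x \<in> \<O> \<Longrightarrow> u1 (0, x) = u2 (0, x)"
    and lim1: "(\<lambda>n. SUP (t, x) \<in> {0<..<T} \<times> (\<O> - exhaustion \<O> n). ereal (\<bar>u1 (t, x)\<bar> / V x)) \<longlonglongrightarrow> 0"
    and lim2: "(\<lambda>n. SUP (t, x) \<in> {0<..<T} \<times> (\<O> - exhaustion \<O> n). ereal (\<bar>u2 (t, x)\<bar> / V x)) \<longlonglongrightarrow> 0"
    and sub: "viscosity_subsolution (join_tx ` ({0<..<T} \<times> \<O>)) (kolmogorov_operator v \<mu> \<sigma>) (\<lambda>z. u1 (split_tx z))"
    and super: "viscosity_supersolution (join_tx ` ({0<..<T} \<times> \<O>)) (kolmogorov_operator v \<mu> \<sigma>) (\<lambda>z. u2 (split_tx z))"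
    and t0: "t0 \<in> {0<..<T}" and x0: "x0 \<in> \<O>"
  shows "u1 (t0, x0) \<le> u2 (t0, x0)"
proof (rule ccontr)
  assume less: "\<not> ?thesis"
  define U where "U = join_tx ` ({0<..<T} \<times> \<O>)"
  define \<beta> where "\<beta> = drift_field \<mu>"
  define \<tau> where "\<tau> = noise_field \<sigma>"
  define L where "L = linear_operator \<beta> (\<lambda>z. v (split_tx z)) \<tau>"
  have K: "kolmogorov_operator v \<mu> \<sigma> = L" by (simp add: L_def \<beta>_def \<tau>_def kolmogorov_operator_eq)
  have U: "z \<in> U \<longleftrightarrow> z $ None \<in> {0<..<T} \<and> space_part z \<in> \<O>" for z
    by (auto simp: U_def image_join_tx split_tx_def)
  have openU: "open U" unfolding U_def by (intro open_image_join_tx open_Times \<O>) simp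
  have wV: "has_C2_witness \<O> V (grad V) (hess V)" by (rule C2_on_imp_has_C2_witness[OF V])
  have contV: "continuous_on \<O> V" by (rule has_C2_witness_continuous(1)[OF wV])
  obtain B where wB: "has_C2_witness U (\<lambda>z. V (space_part z)) (\<lambda>z. join_tx (0, grad V (space_part z))) B"
    and B: "\<And>z h. B z *v h = join_tx (0, hess V (space_part z) *v space_part h)"
    using has_C2_witness_space[OF wV, of U] U by blast
  \<comment> \<open>This supplies the global C2 majorant for
    \<open>viscosity_subsolution_local_test\<close>: outside a compact set of space points the
    quotient by \<open>V\<close> is at most 1 by the decay, and over it, the end points of the time
    interval included, continuity bounds the quotient.\<close>
  have dominated: "\<exists>k. \<forall>z\<in>U. \<bar>u (split_tx z)\<bar> \<le> k * V (space_part z)"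
    if cont: "continuous_on ({0..T} \<times> \<O>) u"
      and lim: "(\<lambda>n. SUP (t, x) \<in> {0<..<T} \<times> (\<O> - exhaustion \<O> n). ereal (\<bar>u (t, x)\<bar> / V x)) \<longlonglongrightarrow> 0" for u
  proof -
    obtain n where n: "n \<ge> 1" "\<And>t x. t \<in> {0<..<T} \<Longrightarrow> x \<in> \<O> - exhaustion \<O> n \<Longrightarrow> \<bar>u (t, x)\<bar> \<le> 1 * V x"
      using eventually_happens'[OF sequentially_bot eventually_conj[OF eventually_ge_at_top[of 1]
        outside_exhaustion_bound[OF lim Vpos zero_less_one]]] by blast
    have sub: "exhaustion \<O> n \<subseteq> \<O>" by (auto simp: exhaustion_def)
    have "compact ((\<lambda>p. u p / V (snd p)) ` ({0..T} \<times> exhaustion \<O> n))"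
      using sub Vpos by (intro compact_continuous_image compact_Times compact_Icc compact_exhaustion n(1)
        continuous_intros continuous_on_subset[OF cont] continuous_on_compose2[OF contV]) force+
    then have "bounded ((\<lambda>p. u p / V (snd p)) ` ({0..T} \<times> exhaustion \<O> n))"
      by (rule compact_imp_bounded)
    then obtain k where "\<forall>p\<in>{0..T} \<times> exhaustion \<O> n. norm (u p / V (snd p)) \<le> k"
      unfolding bounded_iff by blast
    then have k: "\<bar>u p / V (snd p)\<bar> \<le> k" if "p \<in> {0..T} \<times> exhaustion \<O> n" for p
      using that by (metis real_norm_def)
    have "\<bar>u (split_tx z)\<bar> \<le> max 1 k * V (space_part z)" if "z \<in> U" for z
    proof -
      define t x where "t = z $ None" and "x = space_part z"
      have z: "split_tx z = (t, x)" "t \<in> {0<..<T}" "x \<in> \<O>" using that U by (auto simp: split_tx_def t_def x_def)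
      have Vx: "0 < V x" using Vpos z by blast
      show ?thesis
      proof (cases "x \<in> exhaustion \<O> n")
        case True
        then have "\<bar>u (t, x)\<bar> \<le> k * V x" using k[of "(t, x)"] z(2) Vx by (simp add: abs_divide field_simps)
        also have "\<dots> \<le> max 1 k * V x" using Vx by (intro mult_right_mono) auto
        finally show ?thesis by (simp add: z x_def)
      next
        case False
        then have "\<bar>u (t, x)\<bar> \<le> 1 * V x" using n(2) z by blast
        also have "\<dots> \<le> max 1 k * V x" using Vx by (intro mult_right_mono) auto
        finally show ?thesis by (simp add: z x_def)
      qed
    qed
    then show ?thesis by blast
  qed
  have localize: "local_subsolution U L w" if "viscosity_subsolution U L w" "\<And>z. z \<in> U \<Longrightarrow> w z \<le> k * V (space_part z)" for w k
    unfolding local_subsolution_def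
  proof (intro ballI allI impI, elim conjE)
    fix z f g A r
    assume *: "z \<in> U" "has_C2_witness U f g A" "f z = w z" "0 < r" "\<forall>y\<in>U. dist y z < r \<longrightarrow> w y \<le> f y"
    show "L z (w z) (g z) (A z) \<le> 0"
      by (rule viscosity_subsolution_local_test[OF openU that(1)
          has_C2_witness_mult[OF has_C2_witness_const[of U k] wB] that(2) *(2,1,3,4)]) (use *(5) in auto)
  qed
  define w1 where "w1 z = u1 (split_tx z)" for z
  define w2 where "w2 z = - u2 (split_tx z)" for z
  have sub1: "local_subsolution U L w1"
  proof -
    obtain k where "\<forall>z\<in>U. \<bar>u1 (split_tx z)\<bar> \<le> k * V (space_part z)" using dominated[OF cont1 lim1] by blast
    then show ?thesis using sub unfolding K U_def[symmetric]
      by (intro localize[of _ k]) (auto simp: w1_def[abs_def])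
  qed
  have sub2: "local_subsolution U L w2"
  proof -
    obtain k where "\<forall>z\<in>U. \<bar>u2 (split_tx z)\<bar> \<le> k * V (space_part z)" using dominated[OF cont2 lim2] by blast
    moreover have "viscosity_subsolution U L w2"
      unfolding w2_def[abs_def]
      by (rule viscosity_supersolution_uminus[OF openU]) (use super in \<open>auto simp: K U_def L_def linear_operator_uminus\<close>)
    ultimately show ?thesis
      by (intro localize[of _ k]) (auto simp: w2_def)
  qed
  have split_cont: "continuous_on U (\<lambda>z. u (split_tx z))" if "continuous_on ({0..T} \<times> \<O>) u" for u :: "_ \<Rightarrow> real"
    unfolding U_def by (rule continuous_on_image_join_tx) (rule continuous_on_subset[OF that], auto)
  have contw: "continuous_on U w1" "continuous_on U w2"
    unfolding w1_def[abs_def] w2_def[abs_def] by (intro continuous_intros split_cont cont1 cont2)+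
  define q where "q p = (u1 p - u2 p) * (T - fst p) * exp (- \<rho> * fst p) / V (snd p)" for p
  define \<delta> where "\<delta> = q (t0, x0)"
  have \<delta>: "0 < \<delta>" using less t0 Vpos[OF x0] by (simp add: \<delta>_def q_def)
  \<comment> \<open>Outside \<open>exhaustion \<O> n\<close> the two solutions then contribute at
    most \<open>2 * \<epsilon> * (T * exp (\<bar>\<rho>\<bar> * T)) = \<delta> / 2\<close> to
    \<open>q\<close>, less than its value at \<open>(t0, x0)\<close>; so the maximum over the
    compact part is global.\<close>
  define \<epsilon> where "\<epsilon> = \<delta> / (4 * (T * exp (\<bar>\<rho>\<bar> * T)))"
  have \<epsilon>: "0 < \<epsilon>" using \<delta> T by (simp add: \<epsilon>_def)
  obtain n where n: "n \<ge> 1"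
    and out1: "\<And>t x. t \<in> {0<..<T} \<Longrightarrow> x \<in> \<O> - exhaustion \<O> n \<Longrightarrow> \<bar>u1 (t, x)\<bar> \<le> \<epsilon> * V x"
    and out2: "\<And>t x. t \<in> {0<..<T} \<Longrightarrow> x \<in> \<O> - exhaustion \<O> n \<Longrightarrow> \<bar>u2 (t, x)\<bar> \<le> \<epsilon> * V x"
    using eventually_happens'[OF sequentially_bot eventually_conj[OF eventually_ge_at_top[of 1]
      eventually_conj[OF outside_exhaustion_bound[OF lim1 Vpos \<epsilon>] outside_exhaustion_bound[OF lim2 Vpos \<epsilon>]]]] by blast
  have out: "q (t, x) < \<delta>" if "t \<in> {0<..<T}" "x \<in> \<O> - exhaustion \<O> n" for t x
  proof -
    have Vx: "0 < V x" using Vpos that by blast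
    have "(u1 (t, x) - u2 (t, x)) / V x \<le> 2 * \<epsilon>"
      using out1[OF that] out2[OF that] Vx by (simp add: field_simps)
    then have "q (t, x) \<le> 2 * \<epsilon> * ((T - t) * exp (- \<rho> * t))"
      using that mult_right_mono[of "(u1 (t, x) - u2 (t, x)) / V x" "2 * \<epsilon>" "(T - t) * exp (- \<rho> * t)"]
      by (simp add: q_def)
    also have "\<dots> \<le> 2 * \<epsilon> * (T * exp (\<bar>\<rho>\<bar> * T))"
    proof -
      have "- \<rho> * t \<le> \<bar>\<rho>\<bar> * t" using that by (intro mult_right_mono) auto
      also have "\<dots> \<le> \<bar>\<rho>\<bar> * T" using that by (intro mult_left_mono) auto
      finally show ?thesis using that \<epsilon> by (intro mult_left_mono mult_mono) auto
    qed
    also have "\<dots> = \<delta> / 2" using T by (simp add: \<epsilon>_def)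
    finally show ?thesis using \<delta> by simp
  qed
  have sub: "exhaustion \<O> n \<subseteq> \<O>" by (auto simp: exhaustion_def)
  have "(t0, x0) \<in> {0..T} \<times> exhaustion \<O> n"
    using out[OF t0, of x0] x0 t0 by (auto simp: \<delta>_def)
  moreover have "continuous_on ({0..T} \<times> exhaustion \<O> n) q"
    unfolding q_def[abs_def] using sub Vpos
    by (intro continuous_intros continuous_on_subset[OF cont1] continuous_on_subset[OF cont2]
        continuous_on_compose2[OF contV]) force+
  ultimately have "\<exists>p\<in>{0..T} \<times> exhaustion \<O> n. \<forall>p'\<in>{0..T} \<times> exhaustion \<O> n. q p' \<le> q p"
    by (intro continuous_attains_sup compact_Times compact_Icc compact_exhaustion n) auto
  then obtain p where p: "p \<in> {0..T} \<times> exhaustion \<O> n" "\<And>p'. p' \<in> {0..T} \<times> exhaustion \<O> n \<Longrightarrow> q p' \<le> q p"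
    by blast
  define \<theta> where "\<theta> = q p"
  have "\<delta> \<le> \<theta>" unfolding \<theta>_def \<delta>_def by (rule p(2)) fact
  then have \<theta>: "0 < \<theta>" using \<delta> by simp
  obtain tp xp where tx: "p = (tp, xp)" by (cases p)
  have xp: "xp \<in> \<O>" using p(1) sub tx by auto
  have "tp \<noteq> 0" using \<theta> init[OF xp] by (auto simp: \<theta>_def q_def tx)
  moreover have "tp \<noteq> T" using \<theta> by (auto simp: \<theta>_def q_def tx)
  ultimately have tp: "tp \<in> {0<..<T}" using p(1) tx by auto
  have q_le: "q (t, x) \<le> \<theta>" if "t \<in> {0<..<T}" "x \<in> \<O>" for t x
  proof (cases "x \<in> exhaustion \<O> n")
    case True
    then show ?thesis using p(2)[of "(t, x)"] that by (simp add: \<theta>_def)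
  next
    case False
    then show ?thesis using out[of t x] that \<open>\<delta> \<le> \<theta>\<close> by simp
  qed
  define f where "f t = \<theta> * exp (\<rho> * t) / (T - t)" for t
  \<comment> \<open>The exponential alone contributes \<open>\<rho>\<close>, which merely balances
    the inequality for \<open>V\<close>; the summand \<open>1 / (T - t)\<close> makes the barrier
    strict.\<close>
  define f' where "f' t = f t * (\<rho> + 1 / (T - t))" for t
  define f'' where "f'' t = f' t * (\<rho> + 1 / (T - t)) + f t / (T - t)\<^sup>2" for t
  have f_deriv: "(f has_real_derivative f' t) (at t)" if "t < T" for t
    unfolding f_def[abs_def] f'_def using that
    by (auto intro!: derivative_eq_intros simp: field_simps f_def)
  have f'_deriv: "(f' has_real_derivative f'' t) (at t)" if "t < T" for t
  proof -
    have "((\<lambda>t. \<rho> + 1 / (T - t)) has_real_derivative 1 / (T - t)\<^sup>2) (at t)"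
      using that by (auto intro!: derivative_eq_intros simp: power2_eq_square)
    from DERIV_mult[OF f_deriv[OF that] this] show ?thesis
      by (simp add: f'_def[abs_def] f''_def)
  qed
  have contf'': "continuous_on ((\<lambda>z. z $ None) ` U) f''"
    unfolding f''_def[abs_def] f'_def f_def by (intro continuous_intros) (auto simp: U)
  have wf: "has_C2_witness U (\<lambda>z. f (z $ None)) (\<lambda>z. f' (z $ None) *\<^sub>R axis None 1)
    (\<lambda>z. f'' (z $ None) *\<^sub>R outer (axis None 1) (axis None 1))"
    by (rule has_C2_witness_time) (auto simp: U intro!: f_deriv f'_deriv contf'')
  note w\<Psi> = has_C2_witness_mult[OF wf wB]
  define zh where "zh = join_tx (tp, xp)"
  have zh: "zh \<in> U" "split_tx zh = (tp, xp)" "zh $ None = tp" "space_part zh = xp"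
    using tp xp by (simp_all add: U zh_def)
  have q_eq: "q (t, x) * f t * V x = \<theta> * (u1 (t, x) - u2 (t, x))" if "t \<in> {0<..<T}" "x \<in> \<O>" for t x
    using that Vpos[OF that(2)] by (simp add: q_def f_def exp_minus field_simps)
  have fpos: "0 < f t" if "t \<in> {0<..<T}" for t using that \<theta> by (simp add: f_def)
  have "w1 zh + w2 zh = f (zh $ None) * V (space_part zh)"
    using q_eq[OF tp xp] \<theta> unfolding tx[symmetric] \<theta>_def[symmetric]
    by (simp add: w1_def w2_def zh tx[symmetric])
  moreover have "w1 z + w2 z \<le> f (z $ None) * V (space_part z)" if "z \<in> U" for z
  proof -
    define t x where "t = z $ None" and "x = space_part z"
    have z: "t \<in> {0<..<T}" "x \<in> \<O>" using that U by (auto simp: t_def x_def)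
    have "q (t, x) * (f t * V x) \<le> \<theta> * (f t * V x)"
      using q_le[OF z] fpos[OF z(1)] Vpos[OF z(2)] by (intro mult_right_mono) auto
    then have "\<theta> * (u1 (t, x) - u2 (t, x)) \<le> \<theta> * (f t * V x)" using q_eq[OF z] by simp
    then have "u1 (t, x) - u2 (t, x) \<le> f t * V x" using \<theta> by simp
    then show ?thesis by (simp add: w1_def w2_def split_tx_def t_def x_def)
  qed
  ultimately have "L zh (f (zh $ None) * V (space_part zh))
      (f (zh $ None) *\<^sub>R join_tx (0, grad V (space_part zh)) + V (space_part zh) *\<^sub>R f' (zh $ None) *\<^sub>R axis None 1)
      (f (zh $ None) *\<^sub>R B zh + V (space_part zh) *\<^sub>R f'' (zh $ None) *\<^sub>R outer (axis None 1) (axis None 1)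
        + outer (f' (zh $ None) *\<^sub>R axis None 1) (join_tx (0, grad V (space_part zh)))
        + outer (join_tx (0, grad V (space_part zh))) (f' (zh $ None) *\<^sub>R axis None 1)) \<le> 0"
    unfolding L_def
  proof (intro linear_operator_sum_of_subsolutions[OF openU zh(1) _ _ _ _ contw(1) _ contw(2) w\<Psi>])
    show "continuous_on U (\<lambda>z. v (split_tx z))" unfolding U_def by (rule continuous_on_image_join_tx[OF v])
    show "locally_lipschitz_on U \<beta>" unfolding U_def \<beta>_def by (rule locally_lipschitz_drift_field[OF \<mu>])
    show "locally_lipschitz_on U (\<tau> k)" for k unfolding U_def \<tau>_def by (rule locally_lipschitz_noise_field[OF \<sigma>])
  qed (use sub1 sub2 in \<open>simp_all add: L_def\<close>)
  \<comment> \<open>\<open>\<tau> k\<close> has no time component, so the second time derivative and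
    the mixed terms in the Hessian of the product drop out.\<close>
  moreover have "\<tau> k zh \<bullet> ((f (zh $ None) *\<^sub>R B zh + V (space_part zh) *\<^sub>R f'' (zh $ None) *\<^sub>R outer (axis None 1) (axis None 1)
        + outer (f' (zh $ None) *\<^sub>R axis None 1) (join_tx (0, grad V (space_part zh)))
        + outer (join_tx (0, grad V (space_part zh))) (f' (zh $ None) *\<^sub>R axis None 1)) *v \<tau> k zh)
      = f tp * (column k (\<sigma> (tp, xp)) \<bullet> (hess V xp *v column k (\<sigma> (tp, xp))))" for k
    by (simp add: matrix_vector_mult_add_rdistrib scaleR_matrix_vector_assoc[symmetric] outer_mult_vec B
        inner_add_right zh \<tau>_def noise_field_def inner_axis inner_axis' inner_time_space[of "join_tx _" "join_tx _"])
  moreover have "\<beta> zh \<bullet> (f (zh $ None) *\<^sub>R join_tx (0, grad V (space_part zh)) + V (space_part zh) *\<^sub>R f' (zh $ None) *\<^sub>R axis None 1)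
      = V xp * f' tp - f tp * (\<mu> (tp, xp) \<bullet> grad V xp)"
    by (simp add: inner_add_right zh \<beta>_def drift_field_def inner_axis inner_time_space[of "join_tx _" "join_tx _"])
  ultimately have "V xp * f' tp - f tp * (v (tp, xp) * V xp + \<mu> (tp, xp) \<bullet> grad V xp
      + trace (\<sigma> (tp, xp) ** transpose (\<sigma> (tp, xp)) ** hess V xp)) \<le> 0"
    unfolding L_def linear_operator_def by (simp add: zh trace_sandwich sum_distrib_left algebra_simps)
  moreover have "f tp * (v (tp, xp) * V xp + \<mu> (tp, xp) \<bullet> grad V xp
      + trace (\<sigma> (tp, xp) ** transpose (\<sigma> (tp, xp)) ** hess V xp)) \<le> f tp * (\<rho> * V xp)"
    using lyap[OF tp xp] fpos[OF tp] by (intro mult_left_mono) auto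
  moreover have "V xp * f' tp = f tp * (\<rho> * V xp) + V xp * f tp / (T - tp)"
    by (simp add: f'_def algebra_simps)
  moreover have "0 < V xp * f tp / (T - tp)" using fpos[OF tp] Vpos[OF xp] tp by simp
  ultimately show False by linarith
qed

text \<open>Functions on \<open>{0..T} \<times> \<O>\<close> are represented by total ones;
  \<open>extensional\<close> fixes their values elsewhere, so that equality means equality on this
  set.\<close>

theorem corollary4p14:
  fixes T \<rho> :: real
    and \<O> :: "(real^'d) set"
    and \<phi> :: "real^'d \<Rightarrow> real"
    and v :: "real \<times> (real^'d) \<Rightarrow> real"
    and \<mu> :: "real \<times> (real^'d) \<Rightarrow> real^'d"
    and \<sigma> :: "real \<times> (real^'d) \<Rightarrow> real^'m^'d"
    and V :: "real^'d \<Rightarrow> real"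
  assumes "0 < T"
    and "open \<O>"
    and "continuous_on \<O> \<phi>"
    and "continuous_on ({0<..<T} \<times> \<O>) v"
    and "locally_lipschitz_on ({0<..<T} \<times> \<O>) \<mu>"
    and "locally_lipschitz_on ({0<..<T} \<times> \<O>) \<sigma>"
    and "C2_on \<O> V"
    and "\<forall>x\<in>\<O>. 0 < V x"
    and "\<forall>t\<in>{0<..<T}. \<forall>x\<in>\<O>.
           v (t, x) * V x + \<mu> (t, x) \<bullet> grad V x
             + trace (\<sigma> (t, x) ** transpose (\<sigma> (t, x)) ** hess V x) \<le> \<rho> * V x"
  shows "\<exists>\<^sub>\<le>\<^sub>1 u :: real \<times> (real^'d) \<Rightarrow> real.
           u \<in> extensional ({0..T} \<times> \<O>) \<and>
           continuous_on ({0..T} \<times> \<O>) u \<and>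
           (\<forall>x\<in>\<O>. u (0, x) = \<phi> x) \<and>
           (\<lambda>n. SUP (t, x) \<in> {0<..<T} \<times> (\<O> - exhaustion \<O> n). ereal (\<bar>u (t, x)\<bar> / V x))
             \<longlonglongrightarrow> 0 \<and>
           viscosity_solution (join_tx ` ({0<..<T} \<times> \<O>)) (kolmogorov_operator v \<mu> \<sigma>)
             (\<lambda>z. u (split_tx z))"
    (is "\<exists>\<^sub>\<le>\<^sub>1 u. ?P u")
proof (rule Uniq_I)
  fix u w assume u: "?P u" and w: "?P w"
  have le: "u1 (t, x) \<le> u2 (t, x)" if "?P u1" "?P u2" "t \<in> {0<..<T}" "x \<in> \<O>" for u1 u2 t x
    using that assms
    by (intro viscosity_comparison[of T \<O> v \<mu> \<sigma> V \<rho> u1 u2 t x]) (auto simp: viscosity_solution_def)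
  have open_eq: "u (t, x) = w (t, x)" if "t \<in> {0<..<T}" "x \<in> \<O>" for t x
    using le[OF u w that] le[OF w u that] by simp
  have "u p = w p" if "p \<in> {0..T} \<times> \<O>" for p
  proof -
    obtain t x where p: "p = (t, x)" "t \<in> {0..T}" "x \<in> \<O>" using \<open>p \<in> {0..T} \<times> \<O>\<close> by auto
    have cont: "continuous_on {0..T} (\<lambda>t. u (t, x))" "continuous_on {0..T} (\<lambda>t. w (t, x))"
      using u w p(3) by (auto intro!: continuous_on_compose2[of "{0..T} \<times> \<O>"] continuous_intros)
    \<comment> \<open>Comparison covers the open time interval; continuity in time carries the
      equality to both end points.\<close>
    have "closure {0<..<T} = {0..T}" using \<open>0 < T\<close> by simp
    moreover have "u (s, x) - w (s, x) = 0" if "s \<in> {0<..<T}" for s using open_eq[OF that p(3)] by simp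
    ultimately have "u (t, x) - w (t, x) = 0"
      using continuous_constant_on_closure[of "{0<..<T}" "\<lambda>t. u (t, x) - w (t, x)" 0 t] cont p(2)
      by (simp add: continuous_on_diff)
    then show ?thesis by (simp add: p)
  qed
  with u w show "u = w" by (intro extensionalityI[of u "{0..T} \<times> \<O>" w]) auto
qed

end
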